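(* For each irrational $\theta\in(0,1)$, the function $\tau\mapsto\dim_H\mathcal U_\tau[\theta]$ is continuous on $(0,1)\cup(1,\infty)$.
   Context: $\mathbb T=\mathbb R/\mathbb Z$; points identified with fractional parts. $\|t\|$ is the distance from $t$ to the nearest integer. For $\tau>0$, $\mathcal U_\tau[\theta]$ is the set of $y\in\mathbb T$ such that there exists $Q_0$ with: for every real $Q\ge Q_0$ there is an integer $1\le n\le Q$ with $\|n\theta-y\|<Q^{-\tau}$. *)

theory Defs
  imports "HOL-Analysis.Analysis"
begin

definition nint_dist :: "real \<Rightarrow> real" where
  "nint_dist t = min (frac t) (1 - frac t)"

definition hausdorff_content :: "real \<Rightarrow> real \<Rightarrow> real set \<Rightarrow> ennreal" where
  "hausdorff_content s \<delta> A =
     (INF C \<in> {C :: nat \<Rightarrow> real set. A \<subseteq> (\<Union>i. C i) \<and>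
                 (\<forall>i. bounded (C i) \<and> diameter (C i) \<le> \<delta>)}.
        \<Sum>i. ennreal (diameter (C i) powr s))"

definition hausdorff_measure :: "real \<Rightarrow> real set \<Rightarrow> ennreal" where
  "hausdorff_measure s A = (SUP \<delta> \<in> {0<..}. hausdorff_content s \<delta> A)"

definition hausdorff_dim :: "real set \<Rightarrow> real" where
  "hausdorff_dim A = Inf {s. 0 \<le> s \<and> hausdorff_measure s A = 0}"

(* U_tau[theta], with points of T = R/Z represented by their fractional parts in [0,1) *)
definition U_set :: "real \<Rightarrow> real \<Rightarrow> real set" where
  "U_set \<tau> \<theta> = {y \<in> {0..<1}. \<exists>Q0::real. \<forall>Q::real. Q \<ge> Q0 \<longrightarrow>
      (\<exists>n::nat. 1 \<le> n \<and> real n \<le> Q \<and> nint_dist (real n * \<theta> - y) < Q powr (- \<tau>))}"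

end

theory Submission
  imports Defs
begin

text \<open>
  Let \<open>q\<^sub>k\<close> be the best approximation denominators of \<open>\<theta>\<close>. For \<open>q\<^sub>k \<le> Q < q\<^sub>k\<^sub>+\<^sub>1\<close> the points
  \<open>n\<theta>\<close>, \<open>n \<le> Q\<close>, form \<open>q\<^sub>k\<close> clusters of about \<open>Q/q\<^sub>k\<close> points with spacing about \<open>1/q\<^sub>k\<^sub>+\<^sub>1\<close>. The
  neighbourhood of radius \<open>Q\<^sup>-\<^sup>\<tau>\<close> of a cluster is shortest at \<open>Q = (q\<^sub>k q\<^sub>k\<^sub>+\<^sub>1)\<^sup>1\<^sup>/\<^sup>(\<^sup>1\<^sup>+\<^sup>\<tau>\<^sup>)\<close>, where
  its length is \<open>ell \<tau> k = (q\<^sub>k q\<^sub>k\<^sub>+\<^sub>1)\<^sup>-\<^sup>\<tau>\<^sup>/\<^sup>(\<^sup>1\<^sup>+\<^sup>\<tau>\<^sup>)\<close> up to a constant. With \<open>L \<tau> k\<close> the median of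
  \<open>1/q\<^sub>k\<close>, \<open>1/q\<^sub>k\<^sub>+\<^sub>1\<close> and \<open>ell \<tau> k\<close>, the set \<open>U_set \<tau> \<theta>\<close> looks at stage \<open>k\<close> like
  \<open>M \<tau> k = (\<Prod>j<k. q\<^sub>j\<^sub>+\<^sub>1 L \<tau> j)\<close> intervals of length \<open>L \<tau> k\<close>, so its dimension should be
  \<open>liminf\<close> of \<open>ln (M \<tau> k) / - ln (L \<tau> k)\<close>. Constant factors are absorbed by changing \<open>\<tau>\<close>
  slightly: coverings bound the dimension from above by the \<open>liminf\<close> for any smaller exponent, and
  Cantor subsets bound it from below by the \<open>liminf\<close> for any larger one. On either side of \<open>1\<close>, an
  index \<open>k\<close> at which \<open>L \<tau> k\<close> depends on \<open>\<tau>\<close> satisfies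
  \<open>ln q\<^sub>k\<^sub>+\<^sub>1 - ln q\<^sub>k \<ge> c ln q\<^sub>k\<^sub>+\<^sub>1\<close> for some \<open>c > 0\<close>, so the changes of \<open>ln (L \<tau> j)\<close> sum up telescopically
  and the quotients are equicontinuous in \<open>\<tau>\<close> uniformly in \<open>k\<close>.
\<close>

section \<open>Hausdorff dimension of subsets of the unit interval\<close>

text \<open>No mesh bound appears: for \<open>t > 0\<close> a small sum already forces every single
  diameter to be small, so this is the vanishing of \<open>hausdorff_measure t A\<close> freed from
  \<open>\<delta>\<close>.\<close>

definition hnull :: "real \<Rightarrow> real set \<Rightarrow> bool" where
  "hnull t A \<longleftrightarrow> (\<forall>e>0. \<exists>C::nat \<Rightarrow> real set. A \<subseteq> (\<Union>i. C i) \<and> (\<forall>i. bounded (C i)) \<and>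
      (\<Sum>i. ennreal (diameter (C i) powr t)) \<le> ennreal e)"

lemma ennreal_le_suminf:
  fixes f :: "nat \<Rightarrow> ennreal"
  shows "f i \<le> (\<Sum>i. f i)"
proof -
  have "sum f {i} \<le> (\<Sum>i. f i)" by (rule sum_le_suminf) auto
  then show ?thesis by simp
qed

lemma hnullE:
  assumes "hnull t A" "0 < e"
  obtains C :: "nat \<Rightarrow> real set" where "A \<subseteq> (\<Union>i. C i)" "\<And>i. bounded (C i)"
    "(\<Sum>i. ennreal (diameter (C i) powr t)) \<le> ennreal e"
  using assms unfolding hnull_def by metis

lemma hausdorff_measure_hnull:
  assumes "0 < t" "hnull t A"
  shows "hausdorff_measure t A = 0"
proof -
  have "hausdorff_content t \<delta> A \<le> 0" if "0 < \<delta>" for \<delta>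
  proof (rule ennreal_le_epsilon)
    fix e :: real assume "0 < e"
    \<comment> \<open>Capping the whole sum by \<open>\<delta> powr t\<close> keeps each single
      diameter at most \<open>\<delta>\<close>.\<close>
    define e' where "e' = min e (\<delta> powr t)"
    have "0 < e'" using \<open>0 < e\<close> that by (simp add: e'_def)
    with assms(2) obtain C :: "nat \<Rightarrow> real set" where C: "A \<subseteq> (\<Union>i. C i)" "\<And>i. bounded (C i)"
      "(\<Sum>i. ennreal (diameter (C i) powr t)) \<le> ennreal e'"
      by (rule hnullE) blast
    have "diameter (C i) \<le> \<delta>" for i
    proof -
      have "ennreal (diameter (C i) powr t) \<le> (\<Sum>i. ennreal (diameter (C i) powr t))"
        by (rule ennreal_le_suminf)
      also note C(3)
      finally have "diameter (C i) powr t \<le> e'" using \<open>0 < e'\<close> by (simp add: ennreal_le_iff)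
      then have "diameter (C i) powr t \<le> \<delta> powr t" by (simp add: e'_def)
      then show ?thesis using \<open>0 < t\<close> that by (meson not_le powr_less_mono2 order.strict_implies_order)
    qed
    then have "hausdorff_content t \<delta> A \<le> (\<Sum>i. ennreal (diameter (C i) powr t))"
      unfolding hausdorff_content_def using C by (intro INF_lower) auto
    also have "\<dots> \<le> ennreal e" using C(3) by (rule order_trans) (simp add: e'_def ennreal_leI)
    finally show "hausdorff_content t \<delta> A \<le> 0 + ennreal e" by simp
  qed
  then show ?thesis unfolding hausdorff_measure_def
    by (metis SUP_least bot.extremum_uniqueI bot_ennreal greaterThan_iff)
qed

lemma hausdorff_dim_le:
  assumes "0 \<le> s" "\<And>t. s < t \<Longrightarrow> hnull t A"
  shows "hausdorff_dim A \<le> s"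
proof (rule field_le_epsilon)
  fix e :: real assume "0 < e"
  then have "hausdorff_measure (s + e) A = 0"
    using assms by (intro hausdorff_measure_hnull) auto
  then show "hausdorff_dim A \<le> s + e"
    unfolding hausdorff_dim_def using assms(1) \<open>0 < e\<close> by (intro cInf_lower bdd_belowI[of _ 0]) auto
qed

lemma hnull_UN:
  assumes "\<And>n::nat. hnull t (A n)"
  shows "hnull t (\<Union>n. A n)"
  unfolding hnull_def
proof (intro allI impI)
  fix e :: real assume e: "0 < e"
  have "\<exists>C::nat \<Rightarrow> real set. A n \<subseteq> (\<Union>i. C i) \<and> (\<forall>i. bounded (C i)) \<and>
      (\<Sum>i. ennreal (diameter (C i) powr t)) \<le> ennreal (e * (1/2)^Suc n)" for n
    using assms[of n] e unfolding hnull_def by simp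
  then obtain C :: "nat \<Rightarrow> nat \<Rightarrow> real set" where C: "\<And>n. A n \<subseteq> (\<Union>i. C n i)" "\<And>n i. bounded (C n i)"
      "\<And>n. (\<Sum>i. ennreal (diameter (C n i) powr t)) \<le> ennreal (e * (1/2)^Suc n)" by metis
  let ?D = "\<lambda>k. case prod_decode k of (n,i) \<Rightarrow> C n i"
  have "(\<Union>n. A n) \<subseteq> (\<Union>k. ?D k)"
  proof
    fix x assume "x \<in> (\<Union>n. A n)"
    then obtain n i where "x \<in> C n i" using C(1) by blast
    then have "x \<in> ?D (prod_encode (n,i))" by simp
    then show "x \<in> (\<Union>k. ?D k)" by (rule UN_I[OF UNIV_I])
  qed
  moreover have "\<forall>k. bounded (?D k)" using C(2) by (auto split: prod.split)
  moreover have "(\<Sum>k. ennreal (diameter (?D k) powr t)) \<le> ennreal e"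
  proof -
    have "(\<Sum>k. ennreal (diameter (?D k) powr t)) =
        (\<Sum>k. (\<lambda>(n,i). ennreal (diameter (C n i) powr t)) (prod_decode k))"
      by (intro suminf_cong) (simp only: split_beta)
    also have "\<dots> = (\<Sum>n. \<Sum>i. ennreal (diameter (C n i) powr t))"
      by (rule suminf_ennreal_2dimen) (simp only: prod.case)
    also have "\<dots> \<le> (\<Sum>n. ennreal (e * (1/2)^Suc n))"
      using C(3) by (intro suminf_le) auto
    also have "\<dots> = ennreal e"
    proof (rule suminf_ennreal_eq)
      show "(\<lambda>n. e * (1/2)^Suc n) sums e" using sums_mult[OF power_half_series, of e] by simp
    qed (use e in simp)
    finally show ?thesis .
  qed
  ultimately show "\<exists>C::nat \<Rightarrow> real set. (\<Union>n. A n) \<subseteq> (\<Union>i. C i) \<and> (\<forall>i. bounded (C i)) \<and>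
      (\<Sum>i. ennreal (diameter (C i) powr t)) \<le> ennreal e" by blast
qed

text \<open>Upper bounds come from counting: the covers built later are finitely many balls of one
  radius.\<close>

lemma hnullI:
  assumes "0 < t"
    and "\<And>e. 0 < e \<Longrightarrow> \<exists>X r. finite X \<and> 0 \<le> r \<and> A \<subseteq> (\<Union>x\<in>X. cball x r) \<and> real (card X) * (2 * r) powr t \<le> e"
  shows "hnull t A"
  unfolding hnull_def
proof (intro allI impI)
  fix e :: real assume "0 < e"
  from assms(2)[OF this] obtain X r where X: "finite X" "0 \<le> r" "A \<subseteq> (\<Union>x\<in>X. cball x r)"
      "real (card X) * (2 * r) powr t \<le> e" by (elim exE conjE)
  obtain g where g: "bij_betw g {..<card X} X"
    using ex_bij_betw_nat_finite[OF X(1)] by (auto simp: atLeast0LessThan)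
  \<comment> \<open>Beyond the last ball the sequence is padded with the empty set, whose term is
    \<open>0 powr t = 0\<close>.\<close>
  let ?C = "\<lambda>i. if i < card X then cball (g i) r else {}"
  have "A \<subseteq> (\<Union>i. ?C i)"
  proof
    fix y assume "y \<in> A"
    then obtain x where "x \<in> X" "y \<in> cball x r" using X by blast
    moreover then obtain i where "i < card X" "g i = x" using g by (force simp: bij_betw_def)
    ultimately show "y \<in> (\<Union>i. ?C i)" by (auto intro!: exI[of _ i])
  qed
  moreover have "(\<Sum>i. ennreal (diameter (?C i) powr t)) \<le> ennreal e"
  proof -
    have "(\<Sum>i. ennreal (diameter (?C i) powr t)) = (\<Sum>i<card X. ennreal (diameter (?C i) powr t))"
      by (rule suminf_finite) simp_all
    also have "\<dots> = (\<Sum>i<card X. ennreal ((2*r) powr t))"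
      using X(2) by (intro sum.cong) (auto simp: diameter_cball)
    also have "\<dots> = ennreal (real (card X) * (2 * r) powr t)"
      by (simp add: ennreal_mult ennreal_of_nat_eq_real_of_nat)
    also have "\<dots> \<le> ennreal e" using X(4) by (rule ennreal_leI)
    finally show ?thesis .
  qed
  ultimately show "\<exists>C::nat \<Rightarrow> real set. A \<subseteq> (\<Union>i. C i) \<and> (\<forall>i. bounded (C i)) \<and>
      (\<Sum>i. ennreal (diameter (C i) powr t)) \<le> ennreal e" by (intro exI[of _ ?C]) auto
qed

text \<open>Makes the set under \<open>Inf\<close> in \<open>hausdorff_dim\<close> nonempty. The
  \<open>n + 1\<close> balls of radius \<open>1 / n\<close> contribute a constant times
  \<open>n powr (1 - t)\<close>, which tends to 0.\<close>

lemma hnull_unit: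
  assumes "A \<subseteq> {0..<1}" "1 < t"
  shows "hnull t A"
proof (rule hnullI)
  show "0 < t" using assms by simp
  fix e :: real assume "0 < e"
  have "((\<lambda>n. 2 * (2 powr t * real n powr (1 - t))) \<longlongrightarrow> 2 * (2 powr t * 0)) at_top"
    using assms(2) by (intro tendsto_intros tendsto_neg_powr filterlim_real_sequentially) auto
  then have "\<forall>\<^sub>F n in at_top. 2 * (2 powr t * real n powr (1 - t)) < e"
    using \<open>0 < e\<close> by (intro order_tendstoD) auto
  then obtain n where n: "2 * (2 powr t * real n powr (1 - t)) < e" "1 \<le> n"
    using eventually_happens'[OF sequentially_bot eventually_conj[OF _ eventually_ge_at_top]] by blast
  let ?X = "(\<lambda>i. real i / real n) ` {..n}"
  have "A \<subseteq> (\<Union>x\<in>?X. cball x (1 / real n))"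
  proof
    fix y assume "y \<in> A"
    then have y: "0 \<le> y" "y < 1" using assms by auto
    define i where "i = nat \<lfloor>y * n\<rfloor>"
    have i: "real i \<le> y * n" "y * n < real i + 1" unfolding i_def using y by (simp_all add: of_nat_nat)
    have "real i \<le> n" using i y mult_right_mono[of y 1 "real n"] by linarith
    moreover have "\<bar>real i / n - y\<bar> \<le> 1 / n" 
    proof -
      have "real i / n \<le> y" "y \<le> (real i + 1) / n" using i n by (simp_all add: pos_divide_le_eq pos_le_divide_eq)
      then show ?thesis by (simp add: add_divide_distrib abs_le_iff)
    qed
    ultimately show "y \<in> (\<Union>x\<in>?X. cball x (1 / real n))" by (auto simp: dist_real_def intro!: bexI[of _ i])
  qed
  moreover have "real (card ?X) * (2 * (1 / real n)) powr t \<le> e"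
  proof -
    have "card ?X \<le> n + 1" using card_image_le[of "{..n}" "\<lambda>i. real i / real n"] by simp
    then have "real (card ?X) \<le> 2 * real n" using n by linarith
    then have "real (card ?X) * (2 * (1 / real n)) powr t \<le> 2 * real n * (2 * (1 / real n)) powr t"
      by (rule mult_right_mono) simp
    also have "\<dots> = 2 * (2 powr t * real n powr (1 - t))"
      using n by (simp add: powr_diff powr_divide)
    finally show ?thesis using n by linarith
  qed
  ultimately show "\<exists>X r. finite X \<and> 0 \<le> r \<and> A \<subseteq> (\<Union>x\<in>X. cball x r) \<and> real (card X) * (2 * r) powr t \<le> e"
    by (intro exI[of _ ?X] exI[of _ "1 / real n"]) auto
qed

text \<open>In a cover of mesh 1 the sum at \<open>s\<close> is at most the sum at any
  \<open>t < s\<close>. A uniform positive lower bound at \<open>s\<close> therefore excludes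
  \<open>hausdorff_measure t A = 0\<close>.\<close>

lemma hausdorff_dim_ge:
  assumes "A \<subseteq> {0..<1}" "0 < c"
    and cover: "\<And>C::nat \<Rightarrow> real set. A \<subseteq> (\<Union>i. C i) \<Longrightarrow> (\<And>i. bounded (C i)) \<Longrightarrow>
      ennreal c \<le> (\<Sum>i. ennreal (diameter (C i) powr s))"
  shows "s \<le> hausdorff_dim A"
  unfolding hausdorff_dim_def
proof (rule cInf_greatest)
  have "hausdorff_measure 2 A = 0" using hausdorff_measure_hnull[OF _ hnull_unit[OF assms(1)]] by simp
  then show "{s. 0 \<le> s \<and> hausdorff_measure s A = 0} \<noteq> {}" by (auto intro!: exI[of _ 2])
  fix t assume "t \<in> {s. 0 \<le> s \<and> hausdorff_measure s A = 0}"
  then have t: "0 \<le> t" "hausdorff_measure t A = 0" by auto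
  show "s \<le> t"
  proof (rule ccontr)
    assume "\<not> s \<le> t"
    have "hausdorff_content t 1 A \<le> hausdorff_measure t A"
      unfolding hausdorff_measure_def by (rule SUP_upper) simp
    then have "hausdorff_content t 1 A < ennreal c" using t assms(2) by simp
    then obtain C :: "nat \<Rightarrow> real set" where C: "A \<subseteq> (\<Union>i. C i)" "\<And>i. bounded (C i)" "\<And>i. diameter (C i) \<le> 1"
      "(\<Sum>i. ennreal (diameter (C i) powr t)) < ennreal c"
      unfolding hausdorff_content_def INF_less_iff by auto
    have "(\<Sum>i. ennreal (diameter (C i) powr s)) \<le> (\<Sum>i. ennreal (diameter (C i) powr t))"
    proof (intro suminf_le ennreal_leI)
      fix i
      have "0 \<le> diameter (C i)" using C(2) by (rule diameter_ge_0)
      \<comment> \<open>Sets of diameter 0 satisfy the comparison because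
        \<open>0 powr x = 0\<close> for every \<open>x\<close>, also for
        \<open>x = 0\<close>.\<close>
      then show "diameter (C i) powr s \<le> diameter (C i) powr t"
        using C(3)[of i] \<open>\<not> s \<le> t\<close> by (cases "diameter (C i) = 0") (auto intro!: powr_mono')
    qed auto
    with cover[OF C(1,2)] C(4) show False by simp
  qed
qed

lemma hausdorff_dim_unit_nonneg: "A \<subseteq> {0..<1} \<Longrightarrow> 0 \<le> hausdorff_dim A"
  unfolding hausdorff_dim_def
  using hausdorff_measure_hnull[OF _ hnull_unit[of A 2]]
  by (intro cInf_greatest) (auto intro!: exI[of _ 2])

text \<open>Each covering set lies in an interval as long as its diameter, so countable
  subadditivity of Lebesgue measure applies. Serves the case in which
  \<open>U_set \<tau> \<theta>\<close> is all of \<open>{0..<1}\<close>.\<close>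

lemma hausdorff_dim_unit_interval: "1 \<le> hausdorff_dim {0..<1}"
proof (rule hausdorff_dim_ge[where c = 1])
  fix C :: "nat \<Rightarrow> real set" assume C: "{0..<1} \<subseteq> (\<Union>i. C i)" "\<And>i. bounded (C i)"
  define I where "I i = (if C i = {} then {} else {Inf (C i)..Inf (C i) + diameter (C i)})" for i
  have CI: "C i \<subseteq> I i" for i
  proof
    fix x assume x: "x \<in> C i"
    have bb: "bdd_below (C i)" using C(2) by (simp add: bounded_imp_bdd_below)
    have "Inf (C i) \<le> x" using x bb by (rule cInf_lower)
    moreover have "x - diameter (C i) \<le> Inf (C i)"
    proof (rule cInf_greatest)
      show "C i \<noteq> {}" using x by auto
      fix y assume "y \<in> C i"
      then have "dist x y \<le> diameter (C i)" using x C(2) by (simp add: diameter_bounded_bound)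
      then show "x - diameter (C i) \<le> y" by (simp add: dist_real_def)
    qed
    ultimately show "x \<in> I i" using x by (auto simp: I_def)
  qed
  have "ennreal 1 = emeasure lborel {0..<1::real}" by simp
  also have "\<dots> \<le> emeasure lborel (\<Union>i. I i)"
  proof (intro emeasure_mono)
    show "{0..<1} \<subseteq> (\<Union>i. I i)" using C(1) CI by blast
  qed (simp add: I_def)
  also have "\<dots> \<le> (\<Sum>i. emeasure lborel (I i))"
    by (intro emeasure_subadditive_countably) (auto simp: I_def)
  also have "\<dots> = (\<Sum>i. ennreal (diameter (C i) powr 1))"
    using C(2) by (intro suminf_cong) (auto simp: I_def diameter_ge_0)
  finally show "ennreal 1 \<le> (\<Sum>i. ennreal (diameter (C i) powr 1))" .
qed auto

section \<open>Cantor sets given by a tree of points\<close>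

text \<open>Cut the line from \<open>Min W\<close> onwards into half-open cells of length
  \<open>e\<close>: a cell holds at most one point of \<open>W\<close>, and \<open>W\<close> reaches
  only the first \<open>\<lfloor>d / e\<rfloor> + 1\<close> cells.\<close>

lemma card_separated_le:
  fixes W :: "real set"
  assumes fin: "finite W" and "0 < e" "0 \<le> d"
    and sep: "\<And>u v. u \<in> W \<Longrightarrow> v \<in> W \<Longrightarrow> u \<noteq> v \<Longrightarrow> e \<le> \<bar>u - v\<bar>"
    and diam: "\<And>u v. u \<in> W \<Longrightarrow> v \<in> W \<Longrightarrow> \<bar>u - v\<bar> \<le> d"
  shows "real (card W) \<le> d / e + 1"
proof (cases "W = {}")
  case False
  define a where "a = Min W"
  have a: "a \<in> W" "\<And>w. w \<in> W \<Longrightarrow> a \<le> w" using fin False by (auto simp: a_def)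
  define f where "f w = nat \<lfloor>(w - a) / e\<rfloor>" for w
  have fl: "real (f w) \<le> (w - a) / e \<and> (w - a) / e < real (f w) + 1" if "w \<in> W" for w
    unfolding f_def using a(2)[OF that] \<open>0 < e\<close> by (simp add: of_nat_nat)
  have "inj_on f W"
  proof (rule inj_onI, rule ccontr)
    fix u v assume uv: "u \<in> W" "v \<in> W" "f u = f v" "u \<noteq> v"
    have "\<bar>(u - a) / e - (v - a) / e\<bar> < 1" using fl[OF uv(1)] fl[OF uv(2)] uv(3) by linarith
    moreover have "(u - a) / e - (v - a) / e = (u - v) / e" by (simp add: diff_divide_distrib)
    ultimately have "\<bar>u - v\<bar> < e" using \<open>0 < e\<close> by (simp add: abs_divide)
    then show False using sep[OF uv(1,2,4)] by simp
  qed
  moreover have "f ` W \<subseteq> {..nat \<lfloor>d / e\<rfloor>}"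
  proof clarify
    fix w assume w: "w \<in> W"
    have "(w - a) / e \<le> d / e" using diam[OF w a(1)] \<open>0 < e\<close> by (intro divide_right_mono) auto
    then show "f w \<le> nat \<lfloor>d / e\<rfloor>" unfolding f_def by (intro nat_mono floor_mono)
  qed
  ultimately have "card W \<le> nat \<lfloor>d / e\<rfloor> + 1"
    using card_inj_on_le[of f W "{..nat \<lfloor>d / e\<rfloor>}"] by simp
  moreover have "real (nat \<lfloor>d / e\<rfloor>) \<le> d / e" using assms by simp
  ultimately show ?thesis by linarith
qed (use assms in simp)

text \<open>The ratios \<open>a / (a + b)\<close> and \<open>b / (a + b)\<close> lie in the unit
  interval and sum to 1; raising them to a power \<open>s \<le> 1\<close> does not decrease
  them.\<close>

lemma powr_add_le_add_powr:
  fixes a b s :: real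
  assumes "0 \<le> a" "0 < b" "0 < s" "s \<le> 1"
  shows "(a + b) powr s \<le> a powr s + b powr s"
proof -
  have *: "x / (a + b) \<le> x powr s / (a + b) powr s" if "0 \<le> x" "x \<le> a + b" for x
  proof (cases "x = 0")
    case False
    have "(x / (a + b)) powr 1 \<le> (x / (a + b)) powr s"
      using that False assms by (intro powr_mono') auto
    then show ?thesis using that assms False by (simp add: powr_divide)
  qed simp
  have "1 = a / (a + b) + b / (a + b)" using assms by (simp add: add_divide_distrib[symmetric])
  also have "\<dots> \<le> a powr s / (a + b) powr s + b powr s / (a + b) powr s"
    using assms by (intro add_mono *) auto
  finally show ?thesis using assms by (simp add: add_divide_distrib[symmetric] pos_le_divide_eq)
qed

lemma ennreal_add_strict_right_mono:
  assumes "a < ennreal x"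
  shows "a + ennreal x < ennreal x + ennreal x"
  using assms by (subst add.commute) (simp add: ennreal_add_left_cancel_less)

primrec tree_desc :: "(nat \<Rightarrow> 'a \<Rightarrow> 'a set) \<Rightarrow> nat \<Rightarrow> 'a \<Rightarrow> nat \<Rightarrow> 'a set" where
  "tree_desc ch k z 0 = {z}"
| "tree_desc ch k z (Suc l) = (\<Union>x\<in>tree_desc ch k z l. ch (k + l) x)"

lemma tree_desc_trans: "tree_desc ch k z (l + l') = (\<Union>x\<in>tree_desc ch k z l. tree_desc ch (k + l) x l')"
  by (induction l') (auto simp: add.assoc)

text \<open>The intervals of level \<open>i\<close> are the \<open>cball x (\<rho> i)\<close> with
  \<open>x\<close> in \<open>Y i\<close>. \<open>near\<close> nests the interval of a child in that
  of its parent, and \<open>4 * \<rho> i \<le> \<epsilon> i\<close> keeps intervals of one level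
  apart, so that parents are unique. The branching number depends on the level only; hence counting
  points replaces a measure.\<close>

locale cantor_tree =
  fixes Y :: "nat \<Rightarrow> real set" and ch :: "nat \<Rightarrow> real \<Rightarrow> real set"
    and \<rho> \<epsilon> :: "nat \<Rightarrow> real" and m :: "nat \<Rightarrow> nat" and x0 :: real
  assumes root: "x0 \<in> Y 0"
    and sep: "\<And>i x x'. x \<in> Y i \<Longrightarrow> x' \<in> Y i \<Longrightarrow> x \<noteq> x' \<Longrightarrow> \<epsilon> i \<le> \<bar>x - x'\<bar>"
    and rho_pos: "\<And>i. 0 < \<rho> i" and rho_le: "\<And>i. 4 * \<rho> i \<le> \<epsilon> i"
    and ch: "\<And>i x. x \<in> Y i \<Longrightarrow> finite (ch i x)" "\<And>i x. x \<in> Y i \<Longrightarrow> card (ch i x) = m i"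
      "\<And>i x. x \<in> Y i \<Longrightarrow> ch i x \<subseteq> Y (Suc i)"
    and near: "\<And>i x x'. x \<in> Y i \<Longrightarrow> x' \<in> ch i x \<Longrightarrow> \<bar>x' - x\<bar> \<le> \<rho> i - \<rho> (Suc i)"
    and m_pos: "\<And>i. 0 < m i"
    and eps_lim: "\<epsilon> \<longlonglongrightarrow> 0"
begin

text \<open>Points come with a whole branch \<open>x\<close>, because the applications argue with
  the centres and the parent-child relation at every level.\<close>

definition "limit_set = {y. \<exists>x. x 0 = x0 \<and> (\<forall>i. x (Suc i) \<in> ch i (x i)) \<and> (\<forall>i. x i \<in> Y i) \<and> (\<forall>i. \<bar>y - x i\<bar> \<le> \<rho> i)}"

abbreviation "X \<equiv> tree_desc ch 0 x0"

lemma desc_Y: "z \<in> Y k \<Longrightarrow> tree_desc ch k z l \<subseteq> Y (k + l)"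
  by (induction l) (use ch(3) in fastforce)+

lemma desc_finite: "z \<in> Y k \<Longrightarrow> finite (tree_desc ch k z l)"
  by (induction l) (auto intro: ch(1) subsetD[OF desc_Y])

lemma desc_near: "z \<in> Y k \<Longrightarrow> x \<in> tree_desc ch k z l \<Longrightarrow> \<bar>x - z\<bar> \<le> \<rho> k - \<rho> (k + l)"
proof (induction l arbitrary: x)
  case (Suc l)
  then obtain x' where x': "x' \<in> tree_desc ch k z l" "x \<in> ch (k + l) x'" by auto
  have "\<bar>x - x'\<bar> \<le> \<rho> (k + l) - \<rho> (Suc (k + l))" using near x' desc_Y[OF Suc.prems(1)] by blast
  with Suc.IH[OF Suc.prems(1) x'(1)] show ?case by simp
qed simp

lemma desc_card_le: "z \<in> Y k \<Longrightarrow> card (tree_desc ch k z l) \<le> (\<Prod>j=k..<k+l. m j)"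
proof (induction l)
  case (Suc l)
  have "card (tree_desc ch k z (Suc l)) \<le> (\<Sum>x\<in>tree_desc ch k z l. card (ch (k + l) x))"
    using card_UN_le[OF desc_finite[OF Suc.prems]] by simp
  also have "\<dots> = (\<Sum>x\<in>tree_desc ch k z l. m (k + l))"
    using ch(2) desc_Y[OF Suc.prems] by (intro sum.cong) auto
  also have "\<dots> \<le> (\<Prod>j=k..<k+l. m j) * m (k + l)" using Suc by simp
  finally show ?case by simp
qed simp

lemma X_Y: "X i \<subseteq> Y i" using desc_Y[OF root] by simp
lemma X_finite: "finite (X i)" using desc_finite[OF root] by simp

lemma near_unique: "x \<in> Y i \<Longrightarrow> x' \<in> Y i \<Longrightarrow> \<bar>x - x'\<bar> \<le> 2 * \<rho> i \<Longrightarrow> x = x'"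
  using sep[of x i x'] rho_pos[of i] rho_le[of i] by force

text \<open>A common child would bring two parents within \<open>2 * \<rho> i\<close>, less than
  their separation; so child sets are disjoint and the branching numbers multiply.\<close>

lemma card_X: "card (X i) = (\<Prod>j<i. m j)"
proof (induction i)
  case (Suc i)
  have "card (X (Suc i)) = (\<Sum>x\<in>X i. card (ch i x))"
    unfolding tree_desc.simps add_0
  proof (rule card_UN_disjoint)
    show "\<forall>x\<in>X i. finite (ch i x)" using ch(1) X_Y by blast
    show "\<forall>x\<in>X i. \<forall>x'\<in>X i. x \<noteq> x' \<longrightarrow> ch i x \<inter> ch i x' = {}"
    proof (intro ballI impI, rule ccontr)
      fix x x' assume x: "x \<in> X i" "x' \<in> X i" "x \<noteq> x'" and "ch i x \<inter> ch i x' \<noteq> {}"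
      then obtain w where "w \<in> ch i x" "w \<in> ch i x'" by auto
      then have "\<bar>w - x\<bar> \<le> \<rho> i - \<rho> (Suc i)" "\<bar>w - x'\<bar> \<le> \<rho> i - \<rho> (Suc i)" using near x X_Y by blast+
      then have "\<bar>x - x'\<bar> \<le> 2 * \<rho> i" using rho_pos[of "Suc i"] by linarith
      then show False using near_unique x X_Y by blast
    qed
  qed (rule X_finite)
  also have "\<dots> = (\<Sum>x\<in>X i. m i)" using ch(2) X_Y by (intro sum.cong) auto
  finally show ?case using Suc by (simp add: mult.commute)
qed simp

definition cyl :: "nat \<Rightarrow> real set" where "cyl n = (\<Union>x\<in>X n. cball x (\<rho> n))"

lemma compact_cyl: "compact (cyl n)"
  unfolding cyl_def using X_finite by (intro compact_UN) auto

lemma cyl_Suc: "cyl (Suc n) \<subseteq> cyl n"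
proof
  fix y assume "y \<in> cyl (Suc n)"
  then obtain x x' where x: "x \<in> X n" "x' \<in> ch n x" "\<bar>x' - y\<bar> \<le> \<rho> (Suc n)"
    by (auto simp: cyl_def dist_real_def)
  then have "\<bar>x' - x\<bar> \<le> \<rho> n - \<rho> (Suc n)" using near X_Y by blast
  then show "y \<in> cyl n" using x unfolding cyl_def by (auto simp: dist_real_def intro!: bexI[of _ x])
qed

lemma cyl_mono: "i \<le> j \<Longrightarrow> cyl j \<subseteq> cyl i"
  using lift_Suc_antimono_le[of cyl i j] cyl_Suc by blast

text \<open>Choose a centre \<open>x n\<close> at each level. The true parent of
  \<open>x (Suc i)\<close> lies within \<open>2 * \<rho> i\<close> of \<open>x i\<close>, hence
  equals it, and the choices form a branch.\<close>

lemma Inter_cyl: "(\<Inter>n. cyl n) \<subseteq> limit_set"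
proof
  fix y assume "y \<in> (\<Inter>n. cyl n)"
  then have "\<exists>x. x \<in> X n \<and> \<bar>y - x\<bar> \<le> \<rho> n" for n by (auto simp: cyl_def dist_real_def abs_minus_commute)
  then obtain x where x: "\<And>n. x n \<in> X n" "\<And>n. \<bar>y - x n\<bar> \<le> \<rho> n" by metis
  have "x (Suc i) \<in> ch i (x i)" for i
  proof -
    obtain z where z: "z \<in> X i" "x (Suc i) \<in> ch i z" using x(1)[of "Suc i"] by auto
    then have "\<bar>x (Suc i) - z\<bar> \<le> \<rho> i - \<rho> (Suc i)" using near X_Y by blast
    then have "\<bar>z - x i\<bar> \<le> 2 * \<rho> i" using x(2)[of i] x(2)[of "Suc i"] by linarith
    then show ?thesis using near_unique[of z i "x i"] z x(1) X_Y by blast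
  qed
  moreover have "x 0 = x0" using x(1)[of 0] by simp
  moreover have "x i \<in> Y i" for i using x(1) X_Y by blast
  ultimately show "y \<in> limit_set" unfolding limit_set_def using x(2) by blast
qed

text \<open>Nested compact sets: an open cover of \<open>limit_set\<close> already covers one finite
  level.\<close>

lemma cyl_subset_open:
  assumes "open O'" "limit_set \<subseteq> O'"
  obtains n where "cyl n \<subseteq> O'"
proof (rule ccontr)
  assume "\<not> thesis"
  then have ne: "cyl n - O' \<noteq> {}" for n using that by blast
  have "\<Inter>(range (\<lambda>n. cyl n - O')) \<noteq> {}"
    using assms(1) ne cyl_mono by (intro compact_nest compact_diff compact_cyl) auto
  then show False using Inter_cyl assms(2) by blast
qed

text \<open>A Frostman bound for the counting measure on level \<open>n\<close>, uniform in
  \<open>n\<close>. Let \<open>k\<close> be the first level with spacing at most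
  \<open>2 * D\<close>. The ancestors at level \<open>k\<close> of points of \<open>V\<close> are
  bounded in number both by the spacing and by the number \<open>m k'\<close> of siblings; the mean
  of these bounds with weights \<open>s\<close> and \<open>1 - s\<close> is what
  \<open>frost\<close> controls.\<close>

lemma count_le:
  assumes s: "0 < s" "s \<le> 1" and "0 < c"
    and frost: "\<And>i. c \<le> real (\<Prod>j<i. m j) * (real (m i) * \<epsilon> (Suc i)) powr s"
    and D: "0 < D" "\<And>u v. u \<in> V \<Longrightarrow> v \<in> V \<Longrightarrow> \<bar>u - v\<bar> \<le> D" and n: "\<epsilon> n \<le> 2 * D"
  shows "real (card (X n \<inter> V)) \<le> ((2 / \<epsilon> 0) powr s + 4 powr s / c) * real (\<Prod>j<n. m j) * D powr s"
proof -
  have eps: "0 < \<epsilon> i" for i using rho_pos[of i] rho_le[of i] by linarith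
  define N where "N = real (\<Prod>j<n. m j)"
  have "0 < N" unfolding N_def using m_pos by (simp add: prod_pos)
  define k where "k = (LEAST k. \<epsilon> k \<le> 2 * D)"
  have k: "\<epsilon> k \<le> 2 * D" "k \<le> n" unfolding k_def using n by (auto intro: LeastI Least_le)
  have "real (card (X n \<inter> V)) \<le> (2 / \<epsilon> 0) powr s * N * D powr s \<or>
        real (card (X n \<inter> V)) \<le> 4 powr s / c * N * D powr s"
  proof (cases k)
    \<comment> \<open>Now \<open>\<epsilon> 0 \<le> 2 * D\<close>, so the trivial bound by the size
      of the whole level is good enough.\<close>
    case 0
    have "card (X n \<inter> V) \<le> card (X n)" using X_finite by (intro card_mono) auto
    then have "real (card (X n \<inter> V)) \<le> N" unfolding N_def card_X of_nat_le_iff .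
    moreover have "1 \<le> (2 / \<epsilon> 0 * D) powr s"
      using k 0 eps[of 0] s by (intro ge_one_powr_ge_zero) (auto simp: field_simps)
    then have "1 \<le> (2 / \<epsilon> 0) powr s * D powr s" by (simp only: powr_mult)
    then have "N * 1 \<le> N * ((2 / \<epsilon> 0) powr s * D powr s)" using \<open>0 < N\<close> by (intro mult_left_mono) auto
    ultimately have "real (card (X n \<inter> V)) \<le> (2 / \<epsilon> 0) powr s * N * D powr s" by (simp add: mult_ac)
    then show ?thesis ..
  next
    case (Suc k')
    have k': "2 * D < \<epsilon> k'" using not_less_Least[of k' "\<lambda>k. \<epsilon> k \<le> 2 * D"] Suc unfolding k_def by auto
    define W where "W = {z \<in> X k. tree_desc ch k z (n - k) \<inter> V \<noteq> {}}"
    have finW: "finite W" unfolding W_def using X_finite by simp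
    have WY: "z \<in> W \<Longrightarrow> z \<in> Y k" for z unfolding W_def using X_Y by auto
    have Wclose: "\<bar>z - z'\<bar> \<le> D + 2 * \<rho> k" if zW: "z \<in> W" "z' \<in> W" for z z'
    proof -
      obtain u u' where u: "u \<in> tree_desc ch k z (n - k)" "u \<in> V" "u' \<in> tree_desc ch k z' (n - k)" "u' \<in> V"
        using zW unfolding W_def by auto
      have "\<bar>u - z\<bar> \<le> \<rho> k" "\<bar>u' - z'\<bar> \<le> \<rho> k"
        using desc_near[OF WY[OF zW(1)] u(1)] desc_near[OF WY[OF zW(2)] u(3)] rho_pos[of "k + (n - k)"] by linarith+
      then show ?thesis using D(2)[OF u(2,4)] by linarith
    qed
    have W1: "real (card W) \<le> 4 * D / \<epsilon> k"
    proof -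
      have "real (card W) \<le> (D + 2 * \<rho> k) / \<epsilon> k + 1"
        using D(1) rho_pos[of k] eps sep WY Wclose finW by (intro card_separated_le) auto
      also have "\<dots> = (D + 2 * \<rho> k + \<epsilon> k) / \<epsilon> k" using eps[of k] by (simp add: add_divide_distrib)
      also have "\<dots> \<le> 4 * D / \<epsilon> k" using eps[of k] k rho_le[of k] by (intro divide_right_mono) auto
      finally show ?thesis .
    qed
    \<comment> \<open>Since \<open>2 * D < \<epsilon> k'\<close>, two different parents would be too
      far apart: all of \<open>W\<close> are siblings.\<close>
    have W2: "real (card W) \<le> real (m k')"
    proof (cases "W = {}")
      case False
      then obtain w where w: "w \<in> W" by auto
      have par: "\<exists>p\<in>X k'. z \<in> ch k' p" if "z \<in> W" for z using that unfolding W_def Suc by auto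
      obtain p where p: "p \<in> X k'" "w \<in> ch k' p" using par[OF w] by auto
      have "W \<subseteq> ch k' p"
      proof
        fix z assume z: "z \<in> W"
        obtain p' where p': "p' \<in> X k'" "z \<in> ch k' p'" using par[OF z] by auto
        have pY: "p \<in> Y k'" "p' \<in> Y k'" using p p' X_Y by auto
        have "\<bar>z - p'\<bar> \<le> \<rho> k' - \<rho> k" "\<bar>w - p\<bar> \<le> \<rho> k' - \<rho> k"
          using near pY p p' unfolding Suc by blast+
        then have "\<bar>p - p'\<bar> \<le> D + 2 * \<rho> k'" using Wclose[OF z w] by linarith
        then have "\<bar>p - p'\<bar> < \<epsilon> k'" using k' rho_le[of k'] by linarith
        then have "p = p'" using sep[OF pY] by force
        then show "z \<in> ch k' p" using p' by simp
      qed
      moreover have "p \<in> Y k'" using p X_Y by blast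
      ultimately have "card W \<le> m k'" using ch(1,2)[of p k'] card_mono[of "ch k' p" W] by auto
      then show ?thesis by simp
    qed simp
    have W3: "real (card W) \<le> real (m k') * (4 * D / (real (m k') * \<epsilon> k)) powr s"
    proof (cases "card W = 0")
      case False
      \<comment> \<open>The bound \<open>W2\<close> is used with weight \<open>1 - s\<close> and
        \<open>W1\<close> with weight \<open>s\<close>.\<close>
      have "real (card W) = real (card W) powr (1 - s) * real (card W) powr s"
        using False by (simp add: powr_add[symmetric])
      also have "\<dots> \<le> real (m k') powr (1 - s) * (4 * D / \<epsilon> k) powr s"
        using W1 W2 s by (intro mult_mono powr_mono2) auto
      also have "\<dots> = real (m k') * (4 * D / (real (m k') * \<epsilon> k)) powr s"
      proof -
        have "4 * D / (real (m k') * \<epsilon> k) = (4 * D / \<epsilon> k) / real (m k')" by simp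
        then show ?thesis using m_pos[of k'] D eps[of k] by (simp add: powr_divide powr_diff powr_mult)
      qed
      finally show ?thesis .
    qed simp
    have "X n \<inter> V \<subseteq> (\<Union>z\<in>W. tree_desc ch k z (n - k))"
    proof
      fix x assume x: "x \<in> X n \<inter> V"
      have "X n = (\<Union>z\<in>X k. tree_desc ch k z (n - k))" using tree_desc_trans[of ch 0 x0 k "n - k"] k by simp
      then show "x \<in> (\<Union>z\<in>W. tree_desc ch k z (n - k))" using x unfolding W_def by auto
    qed
    then have "card (X n \<inter> V) \<le> card (\<Union>z\<in>W. tree_desc ch k z (n - k))"
      using finW desc_finite WY by (intro card_mono) auto
    also have "\<dots> \<le> (\<Sum>z\<in>W. card (tree_desc ch k z (n - k)))" by (rule card_UN_le[OF finW])
    also have "\<dots> \<le> (\<Sum>z\<in>W. \<Prod>j=k..<n. m j)"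
      using desc_card_le[OF WY, of _ "n - k"] k by (intro sum_mono) auto
    also have "\<dots> = card W * (\<Prod>j=k..<n. m j)" by simp
    finally have "real (card (X n \<inter> V)) \<le> real (card W) * real (\<Prod>j=k..<n. m j)"
      by (metis of_nat_le_iff of_nat_mult)
    also have "\<dots> \<le> real (m k') * (4 * D / (real (m k') * \<epsilon> k)) powr s * real (\<Prod>j=k..<n. m j)"
      using W3 by (rule mult_right_mono) (rule of_nat_0_le_iff)
    also have "\<dots> \<le> 4 powr s / c * N * D powr s"
    proof -
      define P where "P = real (\<Prod>j<k'. m j)"
      define R where "R = real (\<Prod>j=k..<n. m j)"
      define E where "E = (real (m k') * \<epsilon> k) powr s"
      have "{..<n} = {..<k} \<union> {k..<n}" using k by auto
      then have "(\<Prod>j<n. m j) = (\<Prod>j<k. m j) * (\<Prod>j=k..<n. m j)"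
        by (simp add: prod.union_disjoint ivl_disj_int)
      then have N: "N = P * real (m k') * R" unfolding N_def P_def R_def Suc by simp
      have cE: "c \<le> P * E" using frost[of k'] unfolding P_def E_def Suc .
      have pos: "0 < P" "0 < E" "0 < R" unfolding P_def E_def R_def using m_pos[of k'] m_pos eps[of k]
        by (auto intro!: prod_pos)
      have "real (m k') * (4 * D / (real (m k') * \<epsilon> k)) powr s * R = real (m k') * ((4 * D) powr s / E) * R"
        unfolding E_def using D eps[of k] by (subst powr_divide) auto
      also have "\<dots> = (4 powr s * D powr s) * N * (1 / (P * E))"
        unfolding N using pos D by (simp add: powr_mult)
      also have "\<dots> \<le> (4 powr s * D powr s) * N * (1 / c)"
        using cE \<open>0 < c\<close> \<open>0 < N\<close> by (intro mult_left_mono divide_left_mono) auto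
      finally show ?thesis by (simp add: R_def mult_ac)
    qed
    finally show ?thesis by blast
  qed
  moreover have "0 \<le> (2 / \<epsilon> 0) powr s * N * D powr s" "0 \<le> 4 powr s / c * N * D powr s"
    using \<open>0 < N\<close> \<open>0 < c\<close> by auto
  ultimately show ?thesis unfolding N_def[symmetric] by (auto simp: distrib_right)
qed

text \<open>Mass distribution principle: fatten a cover to an open one, pass to finitely many sets
  by compactness, and count the points of a deep level in each by \<open>count_le\<close>.\<close>

theorem limit_set_content:
  assumes s: "0 < s" "s \<le> 1" and "0 < c"
    and frost: "\<And>i. c \<le> real (\<Prod>j<i. m j) * (real (m i) * \<epsilon> (Suc i)) powr s"
  obtains c' where "0 < c'"
    "\<And>C::nat \<Rightarrow> real set. limit_set \<subseteq> (\<Union>i. C i) \<Longrightarrow> (\<And>i. bounded (C i)) \<Longrightarrow>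
      ennreal c' \<le> (\<Sum>i. ennreal (diameter (C i) powr s))"
proof -
  define \<kappa> where "\<kappa> = (2 / \<epsilon> 0) powr s + 4 powr s / c"
  have "0 < \<kappa>" unfolding \<kappa>_def using \<open>0 < c\<close> by (intro add_nonneg_pos) auto
  have main: "ennreal (1 / (2 * \<kappa>)) \<le> (\<Sum>i. ennreal (diameter (C i) powr s))"
    if C: "limit_set \<subseteq> (\<Union>i. C i)" "\<And>i. bounded (C i)" for C :: "nat \<Rightarrow> real set"
  proof (rule ccontr)
    assume "\<not> ?thesis"
    then have small: "(\<Sum>i. ennreal (diameter (C i) powr s)) < ennreal (1 / (2 * \<kappa>))" by simp
    \<comment> \<open>The fattening costs \<open>1 / (2 * \<kappa>)\<close> in total, half of the
      \<open>1 / \<kappa>\<close> that counting demands; it also makes \<open>D i\<close> positive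
      where \<open>C i\<close> is a single point.\<close>
    define \<eta> where "\<eta> i = (1 / (2 * \<kappa>) * (1/2) ^ Suc i) powr (1 / s)" for i
    have eta: "0 < \<eta> i" "\<eta> i powr s = 1 / (2 * \<kappa>) * (1/2) ^ Suc i" for i
      using \<open>0 < \<kappa>\<close> s by (simp_all add: \<eta>_def powr_powr)
    define D where "D i = diameter (C i) + \<eta> i" for i
    define V where "V i = (\<Union>x\<in>C i. ball x (\<eta> i / 2))" for i
    have D_pos: "0 < D i" for i unfolding D_def using diameter_ge_0[OF C(2)] eta(1) by (simp add: add_nonneg_pos)
    have V_diam: "\<bar>u - v\<bar> \<le> D i" if uv: "u \<in> V i" "v \<in> V i" for u v i
    proof -
      obtain x where x: "x \<in> C i" "dist x u < \<eta> i / 2" using uv(1) unfolding V_def by auto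
      obtain y where y: "y \<in> C i" "dist y v < \<eta> i / 2" using uv(2) unfolding V_def by auto
      have "dist x y \<le> diameter (C i)" using x y C(2) by (simp add: diameter_bounded_bound)
      then show ?thesis using x y unfolding D_def dist_real_def by linarith
    qed
    have "limit_set \<subseteq> (\<Union>i. V i)"
    proof
      fix y assume "y \<in> limit_set"
      then obtain i where "y \<in> C i" using C(1) by auto
      then have "y \<in> V i" unfolding V_def using eta(1)[of i] by (auto intro!: bexI[of _ y])
      then show "y \<in> (\<Union>i. V i)" by blast
    qed
    moreover have oV: "open (V i)" for i unfolding V_def by auto
    ultimately obtain n0 where n0: "cyl n0 \<subseteq> (\<Union>i. V i)" by (metis cyl_subset_open open_UN)
    obtain I where I: "I \<subseteq> UNIV" "finite I" "cyl n0 \<subseteq> (\<Union>i\<in>I. V i)"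
      using compactE_image[OF compact_cyl, of UNIV V n0] oV n0 by auto
    \<comment> \<open>As \<open>I\<close> is finite, one level \<open>n\<close> is fine enough for
      \<open>count_le\<close> at all its members.\<close>
    have "\<forall>\<^sub>F n in sequentially. \<forall>i\<in>I. \<epsilon> n < 2 * D i"
      using I(2) D_pos by (intro eventually_ball_finite order_tendstoD(2)[OF eps_lim] ballI) simp_all
    then obtain n where n: "\<And>i. i \<in> I \<Longrightarrow> \<epsilon> n < 2 * D i" "n0 \<le> n"
      using eventually_happens'[OF sequentially_bot eventually_conj[OF _ eventually_ge_at_top[of n0]]] by blast
    define N where "N = real (\<Prod>j<n. m j)"
    have "0 < N" unfolding N_def using m_pos by (simp add: prod_pos)
    have "X n \<subseteq> cyl n" unfolding cyl_def using rho_pos[of n] by (auto intro!: bexI simp: less_imp_le)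
    then have Xn: "X n \<subseteq> (\<Union>i\<in>I. V i)" using cyl_mono[OF n(2)] I(3) by blast
    have "N = real (card (X n))" by (simp add: N_def card_X)
    also have "X n = (\<Union>i\<in>I. X n \<inter> V i)" using Xn by auto
    also have "real (card (\<Union>i\<in>I. X n \<inter> V i)) \<le> (\<Sum>i\<in>I. real (card (X n \<inter> V i)))"
      unfolding of_nat_sum[symmetric] of_nat_le_iff by (rule card_UN_le[OF I(2)])
    also have "\<dots> \<le> (\<Sum>i\<in>I. \<kappa> * N * D i powr s)"
      unfolding \<kappa>_def N_def using n(1) 
      by (intro sum_mono count_le[OF s \<open>0 < c\<close> frost D_pos V_diam]) (auto simp: less_imp_le)
    also have "\<dots> = N * (\<kappa> * (\<Sum>i\<in>I. D i powr s))" by (simp add: sum_distrib_left mult_ac)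
    finally have "1 \<le> \<kappa> * (\<Sum>i\<in>I. D i powr s)" using \<open>0 < N\<close> by simp
    then have ge: "1 / \<kappa> \<le> (\<Sum>i\<in>I. D i powr s)" using \<open>0 < \<kappa>\<close> by (simp add: pos_divide_le_eq mult.commute)
    have "ennreal (\<Sum>i\<in>I. D i powr s) = (\<Sum>i\<in>I. ennreal (D i powr s))" by (simp add: sum_ennreal)
    also have "\<dots> \<le> (\<Sum>i. ennreal (D i powr s))" by (rule sum_le_suminf) (auto simp: I)
    also have "\<dots> \<le> (\<Sum>i. ennreal (diameter (C i) powr s) + ennreal (1 / (2 * \<kappa>) * (1/2) ^ Suc i))"
    proof (intro suminf_le)
      fix i
      have "D i powr s \<le> diameter (C i) powr s + \<eta> i powr s"
        unfolding D_def using s eta(1) diameter_ge_0[OF C(2)] by (intro powr_add_le_add_powr) auto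
      then have "ennreal (D i powr s) \<le> ennreal (diameter (C i) powr s + \<eta> i powr s)" by (rule ennreal_leI)
      also have "\<dots> = ennreal (diameter (C i) powr s) + ennreal (\<eta> i powr s)" by (rule ennreal_plus) simp_all
      finally show "ennreal (D i powr s) \<le> ennreal (diameter (C i) powr s) + ennreal (1 / (2 * \<kappa>) * (1/2) ^ Suc i)"
        unfolding eta(2) .
    qed (rule summableI)+
    also have "\<dots> = (\<Sum>i. ennreal (diameter (C i) powr s)) + (\<Sum>i. ennreal (1 / (2 * \<kappa>) * (1/2) ^ Suc i))"
      by (intro suminf_add[symmetric] summableI)
    also have "(\<Sum>i. ennreal (1 / (2 * \<kappa>) * (1/2) ^ Suc i)) = ennreal (1 / (2 * \<kappa>))"
    proof (intro suminf_ennreal_eq)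
      show "(\<lambda>i. 1 / (2 * \<kappa>) * (1/2) ^ Suc i) sums (1 / (2 * \<kappa>))"
        using sums_mult[OF power_half_series, of "1 / (2 * \<kappa>)"] by simp
    qed (use \<open>0 < \<kappa>\<close> in simp)
    also have "(\<Sum>i. ennreal (diameter (C i) powr s)) + ennreal (1 / (2 * \<kappa>)) <
        ennreal (1 / (2 * \<kappa>)) + ennreal (1 / (2 * \<kappa>))"
      using small by (rule ennreal_add_strict_right_mono)
    also have "\<dots> = ennreal (1 / \<kappa>)" using \<open>0 < \<kappa>\<close> by (subst ennreal_plus[symmetric]) auto
    finally show False using ennreal_leI[OF ge] leD by blast
  qed
  show ?thesis
  proof (rule that)
    show "0 < 1 / (2 * \<kappa>)" using \<open>0 < \<kappa>\<close> by simp
  qed (rule main)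
qed

end

section \<open>Best approximation denominators\<close>

lemma nint_dist_le: "nint_dist x \<le> \<bar>x - of_int p\<bar>"
proof (cases "p \<le> \<lfloor>x\<rfloor>")
  case True
  then have "real_of_int p \<le> of_int \<lfloor>x\<rfloor>" by simp
  then show ?thesis unfolding nint_dist_def frac_def by linarith
next
  case False
  then have "of_int \<lfloor>x\<rfloor> + 1 \<le> real_of_int p" by linarith
  then show ?thesis unfolding nint_dist_def frac_def by linarith
qed

lemma nint_dist_eq: obtains p :: int where "nint_dist x = \<bar>x - of_int p\<bar>"
proof -
  have f: "0 \<le> x - of_int \<lfloor>x\<rfloor>" "x - of_int \<lfloor>x\<rfloor> < 1" by linarith+
  show ?thesis
  proof (cases "frac x \<le> 1 - frac x")
    case True
    then show ?thesis using f that[of "\<lfloor>x\<rfloor>"] by (simp add: nint_dist_def frac_def)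
  next
    case False
    then show ?thesis using f that[of "\<lfloor>x\<rfloor> + 1"] by (simp add: nint_dist_def frac_def)
  qed
qed

locale irrational =
  fixes \<theta> :: real
  assumes irrational: "\<theta> \<notin> \<rat>"
begin

lemma irrational_comb: "n \<noteq> 0 \<Longrightarrow> real_of_int n * \<theta> \<noteq> of_int p"
proof
  assume "n \<noteq> 0" "real_of_int n * \<theta> = of_int p"
  then have "\<theta> = of_int p / of_int n" by (simp add: field_simps)
  then show False using irrational by (metis Rats_divide Rats_of_int)
qed

definition nd :: "nat \<Rightarrow> real" where "nd n = nint_dist (real n * \<theta>)"

lemma nd_pos: "0 < n \<Longrightarrow> 0 < nd n"
proof -
  assume "0 < n"
  obtain p where "nd n = \<bar>real n * \<theta> - of_int p\<bar>" unfolding nd_def by (rule nint_dist_eq)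
  then show ?thesis using irrational_comb[of "int n" p] \<open>0 < n\<close> by simp
qed

lemma nd_small: "0 < N \<Longrightarrow> \<exists>n. 0 < n \<and> n \<le> N \<and> nd n < 1 / real N"
proof -
  assume "0 < N"
  then obtain h k where hk: "0 < k" "k \<le> int N" "\<bar>of_int k * \<theta> - of_int h\<bar> < 1 / real N"
    by (rule Dirichlet_approx)
  have "nd (nat k) < 1 / real N"
    unfolding nd_def using nint_dist_le[of "real (nat k) * \<theta>" h] hk by simp
  then show ?thesis using hk by (intro exI[of _ "nat k"]) auto
qed

text \<open>The record times of \<open>nd\<close>. These are the denominators of the continued
  fraction convergents of \<theta>, each counted once.\<close>

primrec q :: "nat \<Rightarrow> nat" where
  "q 0 = 1"
| "q (Suc k) = (LEAST n. 0 < n \<and> nd n < nd (q k))"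

lemma q_Suc: "0 < q k \<Longrightarrow> 0 < q (Suc k) \<and> nd (q (Suc k)) < nd (q k)"
proof -
  assume "0 < q k"
  then have pos: "0 < nd (q k)" by (rule nd_pos)
  obtain N where N: "0 < N" "1 / real N < nd (q k)" using pos
    by (metis nat_approx_posE zero_less_Suc)
  then obtain n where "0 < n" "nd n < nd (q k)" using nd_small[OF N(1)] by (meson less_trans)
  then show ?thesis unfolding q.simps by (intro LeastI[of "\<lambda>n. 0 < n \<and> nd n < nd (q k)"]) auto
qed

lemma q_pos: "0 < q k"
  by (induction k) (use q_Suc in \<open>auto simp del: q.simps(2)\<close>)

lemma nd_q_Suc: "nd (q (Suc k)) < nd (q k)"
  using q_Suc[OF q_pos] by blast

lemma nd_best: "0 < n \<Longrightarrow> n < q (Suc k) \<Longrightarrow> nd (q k) \<le> nd n"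
  unfolding q.simps using not_less_Least[of n "\<lambda>n. 0 < n \<and> nd n < nd (q k)"] by auto

lemma q_less_Suc: "q k < q (Suc k)"
proof (cases k)
  case 0
  then show ?thesis using q_pos[of 1] nd_q_Suc[of 0] by (cases "q 1 = 1") (auto simp del: q.simps(2))
next
  case (Suc j)
  show ?thesis
  proof (rule ccontr)
    assume "\<not> q k < q (Suc k)"
    then consider "q (Suc k) = q k" | "q (Suc k) < q (Suc j)" unfolding Suc by linarith
    then show False
    proof cases
      case 2
      then have "nd (q j) \<le> nd (q (Suc k))" using nd_best q_pos by blast
      then show False using nd_q_Suc[of k] nd_q_Suc[of j] Suc by simp
    qed (use nd_q_Suc[of k] in simp)
  qed
qed

declare q.simps(2) [simp del]

lemma q_mono: "i \<le> j \<Longrightarrow> q i \<le> q j"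
  by (rule lift_Suc_mono_le[of q, OF less_imp_le[OF q_less_Suc]])

lemma q_ge: "k < q k"
proof (induction k)
  case (Suc k)
  then show ?case using q_less_Suc[of k] by linarith
qed simp

lemma q_ge1: "1 \<le> real (q k)" using q_pos[of k] by linarith

definition p :: "nat \<Rightarrow> int" where "p k = (SOME p. nd (q k) = \<bar>real (q k) * \<theta> - of_int p\<bar>)"
text \<open>The sign is kept: raising an index by \<open>q k\<close> moves the orbit point by
  \<open>D k\<close> modulo 1, always in the same direction.\<close>

definition D :: "nat \<Rightarrow> real" where "D k = real (q k) * \<theta> - of_int (p k)"

lemma abs_D: "\<bar>D k\<bar> = nd (q k)"
proof -
  have "\<exists>p. nd (q k) = \<bar>real (q k) * \<theta> - of_int p\<bar>" unfolding nd_def using nint_dist_eq by metis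
  from someI_ex[OF this] show ?thesis unfolding D_def p_def by simp
qed

text \<open>Dirichlet's theorem with the bound \<open>q (Suc k) - 1\<close>, up to which no index
  beats \<open>q k\<close>; the factor 2 pays for the \<open>- 1\<close>.\<close>

lemma D_upper: "\<bar>D k\<bar> \<le> 2 / real (q (Suc k))"
proof -
  have "2 \<le> q (Suc k)" using q_less_Suc[of k] q_pos[of k] by linarith
  then have "0 < q (Suc k) - 1" by simp
  from nd_small[OF this] obtain n where n: "0 < n" "n \<le> q (Suc k) - 1" "nd n < 1 / real (q (Suc k) - 1)" by blast
  then have "nd (q k) \<le> nd n" by (intro nd_best) auto
  moreover have "1 / real (q (Suc k) - 1) \<le> 2 / real (q (Suc k))"
    using \<open>2 \<le> q (Suc k)\<close> by (simp add: field_simps of_nat_diff)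
  ultimately show ?thesis using n abs_D[of k] by linarith
qed

text \<open>The integer determinant \<open>?Z\<close> is nonzero, since the two products forming it
  have different absolute values. So it is at least 1 in absolute value, and the larger product
  carries at least half of that.\<close>

lemma D_lower: "1 / (2 * real (q (Suc k))) \<le> \<bar>D k\<bar>"
proof -
  let ?Z = "int (q (Suc k)) * p k - int (q k) * p (Suc k)"
  have Z: "real_of_int ?Z = real (q k) * D (Suc k) - real (q (Suc k)) * D k"
    by (simp add: D_def algebra_simps)
  have less: "real (q k) * \<bar>D (Suc k)\<bar> < real (q (Suc k)) * \<bar>D k\<bar>"
    using q_less_Suc[of k] nd_q_Suc[of k] q_pos[of k] nd_pos[OF q_pos, of "Suc k"]
    unfolding abs_D by (intro mult_strict_mono) auto
  have "?Z \<noteq> 0"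
  proof
    assume "?Z = 0"
    then have "real (q k) * D (Suc k) = real (q (Suc k)) * D k" using Z by simp
    then have "\<bar>real (q k) * D (Suc k)\<bar> = \<bar>real (q (Suc k)) * D k\<bar>" by simp
    then show False using less by (simp add: abs_mult)
  qed
  then have "1 \<le> \<bar>real_of_int ?Z\<bar>" by linarith
  also have "\<dots> \<le> real (q k) * \<bar>D (Suc k)\<bar> + real (q (Suc k)) * \<bar>D k\<bar>"
    unfolding Z using abs_triangle_ineq4[of "real (q k) * D (Suc k)" "real (q (Suc k)) * D k"] by (simp add: abs_mult)
  also have "\<dots> \<le> \<bar>D k\<bar> * (2 * real (q (Suc k)))" using less by (simp add: algebra_simps)
  finally show ?thesis using q_pos[of "Suc k"] by (simp add: pos_divide_le_eq)
qed

text \<open>A positive index difference below \<open>q k\<close> approximates no better than the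
  previous denominator, whose error is bounded below by \<open>D_lower\<close>. Only the difference
  matters, so every window of \<open>q k\<close> consecutive indices is covered, not just the
  first.\<close>

lemma orbit_sep:
  assumes "\<bar>int n - int n'\<bar> < int (q k)" "real n * \<theta> - of_int a \<noteq> real n' * \<theta> - of_int b"
  shows "1 / (2 * real (q k)) \<le> \<bar>(real n * \<theta> - of_int a) - (real n' * \<theta> - of_int b)\<bar>"
proof -
  have *: "1 / (2 * real (q k)) \<le> \<bar>(real n * \<theta> - of_int a) - (real n' * \<theta> - of_int b)\<bar>"
    if "n \<le> n'" "int n' - int n < int (q k)" "real n * \<theta> - of_int a \<noteq> real n' * \<theta> - of_int b" for n n' a b
  proof (cases "n = n'")
    case True
    then have "a \<noteq> b" using that(3) by auto
    then have "1 \<le> \<bar>real_of_int b - real_of_int a\<bar>" by linarith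
    moreover have "1 / (2 * real (q k)) \<le> 1" using q_ge1[of k] by (simp add: field_simps)
    ultimately show ?thesis using True by (simp add: abs_minus_commute)
  next
    case False
    define m where "m = n' - n"
    have m: "0 < m" "m < q k" "real n' = real n + real m" using that False by (auto simp: m_def)
    then obtain j where j: "k = Suc j" by (cases k) auto
    have "1 / (2 * real (q k)) \<le> nd (q j)" using D_lower[of j] unfolding j abs_D by simp
    also have "\<dots> \<le> nd m" using m unfolding j by (intro nd_best) auto
    also have "\<dots> \<le> \<bar>real m * \<theta> - of_int (b - a)\<bar>" unfolding nd_def by (rule nint_dist_le)
    also have "real m * \<theta> - of_int (b - a) = (real n' * \<theta> - of_int b) - (real n * \<theta> - of_int a)"
      unfolding m by (simp add: algebra_simps)
    finally show ?thesis by (simp add: abs_minus_commute)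
  qed
  show ?thesis
  proof (cases "n \<le> n'")
    case False
    then show ?thesis using *[of n' n b a] assms by (simp add: abs_minus_commute)
  qed (use *[of n n' a b] assms in simp)
qed

text \<open>Cancelling a common factor would give a smaller denominator with an error below that of
  the previous record. This makes \<open>p k\<close> invertible modulo \<open>q k\<close> in
  \<open>residue_window\<close>.\<close>

lemma coprime_p_q: "coprime (p k) (int (q k))"
proof (rule ccontr)
  assume nc: "\<not> coprime (p k) (int (q k))"
  define g where "g = gcd (p k) (int (q k))"
  have "g \<noteq> 1" using nc by (simp add: g_def coprime_iff_gcd_eq_1)
  moreover have "0 < g" using q_pos[of k] by (simp add: g_def)
  ultimately have g: "1 < g" by linarith
  obtain a b where ab: "p k = g * a" "int (q k) = g * b" unfolding g_def by (meson dvdE gcd_dvd1 gcd_dvd2)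
  have b: "0 < b" using ab(2) q_pos[of k] \<open>0 < g\<close> by (metis of_nat_0_less_iff zero_less_mult_pos)
  have "b < int (q k)" using ab b g by simp
  then have bq: "0 < nat b" "nat b < q k" using b by linarith+
  then obtain j where j: "k = Suc j" by (cases k) auto
  have "nd (q k) < nd (q j)" using nd_q_Suc j by simp
  also have "\<dots> \<le> nd (nat b)" using bq j by (intro nd_best) auto
  also have "\<dots> \<le> \<bar>real (nat b) * \<theta> - of_int a\<bar>" unfolding nd_def by (rule nint_dist_le)
  also have "\<dots> \<le> real_of_int g * \<bar>real (nat b) * \<theta> - of_int a\<bar>" 
    using g mult_right_mono[of 1 "real_of_int g" "\<bar>real (nat b) * \<theta> - of_int a\<bar>"] by simp
  also have "\<dots> = \<bar>D k\<bar>"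
  proof -
    have "real (q k) = real_of_int g * real_of_int b" using ab(2) by (metis of_int_mult of_int_of_nat_eq)
    then have "D k = real_of_int g * (real (nat b) * \<theta> - of_int a)"
      unfolding D_def ab(1) using b by (simp add: algebra_simps)
    then show ?thesis using \<open>0 < g\<close> by (simp add: abs_mult)
  qed
  finally show False using abs_D[of k] by simp
qed

end

section \<open>Cluster lengths and their dependence on the exponent\<close>

text \<open>Equating \<open>Q powr (- t)\<close> with \<open>Q / N\<close> gives
  \<open>Q = N powr (1 / (1 + t))\<close> and the common value
  \<open>N powr (- sig t)\<close>.\<close>

definition sig :: "real \<Rightarrow> real" where "sig t = t / (1 + t)"

lemma sig_bounds: "0 < t \<Longrightarrow> 0 < sig t" "0 < t \<Longrightarrow> sig t < 1"
  by (simp_all add: sig_def)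

lemma sig_less: "0 < u \<Longrightarrow> u < v \<Longrightarrow> sig u < sig v"
  by (simp add: sig_def field_simps)

lemma le_iff_ln: "0 < x \<Longrightarrow> 0 < y \<Longrightarrow> x \<le> y \<longleftrightarrow> ln x \<le> ln (y::real)" by simp

text \<open>With \<open>x = ln (q k)\<close> and \<open>y = ln (q (Suc k))\<close>, this equivalence
  and the next compare \<open>ell t k\<close> with the two outer values \<open>1 / q (Suc k)\<close>
  and \<open>1 / q k\<close> in \<open>L\<close>.\<close>

lemma sig_sum_le_iff: "0 < t \<Longrightarrow> sig t * (x + y) \<le> y \<longleftrightarrow> t * x \<le> y"
  by (simp add: sig_def field_simps)

lemma sig_sum_ge_iff: "0 < t \<Longrightarrow> x \<le> sig t * (x + y) \<longleftrightarrow> x \<le> t * y"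
  by (simp add: sig_def field_simps)

context irrational
begin

lemma q_at_top: "filterlim (\<lambda>k. real (q k)) at_top sequentially"
proof (rule filterlim_at_top_mono[OF filterlim_real_sequentially])
  show "\<forall>\<^sub>F k in sequentially. real k \<le> real (q k)"
    using q_ge by (auto intro!: always_eventually less_imp_le)
qed

lemma q_powr_large: "0 < c \<Longrightarrow> \<forall>\<^sub>F k in sequentially. B \<le> real (q k) powr c"
  using filterlim_compose[OF real_powr_at_top q_at_top] unfolding filterlim_at_top by blast

definition ell :: "real \<Rightarrow> nat \<Rightarrow> real" where
  "ell t k = (real (q k) * real (q (Suc k))) powr (- sig t)"

definition L :: "real \<Rightarrow> nat \<Rightarrow> real" where
  "L t k = min (1 / real (q k)) (max (1 / real (q (Suc k))) (ell t k))"

definition M :: "real \<Rightarrow> nat \<Rightarrow> real" where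
  "M t k = (\<Prod>j<k. real (q (Suc j)) * L t j)"

declare q_pos [simp]

lemma q_nonzero [simp]: "q k \<noteq> 0" using q_pos[of k] by simp

lemma q_le_Suc: "real (q k) \<le> real (q (Suc k))" using q_less_Suc[of k] by simp

lemma ell_pos [simp]: "0 < ell t k" by (simp add: ell_def)
lemma L_pos [simp]: "0 < L t k" by (simp add: L_def less_max_iff_disj)
lemma ell_nonneg [simp]: "0 \<le> ell t k" by (simp add: less_imp_le)
lemma L_nonneg [simp]: "0 \<le> L t k" by (simp add: less_imp_le)
lemma L_nonzero [simp]: "L t k \<noteq> 0" using L_pos[of t k] by linarith
lemma M_pos [simp]: "0 < M t k" by (auto simp: M_def intro!: prod_pos)
lemma M_nonzero [simp]: "M t k \<noteq> 0" using M_pos[of t k] by linarith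

lemma L_ge: "1 / real (q (Suc k)) \<le> L t k"
  unfolding L_def using q_le_Suc[of k] by (auto simp: frac_le)

lemma L_le: "L t k \<le> 1 / real (q k)" by (simp add: L_def)

lemma ln_ell: "ln (ell t k) = - sig t * (ln (real (q k)) + ln (real (q (Suc k))))"
  by (simp add: ell_def ln_powr ln_mult)

lemma ell_ge_iff: "0 < t \<Longrightarrow> 1 / real (q (Suc k)) \<le> ell t k \<longleftrightarrow> real (q k) powr t \<le> real (q (Suc k))"
proof -
  assume t: "0 < t"
  have "1 / real (q (Suc k)) \<le> ell t k \<longleftrightarrow> ln (1 / real (q (Suc k))) \<le> ln (ell t k)"
    by (intro le_iff_ln) auto
  also have "\<dots> \<longleftrightarrow> sig t * (ln (real (q k)) + ln (real (q (Suc k)))) \<le> ln (real (q (Suc k)))"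
    unfolding ln_ell by (simp add: ln_div)
  also have "\<dots> \<longleftrightarrow> t * ln (real (q k)) \<le> ln (real (q (Suc k)))" using t by (rule sig_sum_le_iff)
  also have "\<dots> \<longleftrightarrow> ln (real (q k) powr t) \<le> ln (real (q (Suc k)))" by (simp add: ln_powr)
  also have "\<dots> \<longleftrightarrow> real (q k) powr t \<le> real (q (Suc k))" by (intro le_iff_ln[symmetric]) auto
  finally show ?thesis .
qed

lemma ell_le_iff: "0 < t \<Longrightarrow> ell t k \<le> 1 / real (q k) \<longleftrightarrow> real (q k) \<le> real (q (Suc k)) powr t"
proof -
  assume t: "0 < t"
  have "ell t k \<le> 1 / real (q k) \<longleftrightarrow> ln (ell t k) \<le> ln (1 / real (q k))"
    by (intro le_iff_ln) auto
  also have "\<dots> \<longleftrightarrow> ln (real (q k)) \<le> sig t * (ln (real (q k)) + ln (real (q (Suc k))))"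
    unfolding ln_ell by (simp add: ln_div)
  also have "\<dots> \<longleftrightarrow> ln (real (q k)) \<le> t * ln (real (q (Suc k)))" using t by (rule sig_sum_ge_iff)
  also have "\<dots> \<longleftrightarrow> ln (real (q k)) \<le> ln (real (q (Suc k)) powr t)" by (simp add: ln_powr)
  also have "\<dots> \<longleftrightarrow> real (q k) \<le> real (q (Suc k)) powr t" by (intro le_iff_ln[symmetric]) auto
  finally show ?thesis .
qed

text \<open>As \<open>q k \<le> q (Suc k)\<close>, only one truncation in \<open>L\<close> can act
  on each side of 1: the upper one for \<open>t \<le> 1\<close>, the lower one for
  \<open>t \<ge> 1\<close>.\<close>

lemma ell_ge_small: "0 < t \<Longrightarrow> t \<le> 1 \<Longrightarrow> 1 / real (q (Suc k)) \<le> ell t k"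
  using powr_mono[of t 1 "real (q k)"] q_ge1[of k] q_le_Suc[of k] by (simp add: ell_ge_iff)

lemma ell_le_large: "1 \<le> t \<Longrightarrow> ell t k \<le> 1 / real (q k)"
  using powr_mono[of 1 t "real (q (Suc k))"] q_ge1[of "Suc k"] q_le_Suc[of k] by (simp add: ell_le_iff)

lemma L_small: "0 < t \<Longrightarrow> t \<le> 1 \<Longrightarrow> L t k = min (1 / real (q k)) (ell t k)"
  unfolding L_def using ell_ge_small[of t k] by (simp add: max_absorb2)

lemma L_large: "1 \<le> t \<Longrightarrow> L t k = max (1 / real (q (Suc k))) (ell t k)"
  using ell_le_large[of t k] L_ge[of k t] unfolding L_def by auto

lemma ell_antimono: "0 < u \<Longrightarrow> u \<le> v \<Longrightarrow> ell v k \<le> ell u k"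
proof -
  assume uv: "0 < u" "u \<le> v"
  have "1 \<le> real (q k) * real (q (Suc k))"
    using q_ge1[of k] q_ge1[of "Suc k"] mult_mono[of 1 "real (q k)" 1 "real (q (Suc k))"] by simp
  moreover have "sig u \<le> sig v" using uv sig_less[of u v] by (cases "u = v") auto
  ultimately show ?thesis unfolding ell_def by (intro powr_mono) auto
qed

lemma L_antimono: "0 < u \<Longrightarrow> u \<le> v \<Longrightarrow> L v k \<le> L u k"
  unfolding L_def using ell_antimono[of u v k] by auto

text \<open>Absorbs constants: the quotient \<open>ell u k / ell v k\<close> is at least
  \<open>q k powr (sig v - sig u)\<close>, which tends to infinity.\<close>

lemma ell_slack:
  assumes "0 < u" "u < v" "0 \<le> B"
  shows "\<forall>\<^sub>F k in sequentially. B * ell v k \<le> ell u k"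
proof -
  have "0 < sig v - sig u" using sig_less assms by simp
  from q_powr_large[OF this, of B] show ?thesis
  proof eventually_elim
    case (elim k)
    let ?Q = "real (q k) * real (q (Suc k))"
    have "real (q k) * 1 \<le> ?Q" using q_ge1[of "Suc k"] by (intro mult_left_mono) auto
    then have "real (q k) powr (sig v - sig u) \<le> ?Q powr (sig v - sig u)"
      using \<open>0 < sig v - sig u\<close> by (intro powr_mono2) auto
    then have "B * ell v k \<le> ?Q powr (sig v - sig u) * ell v k" using elim by (intro mult_right_mono) auto
    also have "\<dots> = ell u k" unfolding ell_def powr_add[symmetric] by simp
    finally show ?case .
  qed
qed

lemma ell_mono_index: "0 < t \<Longrightarrow> j \<le> k \<Longrightarrow> ell t k \<le> ell t j"
  unfolding ell_def using q_mono[of j k] q_mono[of "Suc j" "Suc k"] sig_bounds[of t]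
  by (intro powr_mono2' mult_mono) auto

section \<open>Logarithmic cluster lengths and their change with the exponent\<close>

definition lam :: "real \<Rightarrow> nat \<Rightarrow> real" where
  "lam t k = max (ln (real (q k))) (min (ln (real (q (Suc k)))) (sig t * (ln (real (q k)) + ln (real (q (Suc k))))))"

text \<open>Writing \<open>- ln (L t k)\<close> with \<open>max\<close> and \<open>min\<close> of
  terms linear in \<open>ln (q k)\<close> and \<open>ln (q (Suc k))\<close> opens the comparisons
  below to linear arithmetic.\<close>

lemma ln_L: "ln (L t k) = - lam t k"
proof -
  have mx: "ln (max x y) = max (ln x) (ln y)" if "0 < x" "0 < y" for x y :: real
    using that by (auto simp: max_def)
  have mn: "ln (min x y) = min (ln x) (ln y)" if "0 < x" "0 < y" for x y :: real
    using that by (auto simp: min_def)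
  have "ln (L t k) = min (- ln (real (q k))) (max (- ln (real (q (Suc k)))) (- sig t * (ln (real (q k)) + ln (real (q (Suc k))))))"
    unfolding L_def by (subst mn, simp, simp add: less_max_iff_disj, subst mx) (simp_all add: ln_div ln_ell)
  then show ?thesis unfolding lam_def by (simp add: minus_max_eq_min minus_min_eq_max)
qed

lemma ln_M: "ln (M t k) = (\<Sum>j<k. ln (real (q (Suc j))) - lam t j)"
  unfolding M_def by (subst ln_prod) (simp_all add: ln_mult ln_L)

lemma lam_ge: "ln (real (q k)) \<le> lam t k" by (simp add: lam_def)

lemma ln_q_nonneg: "0 \<le> ln (real (q k))" using q_ge1[of k] by simp
lemma ln_q_mono: "ln (real (q k)) \<le> ln (real (q (Suc k)))" using q_le_Suc[of k] by simp

lemma lam_nonneg: "0 \<le> lam t k" using lam_ge[of k t] ln_q_nonneg[of k] by linarith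

lemma lam_le: "lam t k \<le> ln (real (q (Suc k)))" using ln_q_mono[of k] by (simp add: lam_def)

text \<open>Every factor of \<open>M\<close> is at most \<open>q (Suc j) / q j\<close>, so
  \<open>M t k \<le> q k \<le> 1 / L t k\<close> and the dimension quotient never exceeds 1.\<close>

lemma ln_M_le: "ln (M t k) \<le> lam t k"
proof -
  have "ln (M t k) \<le> (\<Sum>j<k. ln (real (q (Suc j))) - ln (real (q j)))"
    unfolding ln_M by (intro sum_mono diff_left_mono lam_ge)
  also have "\<dots> = ln (real (q k))" by (subst sum_lessThan_telescope) simp
  finally show ?thesis using lam_ge[of k t] by linarith
qed

lemma lam_mono: "0 < u \<Longrightarrow> u < v \<Longrightarrow> lam u k \<le> lam v k"
proof -
  assume uv: "0 < u" "u < v"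
  have "sig u * (ln (real (q k)) + ln (real (q (Suc k)))) \<le> sig v * (ln (real (q k)) + ln (real (q (Suc k))))"
    using sig_less[OF uv] ln_q_nonneg[of k] ln_q_nonneg[of "Suc k"] by (intro mult_right_mono) auto
  then show ?thesis unfolding lam_def by linarith
qed

text \<open>The median is monotone and positively homogeneous, and passing from \<open>u\<close> to
  \<open>v\<close> changes only its \<open>sig\<close> term, by the factor
  \<open>sig v / sig u \<ge> 1\<close>.\<close>

lemma lam_ratio:
  assumes "0 < u" "u < v"
  shows "lam v k \<le> sig v / sig u * lam u k"
proof -
  let ?r = "sig v / sig u" and ?x = "ln (real (q k))" and ?y = "ln (real (q (Suc k)))"
  have r: "1 \<le> ?r" using sig_less[OF assms] sig_bounds[of u] assms by simp
  have "?x \<le> ?r * ?x" "?y \<le> ?r * ?y"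
    using r ln_q_nonneg mult_right_mono[of 1 ?r] by fastforce+
  moreover have "sig v * (?x + ?y) = ?r * (sig u * (?x + ?y))" using sig_bounds[of u] assms by simp
  ultimately have "lam v k \<le> max (?r * ?x) (min (?r * ?y) (?r * (sig u * (?x + ?y))))"
    unfolding lam_def by linarith
  also have "\<dots> = ?r * lam u k"
    unfolding lam_def using r by (simp add: max_mult_distrib_left min_mult_distrib_left)
  finally show ?thesis .
qed

text \<open>If the median moves at all, then \<open>ln (q k) \<le> v * ln (q (Suc k))\<close> and
  \<open>u * ln (q k) \<le> ln (q (Suc k))\<close>. The first (if \<open>v < 1\<close>) or the
  second (if \<open>1 < u\<close>) bounds \<open>ln (q (Suc k))\<close> by \<open>C\<close> times
  the gap of the logarithms, which makes the estimate telescope when summed over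
  \<open>k\<close>.\<close>

lemma lam_diff:
  assumes uv: "0 < u" "u < v" and C: "v < 1 \<and> C = 1 / (1 - v) \<or> 1 < u \<and> C = u / (u - 1)"
  shows "lam v k - lam u k \<le> (sig v / sig u - 1) * C * (ln (real (q (Suc k))) - ln (real (q k)))"
proof -
  let ?r = "sig v / sig u" and ?x = "ln (real (q k))" and ?y = "ln (real (q (Suc k)))"
  have r: "0 \<le> ?r - 1" using sig_less[OF uv] sig_bounds[of u] uv by simp
  have C0: "0 \<le> C" using C uv by auto
  show ?thesis
  proof (cases "lam v k = lam u k")
    case False
    then have lt: "lam u k < lam v k" using lam_mono[OF uv, of k] by simp
    then have 1: "?x < sig v * (?x + ?y)" "sig u * (?x + ?y) < ?y"
      unfolding lam_def using ln_q_mono[of k] by linarith+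
    have 2: "?y \<le> C * (?y - ?x)" using C
    proof
      assume c: "v < 1 \<and> C = 1 / (1 - v)"
      have "?x \<le> v * ?y" using 1(1) sig_sum_ge_iff[of v ?x ?y] uv by simp
      then have "?y \<le> (?y - ?x) / (1 - v)" using c by (simp add: pos_le_divide_eq algebra_simps)
      then show ?thesis using c by simp
    next
      assume c: "1 < u \<and> C = u / (u - 1)"
      have "u * ?x \<le> ?y" using 1(2) sig_sum_le_iff[of u ?x ?y] uv by simp
      then have "?y * (u - 1) \<le> u * (?y - ?x)" by (simp add: algebra_simps)
      then have "?y \<le> u * (?y - ?x) / (u - 1)" using c by (simp add: pos_le_divide_eq)
      then show ?thesis using c by simp
    qed
    have "lam v k - lam u k \<le> (?r - 1) * lam u k" using lam_ratio[OF uv, of k] by (simp add: algebra_simps)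
    also have "\<dots> \<le> (?r - 1) * ?y" using r lam_le by (intro mult_left_mono) auto
    also have "\<dots> \<le> (?r - 1) * (C * (?y - ?x))" using r 2 by (intro mult_left_mono) auto
    finally show ?thesis by (simp add: mult.assoc)
  next
    case True
    then show ?thesis using r C0 ln_q_mono[of k] by (simp only: True diff_self) (intro mult_nonneg_nonneg; linarith)
  qed
qed

text \<open>Summing \<open>lam_diff\<close> gives an error with factor \<open>C\<close> times
  \<open>ln (q k) \<le> lam u k\<close>; replacing \<open>lam v k\<close> by \<open>lam u k\<close>
  costs one more such error, hence \<open>1 + C\<close>.\<close>

lemma ln_M_compare:
  assumes uv: "0 < u" "u < v" and C: "v < 1 \<and> C = 1 / (1 - v) \<or> 1 < u \<and> C = u / (u - 1)"
    and s: "0 \<le> s" "s \<le> 1" and le: "ln (M v k) \<le> s * lam v k"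
  shows "ln (M u k) \<le> (s + (sig v / sig u - 1) * (1 + C)) * lam u k"
proof -
  let ?r = "sig v / sig u" and ?x = "ln (real (q k))"
  have r: "0 \<le> ?r - 1" using sig_less[OF uv] sig_bounds[of u] uv by simp
  have C0: "0 \<le> C" using C uv by auto
  have "ln (M u k) - ln (M v k) = (\<Sum>j<k. lam v j - lam u j)"
    unfolding ln_M sum_subtractf[symmetric] by (intro sum.cong) auto
  also have "\<dots> \<le> (\<Sum>j<k. (?r - 1) * C * (ln (real (q (Suc j))) - ln (real (q j))))"
    by (intro sum_mono lam_diff[OF uv C])
  also have "\<dots> = (?r - 1) * C * ?x"
    unfolding sum_distrib_left[symmetric] by (subst sum_lessThan_telescope) simp
  also have "\<dots> \<le> (?r - 1) * C * lam u k" using r C0 lam_ge by (intro mult_left_mono) auto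
  finally have "ln (M u k) \<le> s * lam v k + (?r - 1) * C * lam u k" using le by linarith
  also have "s * lam v k \<le> s * (?r * lam u k)" using s lam_ratio[OF uv] by (intro mult_left_mono) auto
  also have "s * (?r * lam u k) = s * lam u k + s * ((?r - 1) * lam u k)" by (simp add: algebra_simps)
  also have "s * ((?r - 1) * lam u k) \<le> 1 * ((?r - 1) * lam u k)"
    using s r lam_nonneg by (intro mult_right_mono mult_nonneg_nonneg) auto
  also have eq: "s * l + 1 * ((r - 1) * l) + (r - 1) * C * l = (s + (r - 1) * (1 + C)) * l" for r l
    by (simp add: algebra_simps)
  finally show ?thesis by simp
qed

end

section \<open>Upper bounds\<close>

lemma int_ball_count:
  assumes "0 \<le> d"
  shows "finite {r::int. \<bar>real_of_int r - c\<bar> \<le> d}" "real (card {r::int. \<bar>real_of_int r - c\<bar> \<le> d}) \<le> 2 * d + 1"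
    "2 * d - 1 \<le> real (card {r::int. \<bar>real_of_int r - c\<bar> \<le> d})"
proof -
  have eq: "{r::int. \<bar>real_of_int r - c\<bar> \<le> d} = {\<lceil>c - d\<rceil>..\<lfloor>c + d\<rfloor>}"
  proof (intro set_eqI iffI)
    fix r :: int assume "r \<in> {r. \<bar>real_of_int r - c\<bar> \<le> d}"
    then have "c - d \<le> real_of_int r" "real_of_int r \<le> c + d" by (auto simp: abs_le_iff)
    then show "r \<in> {\<lceil>c - d\<rceil>..\<lfloor>c + d\<rfloor>}" by (simp add: ceiling_le_iff le_floor_iff)
  next
    fix r :: int assume "r \<in> {\<lceil>c - d\<rceil>..\<lfloor>c + d\<rfloor>}"
    then have "c - d \<le> real_of_int r" "real_of_int r \<le> c + d" by (simp_all add: ceiling_le_iff le_floor_iff)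
    then show "r \<in> {r. \<bar>real_of_int r - c\<bar> \<le> d}" by (simp add: abs_le_iff)
  qed
  show "finite {r::int. \<bar>real_of_int r - c\<bar> \<le> d}" unfolding eq by simp
  have "real_of_int (\<lfloor>c + d\<rfloor> + 1 - \<lceil>c - d\<rceil>) \<le> 2 * d + 1"
    unfolding of_int_diff of_int_add of_int_1 by linarith
  then show "real (card {r::int. \<bar>real_of_int r - c\<bar> \<le> d}) \<le> 2 * d + 1"
    unfolding eq card_atLeastAtMost_int using assms
    by (cases "0 \<le> \<lfloor>c + d\<rfloor> + 1 - \<lceil>c - d\<rceil>") simp_all
  have "2 * d - 1 \<le> real_of_int (\<lfloor>c + d\<rfloor> + 1 - \<lceil>c - d\<rceil>)"
    unfolding of_int_diff of_int_add of_int_1 by linarith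
  then show "2 * d - 1 \<le> real (card {r::int. \<bar>real_of_int r - c\<bar> \<le> d})"
    unfolding eq card_atLeastAtMost_int by linarith
qed

section \<open>Orbit points near a good point and the critical scale\<close>

context irrational
begin

definition good :: "real \<Rightarrow> real \<Rightarrow> real \<Rightarrow> bool" where
  "good \<tau> y Q \<longleftrightarrow> (\<exists>n::nat. 1 \<le> n \<and> real n \<le> Q \<and> nint_dist (real n * \<theta> - y) < Q powr (- \<tau>))"

text \<open>Integer thresholds \<open>K\<close> suffice and make \<open>U_set\<close> a countable
  union.\<close>

definition E :: "real \<Rightarrow> nat \<Rightarrow> real set" where
  "E \<tau> K = {y \<in> {0..<1}. \<forall>Q\<ge>real K. good \<tau> y Q}"

lemma U_set_eq: "U_set \<tau> \<theta> = (\<Union>K. E \<tau> K)"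
proof -
  have "(\<exists>Q0. \<forall>Q\<ge>Q0. good \<tau> y Q) \<longleftrightarrow> (\<exists>K. \<forall>Q\<ge>real K. good \<tau> y Q)" for y
    by (meson order_trans real_arch_simple)
  then show ?thesis unfolding U_set_def E_def good_def by auto
qed

lemma orbit_inj: "real n * \<theta> - of_int a = real n' * \<theta> - of_int b \<Longrightarrow> n = n'"
proof (rule ccontr)
  assume "real n * \<theta> - of_int a = real n' * \<theta> - of_int b" "n \<noteq> n'"
  then have "real_of_int (int n - int n') * \<theta> = of_int (a - b)" by (simp add: algebra_simps)
  then show False using irrational_comb[of "int n - int n'" "a - b"] \<open>n \<noteq> n'\<close> by simp
qed

text \<open>The indices up to \<open>q k\<close> label the clusters of stage \<open>k\<close>; the
  integer \<open>a\<close> makes closeness one modulo 1.\<close>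

definition near :: "real \<Rightarrow> nat \<Rightarrow> nat \<Rightarrow> real \<Rightarrow> bool" where
  "near y k i d \<longleftrightarrow> 1 \<le> i \<and> i \<le> q k \<and> (\<exists>a::int. \<bar>y - (real i * \<theta> - of_int a)\<bar> < d)"

lemma near_mono: "near y k i d \<Longrightarrow> d \<le> d' \<Longrightarrow> near y k i d'"
  unfolding near_def by (meson less_le_trans)

lemma near_eq:
  assumes "near y k i d" "near y k i' d'" "d + d' \<le> 1 / (2 * real (q k))"
  shows "i = i'"
proof -
  obtain a b where ab: "\<bar>y - (real i * \<theta> - of_int a)\<bar> < d" "\<bar>y - (real i' * \<theta> - of_int b)\<bar> < d'"
    using assms unfolding near_def by auto
  have "\<bar>(real i * \<theta> - of_int a) - (real i' * \<theta> - of_int b)\<bar> < 1 / (2 * real (q k))"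
    using ab assms(3) by linarith
  moreover have "\<bar>int i - int i'\<bar> < int (q k)" using assms(1,2) unfolding near_def by linarith
  ultimately have "real i * \<theta> - of_int a = real i' * \<theta> - of_int b" using orbit_sep[of i i' k a b] by force
  then show ?thesis by (rule orbit_inj)
qed

text \<open>Raising an index by \<open>q k\<close> moves the orbit point by \<open>D k\<close>, and
  an index up to \<open>Q\<close> is at most \<open>Q / q k\<close> such moves away from the first
  block.\<close>

lemma good_near:
  assumes "good \<tau> y Q"
  shows "\<exists>i. near y k i (Q powr (- \<tau>) + Q / real (q k) * \<bar>D k\<bar>)"
proof -
  obtain n where n: "1 \<le> n" "real n \<le> Q" "nint_dist (real n * \<theta> - y) < Q powr (- \<tau>)"
    using assms unfolding good_def by auto
  obtain c where c: "nint_dist (real n * \<theta> - y) = \<bar>real n * \<theta> - y - of_int c\<bar>" by (rule nint_dist_eq)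
  \<comment> \<open>Dividing \<open>n - 1\<close> instead of \<open>n\<close> puts the index
    \<open>i\<close> into \<open>1..q k\<close>.\<close>
  define j where "j = (n - 1) div q k"
  define i where "i = (n - 1) mod q k + 1"
  have i: "1 \<le> i" "i \<le> q k" by (simp_all add: i_def Suc_le_eq)
  have nij: "n = j * q k + i" using n(1) unfolding i_def j_def
    by (metis Nat.add_diff_assoc2 add.assoc add_diff_cancel_right' div_mult_mod_eq le_add_diff_inverse2)
  have "real j * real (q k) \<le> Q" using n(2) unfolding nij by simp
  then have "real j \<le> Q / real (q k)" by (simp add: pos_le_divide_eq)
  then have jD: "real j * \<bar>D k\<bar> \<le> Q / real (q k) * \<bar>D k\<bar>" by (intro mult_right_mono) auto
  have "y - (real i * \<theta> - of_int (c - int j * p k)) = - (real n * \<theta> - y - of_int c) + real j * D k"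
    unfolding nij D_def by (simp add: algebra_simps)
  then have "\<bar>y - (real i * \<theta> - of_int (c - int j * p k))\<bar> \<le> \<bar>real n * \<theta> - y - of_int c\<bar> + real j * \<bar>D k\<bar>"
    by (metis abs_minus_cancel abs_mult abs_of_nat abs_triangle_ineq)
  also have "\<dots> < Q powr (- \<tau>) + Q / real (q k) * \<bar>D k\<bar>" using jD n(3) c by linarith
  finally show ?thesis using i unfolding near_def by blast
qed

text \<open>The \<open>Q\<close> at which the radius \<open>Q powr (- t)\<close> and the cluster
  length \<open>Q / (q k * q (Suc k))\<close> agree; both are then \<open>ell t k\<close>, by
  \<open>Qs_powr\<close> and \<open>Qs_eq\<close>.\<close>

definition Qs :: "real \<Rightarrow> nat \<Rightarrow> real" where
  "Qs t k = (real (q k) * real (q (Suc k))) powr (1 / (1 + t))"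

lemma Qs_pos [simp]: "0 < Qs t k" by (simp add: Qs_def)

lemma Qs_powr: "0 < t \<Longrightarrow> Qs t k powr (- t) = ell t k"
  by (simp add: Qs_def ell_def powr_powr sig_def)

lemma Qs_eq: "0 < t \<Longrightarrow> Qs t k = real (q k) * real (q (Suc k)) * ell t k"
proof -
  assume "0 < t"
  then have eq: "1 / (1 + t) = 1 + (- sig t)" by (simp add: sig_def field_simps)
  show ?thesis unfolding Qs_def ell_def eq powr_add by simp
qed

lemma Qs_ge: "0 < t \<Longrightarrow> real (q k) powr (1 / (1 + t)) \<le> Qs t k"
  unfolding Qs_def using mult_left_mono[of 1 "real (q (Suc k))" "real (q k)"] q_ge1[of "Suc k"]
  by (intro powr_mono2) auto

text \<open>Evaluate goodness at the critical \<open>Qs \<tau> k\<close>: the radius is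
  \<open>ell \<tau> k\<close> and the drift at most twice that, hence the 3.\<close>

lemma E_near:
  assumes "0 < \<tau>"
  shows "\<forall>\<^sub>F k in sequentially. \<forall>y\<in>E \<tau> K. \<exists>i. near y k i (3 * ell \<tau> k)"
proof -
  have "0 < 1 / (1 + \<tau>)" using assms by simp
  from q_powr_large[OF this, of "real K"] show ?thesis
  proof eventually_elim
    case (elim k)
    show ?case
    proof
      fix y assume "y \<in> E \<tau> K"
      then have "good \<tau> y (Qs \<tau> k)" using elim Qs_ge[OF assms, of k] unfolding E_def by auto
      from good_near[OF this, of k] obtain i
        where "near y k i (Qs \<tau> k powr (- \<tau>) + Qs \<tau> k / real (q k) * \<bar>D k\<bar>)" by auto
      moreover have "Qs \<tau> k / real (q k) * \<bar>D k\<bar> \<le> Qs \<tau> k / real (q k) * (2 / real (q (Suc k)))"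
        by (intro mult_left_mono D_upper) (auto simp: less_imp_le)
      then have "Qs \<tau> k / real (q k) * \<bar>D k\<bar> \<le> 2 * ell \<tau> k"
        by (rule order_trans) (simp add: Qs_eq[OF assms])
      ultimately show "\<exists>i. near y k i (3 * ell \<tau> k)"
        unfolding Qs_powr[OF assms] by (intro exI[of _ i]) (erule near_mono, linarith)
    qed
  qed
qed

text \<open>The product telescopes over a run of indices where the clusters fill everything; such
  runs can be crossed without collecting one constant per index.\<close>

lemma M_trivial_run:
  assumes "j \<le> k" "\<And>i. j \<le> i \<Longrightarrow> i < k \<Longrightarrow> L t i = 1 / real (q i)"
  shows "M t k = M t j * real (q k) / real (q j)"
  using assms
proof (induction k rule: dec_induct)
  case (step k)
  then have "M t k = M t j * real (q k) / real (q j)" "L t k = 1 / real (q k)" by auto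
  then show ?case by (simp add: M_def)
qed simp

section \<open>Coverings at the scales \<open>L t k\<close>, first for exponents below 1\<close>

lemma L_mono_index: "0 < t \<Longrightarrow> t \<le> 1 \<Longrightarrow> j \<le> k \<Longrightarrow> L t k \<le> L t j"
  using ell_mono_index[of t j k] q_mono[of j k] by (simp add: L_small) (auto simp: min_le_iff_disj frac_le)

definition coverable :: "real \<Rightarrow> real set \<Rightarrow> bool" where
  "coverable t A \<longleftrightarrow> (\<exists>B>0. \<forall>\<^sub>F k in sequentially. \<exists>X. finite X \<and> A \<subseteq> (\<Union>x\<in>X. cball x (B * L t k)) \<and>
      real (card X) \<le> B * M t k)"

text \<open>The sum for the cover at \<open>k\<close> is a constant times
  \<open>M t k * L t k powr s'\<close>. At the frequent \<open>k\<close> this is at most a constant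
  times \<open>q k powr (s - s')\<close>, which tends to 0.\<close>

lemma coverable_hnull:
  assumes "coverable t A" and freq: "\<exists>\<^sub>F k in sequentially. ln (M t k) \<le> s * lam t k" and s: "0 \<le> s" "s < s'"
  shows "hnull s' A"
proof (rule hnullI)
  show "0 < s'" using s by simp
  fix e :: real assume "0 < e"
  obtain B where B: "0 < B" and cov: "\<forall>\<^sub>F k in sequentially. \<exists>X. finite X \<and> A \<subseteq> (\<Union>x\<in>X. cball x (B * L t k)) \<and>
      real (card X) \<le> B * M t k" using assms(1) unfolding coverable_def by blast
  let ?c = "B * (2 * B) powr s'"
  have "\<forall>\<^sub>F k in sequentially. ?c / e \<le> real (q k) powr (s' - s)" using s by (intro q_powr_large) auto
  from frequently_eventually_frequently[OF freq eventually_conj[OF cov this]]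
  obtain k X where k: "ln (M t k) \<le> s * lam t k" "?c / e \<le> real (q k) powr (s' - s)"
    and X: "finite X" "A \<subseteq> (\<Union>x\<in>X. cball x (B * L t k))" "real (card X) \<le> B * M t k"
    by (auto dest!: frequently_ex)
  have "real (card X) * (2 * (B * L t k)) powr s' \<le> B * M t k * (2 * (B * L t k)) powr s'"
    using X(3) by (rule mult_right_mono) simp
  also have "\<dots> = ?c * (M t k * L t k powr s')"
    using B by (simp add: powr_mult)
  also have "M t k * L t k powr s' = exp (ln (M t k) - s' * lam t k)"
    by (simp add: exp_diff powr_def ln_L exp_minus divide_inverse)
  also have "\<dots> \<le> exp (- ((s' - s) * ln (real (q k))))"
  proof -
    have "(s' - s) * ln (real (q k)) \<le> (s' - s) * lam t k" using s lam_ge by (intro mult_left_mono) auto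
    then show ?thesis using k(1) by (simp add: algebra_simps)
  qed
  also have "\<dots> = 1 / real (q k) powr (s' - s)" by (simp add: powr_def exp_minus divide_inverse)
  finally have 1: "real (card X) * (2 * (B * L t k)) powr s' \<le> ?c * (1 / real (q k) powr (s' - s))"
    using B by (simp add: mult_left_mono)
  have "?c \<le> e * real (q k) powr (s' - s)" using k(2) \<open>0 < e\<close> by (simp add: pos_divide_le_eq mult.commute)
  then have "?c * (1 / real (q k) powr (s' - s)) \<le> e"
    by (simp add: pos_divide_le_eq)
  with 1 have "real (card X) * (2 * (B * L t k)) powr s' \<le> e" by linarith
  then show "\<exists>X r. finite X \<and> 0 \<le> r \<and> A \<subseteq> (\<Union>x\<in>X. cball x r) \<and> real (card X) * (2 * r) powr s' \<le> e"
    using X B by (intro exI[of _ X] exI[of _ "B * L t k"]) auto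
qed


text \<open>Each cluster is replaced by the fraction \<open>r / q k\<close> near it, and the
  fractions near \<open>E \<tau> K\<close> are counted. One refinement loses a factor 21, which the
  gap between \<open>t\<close> and \<open>\<tau>\<close> absorbs only at an index where
  \<open>L t j = ell t j\<close>; all other indices are jumped over.\<close>

lemma E_coverable_small:
  assumes t: "0 < t" "t < \<tau>" "\<tau> < 1"
  shows "coverable t (E \<tau> K)"
proof -
  have \<tau>: "0 < \<tau>" "\<tau> \<le> 1" and t1: "t \<le> 1" using t by auto
  have "\<forall>\<^sub>F k in sequentially. (\<forall>y\<in>E \<tau> K. \<exists>i. near y k i (3 * ell \<tau> k)) \<and> 21 * ell \<tau> k \<le> ell t k"
    using t by (intro eventually_conj E_near ell_slack) auto
  then obtain K1 where K1: "\<And>k y. K1 \<le> k \<Longrightarrow> y \<in> E \<tau> K \<Longrightarrow> \<exists>i. near y k i (3 * ell \<tau> k)"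
      "\<And>k. K1 \<le> k \<Longrightarrow> 21 * ell \<tau> k \<le> ell t k"
    unfolding eventually_sequentially by meson
  define R where "R k = {r::int. \<exists>y\<in>E \<tau> K. \<bar>y - real_of_int r / real (q k)\<bar> \<le> 5 * L \<tau> k}" for k
  have ex_R: "\<exists>r\<in>R k. \<bar>y - real_of_int r / real (q k)\<bar> \<le> 5 * L \<tau> k" if y: "y \<in> E \<tau> K" and k: "K1 \<le> k" for y k
  proof -
    have "\<exists>r::int. \<bar>y - real_of_int r / real (q k)\<bar> \<le> 5 * L \<tau> k"
    proof (cases "ell \<tau> k \<le> 1 / real (q k)")
      case True
      obtain i a where i: "1 \<le> i" "i \<le> q k" "\<bar>y - (real i * \<theta> - of_int a)\<bar> < 3 * ell \<tau> k"
        using K1(1)[OF k y] unfolding near_def by auto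
      \<comment> \<open>The orbit point differs from a fraction with denominator \<open>q k\<close>
        by this drift of at most \<open>2 * ell \<tau> k\<close>; added to the 3 of
        \<open>E_near\<close> it explains the radius \<open>5 * L \<tau> k\<close>.\<close>
      have "real i / real (q k) * \<bar>D k\<bar> \<le> 1 * (2 / real (q (Suc k)))"
        using i D_upper[of k] by (intro mult_mono) auto
      also have "\<dots> \<le> 2 * ell \<tau> k" using ell_ge_small[OF \<tau>, of k] by simp
      finally have iD: "\<bar>real i / real (q k) * D k\<bar> \<le> 2 * ell \<tau> k" by (simp add: abs_mult)
      have "real i * \<theta> - of_int a = real_of_int (int i * p k - a * int (q k)) / real (q k) + real i / real (q k) * D k"
        unfolding D_def by (simp add: field_simps)
      moreover have "\<bar>y - x\<bar> < 3 * e \<Longrightarrow> \<bar>w\<bar> \<le> 2 * e \<Longrightarrow> x = z + w \<Longrightarrow> \<bar>y - z\<bar> \<le> 5 * e" for x z w e :: real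
        by linarith
      ultimately have "\<bar>y - real_of_int (int i * p k - a * int (q k)) / real (q k)\<bar> \<le> 5 * ell \<tau> k"
        using i(3) iD by blast
      moreover have "L \<tau> k = ell \<tau> k" using True by (simp add: L_small[OF \<tau>])
      ultimately show ?thesis by metis
    next
      case False
      then have L: "L \<tau> k = 1 / real (q k)" by (simp add: L_small[OF \<tau>])
      define r where "r = \<lfloor>y * real (q k)\<rfloor>"
      have "real_of_int r \<le> y * real (q k)" "y * real (q k) < real_of_int r + 1" unfolding r_def by linarith+
      then have "real_of_int r / real (q k) \<le> y" "y \<le> (real_of_int r + 1) / real (q k)"
        by (simp_all add: pos_divide_le_eq pos_le_divide_eq)
      then have "\<bar>y - real_of_int r / real (q k)\<bar> \<le> 1 / real (q k)" by (simp add: add_divide_distrib abs_le_iff)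
      then show ?thesis unfolding L by (intro exI[of _ r]) (rule order_trans, auto simp: divide_right_mono)
    qed
    then show ?thesis using y unfolding R_def by blast
  qed
  have R_bound: "finite (R k) \<and> real (card (R k)) \<le> 13 * real (q k)" for k
  proof -
    have sub: "R k \<subseteq> {r. \<bar>real_of_int r - 0\<bar> \<le> real (q k) + 5}"
    proof
      fix r assume "r \<in> R k"
      then obtain y where y: "0 \<le> y" "y < 1" "\<bar>y - real_of_int r / real (q k)\<bar> \<le> 5 * L \<tau> k"
        unfolding R_def E_def by auto
      have "5 * L \<tau> k \<le> 5 / real (q k)" using L_le[of \<tau> k] by simp
      then have "\<bar>real_of_int r / real (q k)\<bar> \<le> 1 + 5 / real (q k)" using y by linarith
      also have "\<dots> = (real (q k) + 5) / real (q k)" by (simp add: add_divide_distrib)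
      finally show "r \<in> {r. \<bar>real_of_int r - 0\<bar> \<le> real (q k) + 5}"
        by (simp add: abs_divide divide_le_cancel)
    qed
    note fin = int_ball_count[of "real (q k) + 5" 0]
    have "real (card (R k)) \<le> 2 * (real (q k) + 5) + 1"
      using card_mono[OF fin(1) sub] fin(2) by (simp del: diff_zero)
    then show ?thesis using finite_subset[OF sub fin(1)] q_ge1[of k] by auto
  qed
  \<comment> \<open>The stages \<open>j\<close> and \<open>k\<close> need not be adjacent, which
    permits the jumps. A ball of radius \<open>10 * L \<tau> j\<close> holds at most
    \<open>20 * q k * L \<tau> j + 1\<close> fractions, and the 1 is absorbed by
    \<open>1 \<le> L \<tau> j * q k\<close>.\<close>
  have R_step: "real (card (R k)) \<le> real (card (R j)) * (21 * (real (q k) * L \<tau> j))"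
    if jk: "K1 \<le> j" "j < k" for j k
  proof -
    define G where "G r' = {r::int. \<bar>real_of_int r - real_of_int r' / real (q j) * real (q k)\<bar> \<le> 10 * L \<tau> j * real (q k)}" for r' :: int
    have Lq: "1 \<le> L \<tau> j * real (q k)"
    proof -
      have "1 / real (q (Suc j)) * real (q (Suc j)) \<le> L \<tau> j * real (q k)"
        using jk q_mono[of "Suc j" k] by (intro mult_mono L_ge) auto
      then show ?thesis by simp
    qed
    have G: "finite (G r')" "real (card (G r')) \<le> 21 * (real (q k) * L \<tau> j)" for r'
    proof -
      have d: "0 \<le> 10 * L \<tau> j * real (q k)" by simp
      show "finite (G r')" unfolding G_def by (rule int_ball_count(1)[OF d])
      have "real (card (G r')) \<le> 2 * (10 * L \<tau> j * real (q k)) + 1" unfolding G_def by (rule int_ball_count(2)[OF d])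
      then show "real (card (G r')) \<le> 21 * (real (q k) * L \<tau> j)" using Lq by (simp add: mult.commute)
    qed
    have "R k \<subseteq> (\<Union>r'\<in>R j. G r')"
    proof
      fix r assume "r \<in> R k"
      then obtain y where y: "y \<in> E \<tau> K" "\<bar>y - real_of_int r / real (q k)\<bar> \<le> 5 * L \<tau> k" unfolding R_def by auto
      obtain r' where r': "r' \<in> R j" "\<bar>y - real_of_int r' / real (q j)\<bar> \<le> 5 * L \<tau> j" using ex_R[OF y(1) jk(1)] by auto
      have "\<bar>real_of_int r / real (q k) - real_of_int r' / real (q j)\<bar> \<le> 10 * L \<tau> j"
        using y r' L_mono_index[OF \<tau>, of j k] jk by linarith
      then have "\<bar>real_of_int r / real (q k) - real_of_int r' / real (q j)\<bar> * real (q k) \<le> 10 * L \<tau> j * real (q k)"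
        by (rule mult_right_mono) simp
      moreover have "\<bar>real_of_int r / real (q k) - real_of_int r' / real (q j)\<bar> * real (q k) =
          \<bar>(real_of_int r / real (q k) - real_of_int r' / real (q j)) * real (q k)\<bar>" by (simp add: abs_mult)
      moreover have "(real_of_int r / real (q k) - real_of_int r' / real (q j)) * real (q k) =
          real_of_int r - real_of_int r' / real (q j) * real (q k)" by (simp add: left_diff_distrib)
      ultimately have "r \<in> G r'" unfolding G_def by simp
      then show "r \<in> (\<Union>r'\<in>R j. G r')" using r' by blast
    qed
    then have "card (R k) \<le> card (\<Union>r'\<in>R j. G r')" using R_bound G by (intro card_mono) auto
    also have "\<dots> \<le> (\<Sum>r'\<in>R j. card (G r'))" using R_bound by (intro card_UN_le) auto
    finally have "real (card (R k)) \<le> (\<Sum>r'\<in>R j. real (card (G r')))" by (metis of_nat_le_iff of_nat_sum)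
    also have "\<dots> \<le> (\<Sum>r'\<in>R j. 21 * (real (q k) * L \<tau> j))" by (intro sum_mono G)
    finally show ?thesis by simp
  qed
  \<comment> \<open>This turns the trivial bound \<open>13 * q k\<close> into
    \<open>B * M t k\<close> as long as no index with \<open>ell t j < 1 / q j\<close> has occurred
    since \<open>K1\<close>.\<close>
  define B where "B = 13 * real (q K1) / M t K1"
  have "0 < B" by (simp add: B_def)
  have card_R: "real (card (R k)) \<le> B * M t k" if "K1 \<le> k" for k
    using that
  proof (induction k rule: less_induct)
    case (less k)
    define J where "J = {j. K1 \<le> j \<and> j < k \<and> ell t j < 1 / real (q j)}"
    have finJ: "finite J" unfolding J_def by simp
    show ?case
    proof (cases "J = {}")
      case True
      then have "M t k = M t K1 * real (q k) / real (q K1)"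
        using less.prems by (intro M_trivial_run) (auto simp: J_def L_small[OF t(1) t1] not_less min_def)
      then have "B * M t k = 13 * real (q k)" by (simp add: B_def)
      then show ?thesis using R_bound[of k] by simp
    next
      case False
      \<comment> \<open>After the last index at which \<open>ell t\<close> is the shorter length,
        \<open>M t\<close> telescopes; so one step from \<open>j\<close> to \<open>k\<close> is
        enough and its factor 21 is absorbed at \<open>j\<close>.\<close>
      define j where "j = Max J"
      have j: "K1 \<le> j" "j < k" "ell t j < 1 / real (q j)" and jmax: "\<And>i. i \<in> J \<Longrightarrow> i \<le> j"
        using Max_in[OF finJ False] Max_ge[OF finJ] unfolding j_def[symmetric] by (auto simp: J_def)
      have Lj: "L t j = ell t j" using j by (simp add: L_small[OF t(1) t1])
      have "M t k = M t (Suc j) * real (q k) / real (q (Suc j))"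
      proof (rule M_trivial_run)
        fix i assume i: "Suc j \<le> i" "i < k"
        then have "i \<notin> J" using jmax[of i] by auto
        then show "L t i = 1 / real (q i)" using i j by (auto simp: J_def L_small[OF t(1) t1])
      qed (use j in simp)
      then have Mk: "M t k = M t j * (real (q k) * L t j)" by (simp add: M_def)
      have "21 * L \<tau> j \<le> 21 * ell \<tau> j" by (simp add: L_small[OF \<tau>])
      also have "\<dots> \<le> L t j" using K1(2)[OF j(1)] Lj by simp
      finally have "real (q k) * (21 * L \<tau> j) \<le> real (q k) * L t j" by (rule mult_left_mono) simp
      then have le: "21 * (real (q k) * L \<tau> j) \<le> real (q k) * L t j" by (simp only: mult.left_commute)
      then have "real (card (R j)) * (21 * (real (q k) * L \<tau> j)) \<le> (B * M t j) * (real (q k) * L t j)"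
        using \<open>0 < B\<close> by (intro mult_mono[OF less.IH[OF j(2,1)] le]) (auto simp: less_imp_le)
      with R_step[OF j(1,2)] have "real (card (R k)) \<le> (B * M t j) * (real (q k) * L t j)" by (rule order_trans)
      then show ?thesis unfolding Mk by (simp only: mult.assoc)
    qed
  qed
  show ?thesis unfolding coverable_def
  proof (intro exI[of _ "max B 5"] conjI)
    show "\<forall>\<^sub>F k in sequentially. \<exists>X. finite X \<and> E \<tau> K \<subseteq> (\<Union>x\<in>X. cball x (max B 5 * L t k)) \<and>
        real (card X) \<le> max B 5 * M t k"
    proof (rule eventually_sequentiallyI)
      fix k assume k: "K1 \<le> k"
      let ?X = "(\<lambda>r. real_of_int r / real (q k)) ` R k"
      have "E \<tau> K \<subseteq> (\<Union>x\<in>?X. cball x (max B 5 * L t k))"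
      proof
        fix y assume "y \<in> E \<tau> K"
        then obtain r where r: "r \<in> R k" "\<bar>y - real_of_int r / real (q k)\<bar> \<le> 5 * L \<tau> k" using ex_R k by blast
        have "5 * L \<tau> k \<le> max B 5 * L t k"
          using L_antimono[of t \<tau> k] t by (intro mult_mono) auto
        then have "y \<in> cball (real_of_int r / real (q k)) (max B 5 * L t k)"
          using r by (simp add: dist_real_def abs_minus_commute)
        then show "y \<in> (\<Union>x\<in>?X. cball x (max B 5 * L t k))" using r by blast
      qed
      moreover have "real (card ?X) \<le> max B 5 * M t k"
      proof -
        have "real (card ?X) \<le> real (card (R k))" using R_bound[of k] by (simp add: card_image_le)
        also have "\<dots> \<le> B * M t k" by (rule card_R[OF k])
        also have "\<dots> \<le> max B 5 * M t k" by (intro mult_right_mono) (auto simp: less_imp_le)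
        finally show ?thesis .
      qed
      ultimately show "\<exists>X. finite X \<and> E \<tau> K \<subseteq> (\<Union>x\<in>X. cball x (max B 5 * L t k)) \<and>
          real (card X) \<le> max B 5 * M t k" using R_bound[of k] by (intro exI[of _ ?X]) simp
    qed
  qed simp
qed


section \<open>Coverings for exponents above 1\<close>

lemma near_count:
  assumes "0 \<le> d"
  shows "real (card {i. near x k i d}) \<le> 4 * real (q k) * d + 1"
proof -
  define W where "W = {i. near x k i d}"
  have "W \<subseteq> {..q k}" unfolding W_def near_def by auto
  then have fin: "finite W" by (rule finite_subset) simp
  have "\<exists>a::int. \<bar>x - (real i * \<theta> - of_int a)\<bar> < d" if "i \<in> W" for i using that unfolding W_def near_def by auto
  then obtain a :: "nat \<Rightarrow> int" where a: "\<And>i. i \<in> W \<Longrightarrow> \<bar>x - (real i * \<theta> - of_int (a i))\<bar> < d" by metis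
  define f where "f i = real i * \<theta> - of_int (a i)" for i
  have inj: "inj_on f W" unfolding f_def by (rule inj_onI) (rule orbit_inj)
  have "real (card (f ` W)) \<le> 2 * d / (1 / (2 * real (q k))) + 1"
  proof (rule card_separated_le)
    fix u v assume "u \<in> f ` W" "v \<in> f ` W" "u \<noteq> v"
    then obtain i j where ij: "i \<in> W" "j \<in> W" "u = f i" "v = f j" "f i \<noteq> f j" by auto
    have "\<bar>int i - int j\<bar> < int (q k)" using ij(1,2) unfolding W_def near_def mem_Collect_eq by linarith
    then show "1 / (2 * real (q k)) \<le> \<bar>u - v\<bar>" using ij orbit_sep unfolding f_def by blast
  next
    fix u v assume "u \<in> f ` W" "v \<in> f ` W"
    then obtain i j where ij: "i \<in> W" "j \<in> W" "u = f i" "v = f j" by auto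
    have "\<bar>x - u\<bar> < d" "\<bar>x - v\<bar> < d" using ij a unfolding f_def by auto
    then show "\<bar>u - v\<bar> \<le> 2 * d" by linarith
  qed (use fin assms in auto)
  then show ?thesis unfolding W_def[symmetric] using inj by (simp add: card_image mult_ac)
qed

text \<open>Here \<open>X k\<close> collects the indices of orbit points seen near
  \<open>E \<tau> K\<close> at \<open>Q = q k\<close>. If \<open>q (Suc k)\<close> is small against
  \<open>q k powr \<tau>\<close>, the index survives unchanged and nothing is lost; otherwise new
  indices are counted and the constant is absorbed.\<close>

lemma E_coverable_large:
  assumes t: "1 < t" "t < \<tau>"
  shows "coverable t (E \<tau> K)"
proof -
  \<comment> \<open>When \<open>q k powr \<tau> < 4 * q (Suc k)\<close>, the gap between
    \<open>t'\<close> and \<open>\<tau>\<close> absorbs the 4 and gives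
    \<open>1 / q (Suc k) \<le> ell t' k\<close>; the gap between \<open>t\<close> and
    \<open>t'\<close> then absorbs the factor 17.\<close>
  define t' where "t' = (t + \<tau>) / 2"
  have t': "t < t'" "t' < \<tau>" using t by (auto simp: t'_def)
  have "\<forall>\<^sub>F k in sequentially. (\<forall>y\<in>E \<tau> K. \<exists>i. near y k i (3 * ell \<tau> k)) \<and> 17 * ell t' k \<le> ell t k \<and>
      16 \<le> real (q k) powr (\<tau> - 1) \<and> 4 \<le> real (q k) powr (\<tau> - t') \<and> real K \<le> real (q k) powr 1"
    using t t' by (intro eventually_conj E_near ell_slack q_powr_large) auto
  then obtain K1 where K1: "\<And>k y. K1 \<le> k \<Longrightarrow> y \<in> E \<tau> K \<Longrightarrow> \<exists>i. near y k i (3 * ell \<tau> k)"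
      "\<And>k. K1 \<le> k \<Longrightarrow> 17 * ell t' k \<le> ell t k"
      "\<And>k. K1 \<le> k \<Longrightarrow> 16 \<le> real (q k) powr (\<tau> - 1)"
      "\<And>k. K1 \<le> k \<Longrightarrow> 4 \<le> real (q k) powr (\<tau> - t')"
      "\<And>k. K1 \<le> k \<Longrightarrow> real K \<le> real (q k)"
    unfolding eventually_sequentially by (auto simp: Suc_le_eq)
  have ell': "ell \<tau> k \<le> ell t' k" for k using t t' by (intro ell_antimono) auto
  have ell1: "17 * ell \<tau> k \<le> 1 / real (q k)" if "K1 \<le> k" for k
    using K1(2)[OF that] ell'[of k] ell_le_large[of t k] t by linarith
  have qt: "16 * real (q k) powr (- \<tau>) \<le> 1 / real (q k)" if "K1 \<le> k" for k
  proof -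
    have "16 * real (q k) powr (- \<tau>) \<le> real (q k) powr (\<tau> - 1) * real (q k) powr (- \<tau>)"
      using K1(3)[OF that] by (intro mult_right_mono) auto
    also have "\<dots> = real (q k) powr (- 1)" by (simp add: powr_add[symmetric])
    also have "\<dots> = 1 / real (q k)" by (simp add: powr_minus_divide)
    finally show ?thesis .
  qed
  have near2: "\<exists>i. near y k i (real (q k) powr (- \<tau>))" if "y \<in> E \<tau> K" "K1 \<le> k" for y k
  proof -
    have "good \<tau> y (real (q k))" using that K1(5) unfolding E_def by auto
    then obtain n where n: "1 \<le> n" "n \<le> q k" "nint_dist (real n * \<theta> - y) < real (q k) powr (- \<tau>)"
      unfolding good_def by auto
    obtain c where "nint_dist (real n * \<theta> - y) = \<bar>real n * \<theta> - y - of_int c\<bar>" by (rule nint_dist_eq)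
    then have "\<bar>y - (real n * \<theta> - of_int c)\<bar> < real (q k) powr (- \<tau>)" using n(3) by linarith
    then show ?thesis using n unfolding near_def by blast
  qed
  define X where "X k = {i. \<exists>y\<in>E \<tau> K. near y k i (real (q k) powr (- \<tau>))}" for k
  have X_sub: "X k \<subseteq> {1..q k}" for k unfolding X_def near_def by auto
  then have finX: "finite (X k)" for k by (rule finite_subset) simp
  \<comment> \<open>The index found at \<open>Q = q k\<close> and the one found at
    \<open>Qs \<tau> k\<close> coincide, because the two radii together do not exceed the separation
    of the first \<open>q k\<close> orbit points.\<close>
  have X_near: "\<exists>i\<in>X k. near y k i (real (q k) powr (- \<tau>)) \<and> near y k i (3 * ell \<tau> k)"
    if y: "y \<in> E \<tau> K" and k: "K1 \<le> k" for y k
  proof -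
    obtain i where i: "near y k i (real (q k) powr (- \<tau>))" using near2[OF y k] by auto
    obtain i' where i': "near y k i' (3 * ell \<tau> k)" using K1(1)[OF k y] by auto
    have "1 / (2 * real (q k)) = 1 / real (q k) / 2" by simp
    then have "real (q k) powr (- \<tau>) + 3 * ell \<tau> k \<le> 1 / (2 * real (q k))"
      using qt[OF k] ell1[OF k] powr_ge_zero[of "real (q k)" "- \<tau>"] ell_pos[of \<tau> k] by linarith
    from near_eq[OF i i' this] show ?thesis using i i' y unfolding X_def by blast
  qed
  have X_step: "real (card (X (Suc k))) \<le> real (card (X k)) * (real (q (Suc k)) * L t k)" if k: "K1 \<le> k" for k
  proof (cases "4 * real (q (Suc k)) \<le> real (q k) powr \<tau>")
    \<comment> \<open>The radius \<open>q k powr (- \<tau>)\<close> is now fine enough to tell the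
      first \<open>q (Suc k)\<close> orbit points apart, so the index seen at stage
      \<open>Suc k\<close> is the one seen at stage \<open>k\<close>.\<close>
    case True
    have "X (Suc k) \<subseteq> X k"
    proof
      fix i' assume "i' \<in> X (Suc k)"
      then obtain y where y: "y \<in> E \<tau> K" and i': "near y (Suc k) i' (real (q (Suc k)) powr (- \<tau>))" unfolding X_def by auto
      obtain i where i: "near y k i (real (q k) powr (- \<tau>))" using near2[OF y k] by auto
      then have i2: "near y (Suc k) i (real (q k) powr (- \<tau>))" using q_less_Suc[of k] unfolding near_def by auto
      have "real (q (Suc k)) powr (- \<tau>) \<le> real (q k) powr (- \<tau>)"
        using t q_less_Suc[of k] by (intro powr_mono2') auto
      moreover have "real (q k) powr (- \<tau>) \<le> 1 / (4 * real (q (Suc k)))"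
        unfolding powr_minus_divide using True by (intro divide_left_mono) auto
      moreover have "1 / (2 * real (q (Suc k))) = 2 * (1 / (4 * real (q (Suc k))))" by simp
      ultimately have "real (q (Suc k)) powr (- \<tau>) + real (q k) powr (- \<tau>) \<le> 1 / (2 * real (q (Suc k)))" by linarith
      from near_eq[OF i' i2 this] show "i' \<in> X k" using i y unfolding X_def by auto
    qed
    then have "card (X (Suc k)) \<le> card (X k)" by (intro card_mono finX)
    moreover have "1 \<le> real (q (Suc k)) * L t k"
      using L_ge[of k t] by (simp add: pos_divide_le_eq mult.commute)
    then have "real (card (X k)) * 1 \<le> real (card (X k)) * (real (q (Suc k)) * L t k)"
      by (intro mult_left_mono) auto
    ultimately show ?thesis by simp
  next
    case False
    let ?d = "3 * ell \<tau> k + 1 / real (q (Suc k))"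
    define G where "G i = (\<Union>a::int. {i'. near (real i * \<theta> - of_int a) (Suc k) i' ?d})" for i
    \<comment> \<open>\<open>near\<close> is invariant under integer shifts of the point, so the
      union over \<open>a\<close> collapses and its size does not depend on
      \<open>a\<close>.\<close>
    have Geq: "G i = {i'. near (real i * \<theta>) (Suc k) i' ?d}" for i
    proof (intro set_eqI iffI)
      fix i' assume "i' \<in> G i"
      then obtain a b where i': "1 \<le> i'" "i' \<le> q (Suc k)" and ab: "\<bar>real i * \<theta> - of_int a - (real i' * \<theta> - of_int b)\<bar> < ?d"
        unfolding G_def near_def by auto
      have eq: "real i * \<theta> - of_int a - (real i' * \<theta> - of_int b) = real i * \<theta> - (real i' * \<theta> - of_int (b - a))"
        by simp
      show "i' \<in> {i'. near (real i * \<theta>) (Suc k) i' ?d}" unfolding near_def mem_Collect_eq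
        using i' ab[unfolded eq] by blast
    next
      fix i' assume "i' \<in> {i'. near (real i * \<theta>) (Suc k) i' ?d}"
      then show "i' \<in> G i" unfolding G_def by (auto intro!: exI[of _ 0])
    qed
    have qq: "1 / real (q (Suc k)) \<le> ell t' k"
    proof -
      have "real (q k) powr t' * 4 \<le> real (q k) powr t' * real (q k) powr (\<tau> - t')"
        using K1(4)[OF k] by (intro mult_left_mono) auto
      also have "\<dots> = real (q k) powr \<tau>" by (simp add: powr_add[symmetric])
      finally have "real (q k) powr t' \<le> real (q (Suc k))" using False by linarith
      then show ?thesis using t t' by (subst ell_ge_iff) auto
    qed
    have cardG: "real (card (G i)) \<le> real (q (Suc k)) * L t k" for i
    proof -
      have "real (card (G i)) \<le> 4 * real (q (Suc k)) * ?d + 1" unfolding Geq by (rule near_count) simp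
      also have "\<dots> = real (q (Suc k)) * (12 * ell \<tau> k + 5 * (1 / real (q (Suc k))))" by (simp add: algebra_simps)
      also have "\<dots> \<le> real (q (Suc k)) * (17 * ell t' k)"
        using qq ell'[of k] by (intro mult_left_mono) auto
      also have "\<dots> \<le> real (q (Suc k)) * L t k"
        using K1(2)[OF k] t by (intro mult_left_mono) (auto simp: L_large)
      finally show ?thesis .
    qed
    have finG: "finite (G i)" for i
      by (rule finite_subset[of _ "{..q (Suc k)}"]) (auto simp: Geq near_def)
    have "X (Suc k) \<subseteq> (\<Union>i\<in>X k. G i)"
    proof
      fix i' assume "i' \<in> X (Suc k)"
      then obtain y where y: "y \<in> E \<tau> K" and "near y (Suc k) i' (real (q (Suc k)) powr (- \<tau>))" unfolding X_def by auto
      then obtain b where i': "1 \<le> i'" "i' \<le> q (Suc k)" "\<bar>y - (real i' * \<theta> - of_int b)\<bar> < real (q (Suc k)) powr (- \<tau>)"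
        unfolding near_def by auto
      obtain i where "i \<in> X k" "near y k i (3 * ell \<tau> k)" using X_near[OF y k] by auto
      then obtain a where i: "i \<in> X k" "\<bar>y - (real i * \<theta> - of_int a)\<bar> < 3 * ell \<tau> k" unfolding near_def by auto
      have "real (q (Suc k)) powr (- \<tau>) \<le> real (q (Suc k)) powr (- 1)"
        using t q_ge1 by (intro powr_mono) auto
      then have "real (q (Suc k)) powr (- \<tau>) \<le> 1 / real (q (Suc k))" by (simp add: powr_minus_divide)
      then have "\<bar>real i * \<theta> - of_int a - (real i' * \<theta> - of_int b)\<bar> < ?d" using i i' by linarith
      then have "i' \<in> G i" using i' unfolding G_def near_def by blast
      then show "i' \<in> (\<Union>i\<in>X k. G i)" using i by blast
    qed
    then have "card (X (Suc k)) \<le> card (\<Union>i\<in>X k. G i)" using finX finG by (intro card_mono) auto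
    also have "\<dots> \<le> (\<Sum>i\<in>X k. card (G i))" by (rule card_UN_le[OF finX])
    finally have "real (card (X (Suc k))) \<le> (\<Sum>i\<in>X k. real (card (G i)))" by (metis of_nat_le_iff of_nat_sum)
    also have "\<dots> \<le> (\<Sum>i\<in>X k. real (q (Suc k)) * L t k)" by (intro sum_mono cardG)
    finally show ?thesis by simp
  qed
  define B where "B = real (q K1) / M t K1"
  have "0 < B" by (simp add: B_def)
  have card_X: "real (card (X k)) \<le> B * M t k" if "K1 \<le> k" for k
    using that
  proof (induction k rule: dec_induct)
    case base
    then show ?case using card_mono[OF _ X_sub, of K1] by (simp add: B_def)
  next
    case (step k)
    have "real (card (X (Suc k))) \<le> real (card (X k)) * (real (q (Suc k)) * L t k)" using step.hyps by (intro X_step) simp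
    also have "\<dots> \<le> (B * M t k) * (real (q (Suc k)) * L t k)" using step.IH by (intro mult_right_mono) auto
    finally show ?case by (simp add: M_def mult_ac)
  qed
  show ?thesis unfolding coverable_def
  proof (intro exI[of _ "max (3 * B) 3"] conjI)
    show "\<forall>\<^sub>F k in sequentially. \<exists>X. finite X \<and> E \<tau> K \<subseteq> (\<Union>x\<in>X. cball x (max (3 * B) 3 * L t k)) \<and>
        real (card X) \<le> max (3 * B) 3 * M t k"
    proof (rule eventually_sequentiallyI)
      fix k assume k: "K1 \<le> k"
      \<comment> \<open>The shifts by -1, 0 and 1 catch every representative that lies within
        distance 1 of a point of the unit interval.\<close>
      define f where "f = (\<lambda>(i, z::int). frac (real i * \<theta>) + real_of_int z)"
      let ?X = "f ` (X k \<times> {-1..1})"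
      have "E \<tau> K \<subseteq> (\<Union>x\<in>?X. cball x (max (3 * B) 3 * L t k))"
      proof
        fix y assume y: "y \<in> E \<tau> K"
        then obtain i where "i \<in> X k" "near y k i (3 * ell \<tau> k)" using X_near k by blast
        then obtain a where i: "i \<in> X k" "\<bar>y - (real i * \<theta> - of_int a)\<bar> < 3 * ell \<tau> k" unfolding near_def by auto
        have "1 / real (q k) \<le> 1" using q_ge1[of k] by simp
        then have "3 * ell \<tau> k < 1" using ell1[OF k] ell_pos[of \<tau> k] by linarith
        moreover have "0 \<le> y" "y < 1" using y by (auto simp: E_def)
        moreover have fr: "real i * \<theta> - of_int a = frac (real i * \<theta>) + real_of_int (\<lfloor>real i * \<theta>\<rfloor> - a)" by (simp add: frac_def)
        moreover have "0 \<le> frac (real i * \<theta>)" "frac (real i * \<theta>) < 1" using frac_lt_1 by auto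
        ultimately have "real_of_int (\<lfloor>real i * \<theta>\<rfloor> - a) < 2" "- 2 < real_of_int (\<lfloor>real i * \<theta>\<rfloor> - a)"
          using i(2) by linarith+
        then have "\<lfloor>real i * \<theta>\<rfloor> - a \<in> {-1..1}" by (simp del: of_int_diff)
        then have "real i * \<theta> - of_int a \<in> ?X" unfolding fr f_def using i(1) by (intro image_eqI[of _ _ "(i, \<lfloor>real i * \<theta>\<rfloor> - a)"]) auto
        moreover have "3 * ell \<tau> k \<le> max (3 * B) 3 * L t k"
          using ell_antimono[of t \<tau> k] t by (intro mult_mono) (auto simp: L_large)
        then have "y \<in> cball (real i * \<theta> - of_int a) (max (3 * B) 3 * L t k)"
          using i(2) by (simp add: dist_real_def abs_minus_commute)
        ultimately show "y \<in> (\<Union>x\<in>?X. cball x (max (3 * B) 3 * L t k))" by blast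
      qed
      moreover have "real (card ?X) \<le> max (3 * B) 3 * M t k"
      proof -
        have "card ?X \<le> card (X k \<times> {-1..1::int})" using finX by (intro card_image_le) auto
        then have "real (card ?X) \<le> 3 * real (card (X k))" by (simp add: card_cartesian_product)
        also have "\<dots> \<le> 3 * B * M t k" using card_X[OF k] by simp
        also have "\<dots> \<le> max (3 * B) 3 * M t k" by (intro mult_right_mono) (auto simp: less_imp_le)
        finally show ?thesis .
      qed
      ultimately show "\<exists>X. finite X \<and> E \<tau> K \<subseteq> (\<Union>x\<in>X. cball x (max (3 * B) 3 * L t k)) \<and>
          real (card X) \<le> max (3 * B) 3 * M t k" using finX[of k] by (intro exI[of _ ?X]) simp
    qed
  qed simp
qed

end

section \<open>Lower bounds\<close>

context irrational
begin

section \<open>Cantor subsets for exponents above 1\<close>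

lemma goodI:
  assumes "1 \<le> n" "real n \<le> Q" "\<bar>y - (real n * \<theta> - of_int a)\<bar> < Q powr (- \<tau>)"
  shows "good \<tau> y Q"
proof -
  have "nint_dist (real n * \<theta> - y) \<le> \<bar>real n * \<theta> - y - of_int a\<bar>" by (rule nint_dist_le)
  also have "\<dots> = \<bar>y - (real n * \<theta> - of_int a)\<bar>" by linarith
  finally show ?thesis unfolding good_def using assms by (meson le_less_trans)
qed

lemma q_bracket:
  assumes "real (q K) \<le> Q"
  obtains k where "K \<le> k" "real (q k) \<le> Q" "Q < real (q (Suc k))"
proof -
  define A where "A = {k. real (q k) \<le> Q}"
  have "A \<subseteq> {..nat \<lceil>Q\<rceil>}"
  proof
    fix k assume "k \<in> A"
    then have "real k \<le> Q" using q_ge[of k] unfolding A_def by simp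
    then show "k \<in> {..nat \<lceil>Q\<rceil>}" by simp linarith
  qed
  then have fin: "finite A" by (rule finite_subset) simp
  have K: "K \<in> A" using assms by (simp add: A_def)
  have "Max A \<in> A" using fin K by (intro Max_in) auto
  moreover have "K \<le> Max A" using fin K by simp
  moreover have "Suc (Max A) \<notin> A" using Max_ge[OF fin, of "Suc (Max A)"] by auto
  ultimately show ?thesis using that[of "Max A"] by (auto simp: A_def)
qed

text \<open>At \<open>Qs t k\<close> the radius for \<open>\<tau>\<close> exceeds
  \<open>ell t k\<close> by the factor \<open>Qs t k powr (t - \<tau>)\<close>, at least a positive
  power of \<open>q k\<close>; this absorbs both \<open>B\<close> and \<open>c\<close>.\<close>

lemma Qs_slack:
  assumes "0 < \<tau>" "\<tau> < t" "0 < c" and large: "B * c powr \<tau> \<le> real (q k) powr ((t - \<tau>) / (1 + t))"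
  shows "B * ell t k \<le> (c * Qs t k) powr (- \<tau>)"
proof -
  have t0: "0 < t" using assms by simp
  have "real (q k) powr ((t - \<tau>) / (1 + t)) = (real (q k) powr (1 / (1 + t))) powr (t - \<tau>)"
    by (simp add: powr_powr)
  also have "\<dots> \<le> Qs t k powr (t - \<tau>)" using assms Qs_ge[OF t0] by (intro powr_mono2) auto
  finally have "B * c powr \<tau> \<le> Qs t k powr (t - \<tau>)" using large by linarith
  then have "B * c powr \<tau> * Qs t k powr (- t) \<le> Qs t k powr (t - \<tau>) * Qs t k powr (- t)"
    by (rule mult_right_mono) simp
  also have "\<dots> = Qs t k powr (- \<tau>)" by (simp add: powr_add[symmetric])
  finally have A: "B * c powr \<tau> * ell t k \<le> Qs t k powr (- \<tau>)" unfolding Qs_powr[OF t0] .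
  have "B * ell t k = c powr (- \<tau>) * (B * c powr \<tau> * ell t k)" using \<open>0 < c\<close> by (simp add: powr_minus_divide)
  also have "\<dots> \<le> c powr (- \<tau>) * Qs t k powr (- \<tau>)" using A by (rule mult_left_mono) simp
  also have "\<dots> = (c * Qs t k) powr (- \<tau>)" using \<open>0 < c\<close> by (simp add: powr_mult less_imp_le)
  finally show ?thesis .
qed

lemma frostman_const:
  assumes "s * lam t k \<le> ln (M t k)"
  shows "1 \<le> M t k * L t k powr s"
proof -
  have "M t k * L t k powr s = exp (ln (M t k) - s * lam t k)"
    by (simp add: exp_diff powr_def ln_L exp_minus divide_inverse)
  then show ?thesis using assms by simp
qed

text \<open>Level \<open>i\<close> of the tree consists of orbit points with index up to
  \<open>q (K + i)\<close>; the children of index \<open>n\<close> have indices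
  \<open>n + j * q k\<close> and run along its cluster. For \<open>Q\<close> between
  \<open>q k\<close> and \<open>q (Suc k)\<close> the child approximates well as soon as its index
  is at most \<open>Q\<close>, and before that the parent does.\<close>

lemma dim_ge_large:
  assumes \<theta>: "0 < \<theta>" "\<theta> < 1" and t: "1 < \<tau>" "\<tau> < t" and s: "0 < s" "s \<le> 1"
    and ev: "\<forall>\<^sub>F k in sequentially. s * lam t k \<le> ln (M t k)"
  shows "s \<le> hausdorff_dim (U_set \<tau> \<theta>)"
proof -
  \<comment> \<open>The tree is rooted at \<theta>, and \<open>\<gamma>\<close> is the room that
    keeps its limit set inside the unit interval.\<close>
  define \<gamma> where "\<gamma> = min \<theta> (1 - \<theta>)"
  have "0 < \<gamma>" using \<theta> by (simp add: \<gamma>_def)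
  have t0: "0 < t" "1 < t" using t by auto
  have "\<forall>\<^sub>F k in sequentially. s * lam t k \<le> ln (M t k) \<and> 32 \<le> real (q k) powr (t - 1) \<and>
      8 / \<gamma> \<le> real (q k) powr t \<and> 7 * 2 powr \<tau> \<le> real (q k) powr ((t - \<tau>) / (1 + t)) \<and>
      5 \<le> real (q k) powr (t - \<tau>) \<and> 2 \<le> real (q k) powr (1 - 1 / t)"
    using t by (intro eventually_conj ev q_powr_large) auto
  then obtain K where
        K1: "\<And>k. K \<le> k \<Longrightarrow> s * lam t k \<le> ln (M t k)"
    and K2: "\<And>k. K \<le> k \<Longrightarrow> 32 \<le> real (q k) powr (t - 1)"
    and K3: "\<And>k. K \<le> k \<Longrightarrow> 8 / \<gamma> \<le> real (q k) powr t"
    and K4: "\<And>k. K \<le> k \<Longrightarrow> 7 * 2 powr \<tau> \<le> real (q k) powr ((t - \<tau>) / (1 + t))"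
    and K5: "\<And>k. K \<le> k \<Longrightarrow> 5 \<le> real (q k) powr (t - \<tau>)"
    and K6: "\<And>k. K \<le> k \<Longrightarrow> 2 \<le> real (q k) powr (1 - 1 / t)"
    unfolding eventually_sequentially by blast
  \<comment> \<open>A child moves by at most twice this power of \<open>q\<close>. The factor 4
    leaves enough room, since \<open>q\<close> at least doubles at every level that splits.\<close>
  define \<rho> where "\<rho> i = 4 * real (q (K + i)) powr (- t)" for i
  define \<epsilon> where "\<epsilon> i = 1 / (2 * real (q (K + i)))" for i
  define m where "m i = nat \<lceil>real (q (Suc (K + i))) * L t (K + i)\<rceil>" for i
  define ch where "ch i x = (\<lambda>j. x + real j * D (K + i)) ` {..<m i}" for i :: nat and x :: real
  define Y where "Y i = {real n * \<theta> - of_int a | n a. 1 \<le> n \<and> n \<le> q (K + i)}" for i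
  have qL: "1 \<le> real (q (Suc k)) * L t k" for k
    using L_ge[of k t] by (simp add: pos_divide_le_eq mult.commute)
  have m_ge: "real (q (Suc (K + i))) * L t (K + i) \<le> real (m i)" for i
    unfolding m_def by linarith
  have m_pos: "0 < m i" for i using m_ge[of i] qL[of "K + i"] by linarith
  \<comment> \<open>Either there is a single child, or the level splits and \<open>Qs t k\<close> separates the range of \<open>Q\<close>
      where the parent works from the range where the child works.\<close>
  have dich: "m i = 1 \<or> (real (m i) - 1 \<le> real (q (Suc k)) * ell t k \<and> real (q k) \<le> Qs t k \<and>
      2 * Qs t k \<le> real (q (Suc k)) \<and> 2 * real (q k) \<le> real (q (Suc k)))" if k: "k = K + i" for i k
  proof (cases "1 / real (q (Suc k)) \<le> ell t k")
    case False
    then have "L t k = 1 / real (q (Suc k))" using t0 by (simp add: L_large)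
    then show ?thesis unfolding m_def k[symmetric] by simp
  next
    case True
    then have L: "L t k = ell t k" using t0 by (simp add: L_large)
    have 1: "real (m i) - 1 \<le> real (q (Suc k)) * ell t k"
      unfolding m_def k[symmetric] L using qL[of k] unfolding L by linarith
    have qt: "real (q k) powr t \<le> real (q (Suc k))" using True ell_ge_iff[OF t0(1)] by simp
    have 2: "real (q k) \<le> Qs t k"
    proof -
      have "real (q k) * 1 \<le> real (q k) * (real (q (Suc k)) * ell t k)"
        using qL[of k] unfolding L by (intro mult_left_mono) auto
      then show ?thesis unfolding Qs_eq[OF t0(1)] by (simp add: mult.assoc)
    qed
    \<comment> \<open>Here \<open>q k \<le> q (Suc k) powr (1 / t)\<close>, so \<open>Qs t k\<close>
      is at most the same power, whose exponent is below 1.\<close>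
    have 3: "2 * Qs t k \<le> real (q (Suc k))"
    proof -
      have "real (q k) = (real (q k) powr t) powr (1 / t)" using t0 by (simp add: powr_powr)
      also have "\<dots> \<le> real (q (Suc k)) powr (1 / t)" using qt t0 by (intro powr_mono2) auto
      finally have "Qs t k \<le> (real (q (Suc k)) powr (1 / t) * real (q (Suc k)) powr 1) powr (1 / (1 + t))"
        unfolding Qs_def using t0 by (intro powr_mono2) (auto intro!: mult_right_mono)
      also have "\<dots> = real (q (Suc k)) powr ((1 / t + 1) * (1 / (1 + t)))"
        by (simp only: powr_add[symmetric] powr_powr)
      also have "(1 / t + 1) * (1 / (1 + t)) = 1 / t" using t0 by (simp add: field_simps)
      finally have Q: "Qs t k \<le> real (q (Suc k)) powr (1 / t)" .
      have "2 \<le> real (q (Suc k)) powr (1 - 1 / t)" using K6[of "Suc k"] k by simp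
      then have "2 * Qs t k \<le> real (q (Suc k)) powr (1 - 1 / t) * real (q (Suc k)) powr (1 / t)"
        using Q by (intro mult_mono) (auto simp: less_imp_le)
      also have "\<dots> = real (q (Suc k))" by (simp add: powr_add[symmetric])
      finally show ?thesis .
    qed
    from 1 2 3 show ?thesis by auto
  qed
  have rho_eq: "\<rho> i \<le> 1 / (8 * real (q (K + i)))" for i
  proof -
    let ?q = "real (q (K + i))"
    have "32 * ?q powr (- t) \<le> ?q powr (t - 1) * ?q powr (- t)" using K2[of "K + i"] by (intro mult_right_mono) auto
    also have "\<dots> = ?q powr (- 1)" by (simp add: powr_add[symmetric])
    also have "\<dots> = 1 / ?q" by (simp add: powr_minus_divide)
    finally show ?thesis unfolding \<rho>_def by simp
  qed
  have rho_Suc: "\<rho> (Suc i) \<le> \<rho> i" for i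
    unfolding \<rho>_def using t0 q_less_Suc[of "K + i"] by (auto intro!: powr_mono2')
  have shift: "real j * \<bar>D k\<bar> \<le> 2 * ell t k" "ell t k \<le> real (q k) powr (- t)" "real (q (Suc k)) powr (- t) \<le> ell t k"
    "real (n + j * q k) \<le> 2 * Qs t k"
    if k: "k = K + i" and j: "j < m i" and m1: "m i \<noteq> 1" and n: "n \<le> q k" for i j k n
  proof -
    have d: "real (m i) - 1 \<le> real (q (Suc k)) * ell t k" "real (q k) \<le> Qs t k" "2 * Qs t k \<le> real (q (Suc k))"
      using dich[OF k] m1 by auto
    have j': "real j \<le> real (q (Suc k)) * ell t k" using d(1) j by linarith
    have "real j * \<bar>D k\<bar> \<le> real (q (Suc k)) * ell t k * (2 / real (q (Suc k)))"
      using j' D_upper[of k] by (intro mult_mono) auto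
    then show "real j * \<bar>D k\<bar> \<le> 2 * ell t k" by simp
    show "ell t k \<le> real (q k) powr (- t)" unfolding Qs_powr[OF t0(1), symmetric] using d t0 by (intro powr_mono2') auto
    show "real (q (Suc k)) powr (- t) \<le> ell t k"
      unfolding Qs_powr[OF t0(1), symmetric] using d(3) t0 Qs_pos[of t k] by (intro powr_mono2') auto
    have "real (j * q k) \<le> real (q (Suc k)) * ell t k * real (q k)" using j' by (simp add: mult_right_mono)
    also have "\<dots> = Qs t k" unfolding Qs_eq[OF t0(1)] by simp
    finally show "real (n + j * q k) \<le> 2 * Qs t k" using n d(2) by simp
  qed
  interpret cantor_tree Y ch \<rho> \<epsilon> m \<theta>
  proof
    show "\<theta> \<in> Y 0" unfolding Y_def mem_Collect_eq using q_pos[of K]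
      by (intro exI[of _ "1::nat"] exI[of _ "0::int"]) (simp add: Suc_le_eq)
  next
    fix i x x' assume "x \<in> Y i" "x' \<in> Y i" "x \<noteq> x'"
    then obtain n a n' a' where n: "1 \<le> n" "n \<le> q (K + i)" "x = real n * \<theta> - of_int a"
      "1 \<le> n'" "n' \<le> q (K + i)" "x' = real n' * \<theta> - of_int a'" unfolding Y_def by auto
    then have "\<bar>int n - int n'\<bar> < int (q (K + i))" by linarith
    then show "\<epsilon> i \<le> \<bar>x - x'\<bar>" unfolding \<epsilon>_def using orbit_sep n \<open>x \<noteq> x'\<close> by blast
  next
    fix i show "0 < \<rho> i" by (simp add: \<rho>_def)
    show "4 * \<rho> i \<le> \<epsilon> i" unfolding \<epsilon>_def using rho_eq[of i] by simp
    show "0 < m i" by (rule m_pos)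
  next
    fix i x assume x: "x \<in> Y i"
    show "finite (ch i x)" by (simp add: ch_def)
    have "D (K + i) \<noteq> 0" using D_lower[of "K + i"] by auto
    then show "card (ch i x) = m i" unfolding ch_def by (subst card_image) (auto simp: inj_on_def)
    show "ch i x \<subseteq> Y (Suc i)"
    proof
      fix x' assume "x' \<in> ch i x"
      then obtain j where j: "j < m i" "x' = x + real j * D (K + i)" unfolding ch_def by auto
      obtain n a where n: "1 \<le> n" "n \<le> q (K + i)" "x = real n * \<theta> - of_int a" using x unfolding Y_def by auto
      have "x' = real (n + j * q (K + i)) * \<theta> - of_int (a + int j * p (K + i))"
        unfolding j n D_def by (simp add: algebra_simps)
      moreover have "n + j * q (K + i) \<le> q (K + Suc i)"
      proof (cases "m i = 1")
        case True
        then show ?thesis using j n q_less_Suc[of "K + i"] by simp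
      next
        case False
        then have "real (n + j * q (K + i)) \<le> real (q (Suc (K + i)))"
          using shift(4)[OF refl j(1) False n(2)] dich[OF refl, of i] by linarith
        then show ?thesis by (simp only: of_nat_le_iff add_Suc_right)
      qed
      ultimately show "x' \<in> Y (Suc i)" unfolding Y_def using n(1) by fastforce
    qed
  next
    fix i x x' assume "x \<in> Y i" "x' \<in> ch i x"
    then obtain j where j: "j < m i" "x' = x + real j * D (K + i)" unfolding ch_def by auto
    show "\<bar>x' - x\<bar> \<le> \<rho> i - \<rho> (Suc i)"
    proof (cases "m i = 1")
      case True
      then show ?thesis using j rho_Suc[of i] by simp
    next
      case False
      note sh = shift[OF refl j(1) False order_refl]
      have d: "2 * real (q (K + i)) \<le> real (q (Suc (K + i)))" using dich[OF refl, of i] False by auto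
      have "real (q (Suc (K + i))) powr (- t) \<le> (2 * real (q (K + i))) powr (- t)"
        using d t0 by (intro powr_mono2') auto
      also have "\<dots> = 2 powr (- t) * real (q (K + i)) powr (- t)" by (simp add: powr_mult)
      also have "\<dots> \<le> 2 powr (- 1) * real (q (K + i)) powr (- t)"
        using t0 by (intro mult_right_mono powr_mono) auto
      finally have "2 * real (q (K + i)) powr (- t) \<le> \<rho> i - \<rho> (Suc i)"
        unfolding \<rho>_def by (simp add: powr_minus_divide)
      moreover have "\<bar>x' - x\<bar> = real j * \<bar>D (K + i)\<bar>" unfolding j by (simp add: abs_mult)
      ultimately show ?thesis using sh(1,2) by linarith
    qed
  next
    have "(\<lambda>i. inverse (2 * real (q (i + K)))) \<longlonglongrightarrow> 0"
      by (rule LIMSEQ_ignore_initial_segment)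
        (intro tendsto_inverse_0_at_top filterlim_tendsto_pos_mult_at_top[OF tendsto_const] q_at_top, simp)
    then show "\<epsilon> \<longlonglongrightarrow> 0" unfolding \<epsilon>_def by (simp add: inverse_eq_divide add.commute)
  qed
  have sub: "limit_set \<subseteq> U_set \<tau> \<theta>"
  proof
    fix y assume "y \<in> limit_set"
    then obtain x where x: "x 0 = \<theta>" "\<And>i. x (Suc i) \<in> ch i (x i)" "\<And>i. x i \<in> Y i" "\<And>i. \<bar>y - x i\<bar> \<le> \<rho> i"
      unfolding limit_set_def by auto
    have "good \<tau> y Q" if Q: "real (q K) \<le> Q" for Q
    proof -
      obtain k where k: "K \<le> k" "real (q k) \<le> Q" "Q < real (q (Suc k))" using q_bracket[OF Q] .
      define i where "i = k - K"
      have ki: "k = K + i" using k by (simp add: i_def)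
      have "0 < Q" using k(2) q_ge1[of k] by linarith
      obtain n a where n: "1 \<le> n" "n \<le> q k" "x i = real n * \<theta> - of_int a" using x(3)[of i] unfolding Y_def ki by auto
      obtain j where j: "j < m i" "x (Suc i) = x i + real j * D k" using x(2)[of i] unfolding ch_def ki by auto
      have "\<bar>y - x (Suc i)\<bar> \<le> 4 * real (q (Suc k)) powr (- t)" using x(4)[of "Suc i"] by (simp add: \<rho>_def ki)
      also have "\<dots> < real (q (Suc k)) powr (t - \<tau>) * real (q (Suc k)) powr (- t)"
        using K5[of "Suc k"] k(1) by (intro mult_strict_right_mono) auto
      also have "\<dots> = real (q (Suc k)) powr (- \<tau>)" by (simp add: powr_add[symmetric])
      also have "\<dots> \<le> Q powr (- \<tau>)" using k(3) \<open>0 < Q\<close> t by (intro powr_mono2') auto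
      finally have child: "\<bar>y - x (Suc i)\<bar> < Q powr (- \<tau>)" .
      show ?thesis
      proof (cases "real (n + j * q k) \<le> Q")
        case True
        have eq: "x (Suc i) = real (n + j * q k) * \<theta> - of_int (a + int j * p k)"
          unfolding j n D_def by (simp add: algebra_simps)
        show ?thesis using n(1) by (intro goodI[OF _ True child[unfolded eq]]) simp
      next
        \<comment> \<open>The child comes too late, so \<open>Q\<close> is below its index and hence
          below \<open>2 * Qs t k\<close>. At such \<open>Q\<close> the radius still exceeds the
          distance to the parent.\<close>
        case False
        then have "j \<noteq> 0" using n k by (intro notI) simp
        then have m1: "m i \<noteq> 1" using j by auto
        note sh = shift[OF ki j(1) m1 n(2)]
        have "\<bar>y - x i\<bar> \<le> \<bar>y - x (Suc i)\<bar> + real j * \<bar>D k\<bar>"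
          unfolding j abs_mult[of "real j", simplified, symmetric] by linarith
        also have "\<bar>y - x (Suc i)\<bar> \<le> 4 * ell t k"
          using x(4)[of "Suc i"] sh(3) by (simp add: \<rho>_def ki)
        finally have "\<bar>y - x i\<bar> \<le> 6 * ell t k" using sh(1) by linarith
        also have "6 * ell t k < Q powr (- \<tau>)"
        proof -
          have "7 * ell t k \<le> (2 * Qs t k) powr (- \<tau>)" using t K4[OF k(1)] by (intro Qs_slack) auto
          also have "\<dots> \<le> Q powr (- \<tau>)" using False sh(4) \<open>0 < Q\<close> t by (intro powr_mono2') auto
          finally show ?thesis using ell_pos[of t k] by linarith
        qed
        finally show ?thesis using n k by (intro goodI[of n _ _ a]) auto
      qed
    qed
    moreover have "0 \<le> y" "y < 1"
    proof -
      have "4 * real (q K) powr (- t) \<le> \<gamma> / 2"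
        using K3[of K] \<open>0 < \<gamma>\<close> by (simp add: powr_minus_divide divide_simps mult.commute split: if_splits)
      then have "\<bar>y - \<theta>\<bar> \<le> \<gamma> / 2" using x(1) x(4)[of 0] by (simp add: \<rho>_def)
      moreover have "\<gamma> \<le> \<theta>" "\<gamma> \<le> 1 - \<theta>" by (simp_all add: \<gamma>_def)
      ultimately show "0 \<le> y" "y < 1" using \<open>0 < \<gamma>\<close> by linarith+
    qed
    ultimately show "y \<in> U_set \<tau> \<theta>" unfolding U_set_eq E_def by (auto intro!: exI[of _ "q K"])
  qed
  have prod_m: "M t (K + i) / M t K \<le> real (\<Prod>j<i. m j)" for i
  proof (induction i)
    case (Suc i)
    have "M t (K + Suc i) / M t K = M t (K + i) / M t K * (real (q (Suc (K + i))) * L t (K + i))"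
      by (simp add: M_def)
    also have "\<dots> \<le> real (\<Prod>j<i. m j) * real (m i)"
      using Suc m_ge[of i] by (intro mult_mono) (auto intro!: mult_nonneg_nonneg divide_nonneg_nonneg less_imp_le[OF M_pos] prod_nonneg)
    finally show ?case by simp
  qed simp
  \<comment> \<open>The constant accounts for starting the tree at stage \<open>K\<close> and for
    \<open>\<epsilon>\<close> being half of \<open>1 / q\<close>.\<close>
  have frost: "1 / (M t K * 2 powr s) \<le> real (\<Prod>j<i. m j) * (real (m i) * \<epsilon> (Suc i)) powr s" for i
  proof -
    have "1 / (M t K * 2 powr s) * 1 \<le> 1 / (M t K * 2 powr s) * (M t (K + i) * L t (K + i) powr s)"
      using frostman_const[OF K1[of "K + i"]] by (intro mult_left_mono) (auto simp: less_imp_le)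
    also have "\<dots> = M t (K + i) / M t K * (L t (K + i) / 2) powr s" by (simp add: powr_divide)
    also have "\<dots> \<le> real (\<Prod>j<i. m j) * (real (m i) * \<epsilon> (Suc i)) powr s"
    proof (intro mult_mono prod_m powr_mono2)
      have "L t (K + i) / 2 = real (q (Suc (K + i))) * L t (K + i) * \<epsilon> (Suc i)" by (simp add: \<epsilon>_def)
      also have "\<dots> \<le> real (m i) * \<epsilon> (Suc i)" by (intro mult_right_mono m_ge) (simp add: \<epsilon>_def)
      finally show "L t (K + i) / 2 \<le> real (m i) * \<epsilon> (Suc i)" .
    qed (use s in \<open>auto intro!: prod_nonneg\<close>)
    finally show ?thesis by simp
  qed
  obtain c' where c': "0 < c'" "\<And>C::nat \<Rightarrow> real set. limit_set \<subseteq> (\<Union>i. C i) \<Longrightarrow> (\<And>i. bounded (C i)) \<Longrightarrow>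
      ennreal c' \<le> (\<Sum>i. ennreal (diameter (C i) powr s))"
    by (rule limit_set_content[OF s _ frost]) (simp, blast)
  show ?thesis
  proof (rule hausdorff_dim_ge[OF _ c'(1)])
    show "U_set \<tau> \<theta> \<subseteq> {0..<1}" by (auto simp: U_set_def)
    fix C :: "nat \<Rightarrow> real set" assume "U_set \<tau> \<theta> \<subseteq> (\<Union>i. C i)" "\<And>i. bounded (C i)"
    then show "ennreal c' \<le> (\<Sum>i. ennreal (diameter (C i) powr s))" using sub by (intro c'(2)) blast+
  qed
qed


section \<open>Cantor subsets for exponents below 1\<close>

lemma residue_window:
  fixes r :: int
  obtains n a where "h * q k < n" "n \<le> (h + 1) * q k" "int n * p k - a * int (q k) = r"
proof -
  let ?q = "int (q k)"
  \<comment> \<open>\<open>u\<close> inverts \<open>p k\<close> modulo \<open>q k\<close>, so the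
    wanted \<open>n\<close> is congruent to \<open>u * r\<close>; the remainder \<open>z\<close>
    picks its representative among the \<open>q k\<close> indices above
    \<open>h * q k\<close>.\<close>
  obtain u v where uv: "u * p k + v * ?q = 1"
    using bezout_int[of "p k" ?q] coprime_p_q[of k] by (metis coprime_iff_gcd_eq_1)
  define z where "z = (u * r - int h * ?q - 1) mod ?q"
  have z: "0 \<le> z" "z < ?q" unfolding z_def by simp_all
  define n where "n = h * q k + 1 + nat z"
  define w where "w = (u * r - int h * ?q - 1) div ?q"
  have "u * r - int h * ?q - 1 = w * ?q + z" unfolding w_def z_def by simp
  then have n: "int n = u * r - w * ?q" unfolding n_def using z by simp
  have "int n * p k = (u * p k) * r - w * p k * ?q" unfolding n by (simp add: algebra_simps)
  also have "u * p k = 1 - v * ?q" using uv by simp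
  finally have "int n * p k - (- (v * r) - w * p k) * ?q = r" by (simp add: algebra_simps)
  moreover have "h * q k < n" unfolding n_def by simp
  moreover have "int n \<le> int ((h + 1) * q k)" unfolding n_def using z by simp
  then have "n \<le> (h + 1) * q k" by (simp only: of_nat_le_iff)
  ultimately show ?thesis using that by blast
qed

lemma orbit_point_eq:
  assumes "int n * p k - a * int (q k) = r"
  shows "real n * \<theta> - of_int a = real_of_int r / real (q k) + real n / real (q k) * D k"
  unfolding D_def assms[symmetric] by (simp add: field_simps)

text \<open>The first \<open>q k\<close> orbit points come within \<open>3 / q k\<close> of every
  \<open>y\<close>, and \<open>Q powr t < q (Suc k) powr t \<le> q k\<close> makes the radius at
  least \<open>q k powr (- (\<tau> / t))\<close>, which is larger.\<close>

lemma trivial_good: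
  assumes "0 < \<tau>" "\<tau> < t" "real (q (Suc k)) powr t \<le> real (q k)" and large: "3 < real (q k) powr (1 - \<tau> / t)"
    and Q: "real (q k) \<le> Q" "Q < real (q (Suc k))"
  shows "good \<tau> y Q"
proof -
  define r where "r = \<lfloor>y * real (q k)\<rfloor>"
  obtain n a where n: "0 * q k < n" "n \<le> (0 + 1) * q k" "int n * p k - a * int (q k) = r" by (rule residue_window)
  have "real_of_int r \<le> y * real (q k)" "y * real (q k) < real_of_int r + 1" unfolding r_def by linarith+
  then have "real_of_int r / real (q k) \<le> y" "y \<le> (real_of_int r + 1) / real (q k)"
    by (simp_all add: pos_divide_le_eq pos_le_divide_eq)
  then have "\<bar>y - real_of_int r / real (q k)\<bar> \<le> 1 / real (q k)" by (simp add: add_divide_distrib abs_le_iff)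
  moreover have "\<bar>real n / real (q k) * D k\<bar> \<le> 2 / real (q k)"
  proof -
    have "real n / real (q k) * \<bar>D k\<bar> \<le> 1 * (2 / real (q (Suc k)))" using n D_upper[of k] by (intro mult_mono) auto
    also have "\<dots> \<le> 2 / real (q k)" using q_le_Suc[of k] by (simp add: frac_le)
    finally show ?thesis by (simp add: abs_mult)
  qed
  moreover have "\<bar>y - (A + w)\<bar> \<le> e1 + e2" if "\<bar>y - A\<bar> \<le> e1" "\<bar>w\<bar> \<le> e2" for A w e1 e2 :: real using that by linarith
  ultimately have "\<bar>y - (real n * \<theta> - of_int a)\<bar> \<le> 1 / real (q k) + 2 / real (q k)"
    unfolding orbit_point_eq[OF n(3)] by blast
  also have "\<dots> = 3 * real (q k) powr (- 1)" by (simp add: powr_minus_divide)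
  also have "\<dots> < real (q k) powr (1 - \<tau> / t) * real (q k) powr (- 1)" using large by (intro mult_strict_right_mono) auto
  also have "\<dots> = real (q k) powr (- (\<tau> / t))" by (simp only: powr_add[symmetric]) simp
  also have "\<dots> \<le> Q powr (- \<tau>)"
  proof -
    have "0 < Q" using Q q_ge1[of k] by linarith
    have "Q powr t \<le> real (q (Suc k)) powr t" using Q \<open>0 < Q\<close> assms by (intro powr_mono2) auto
    then have "Q powr t \<le> real (q k)" using assms by linarith
    then have "real (q k) powr (- (\<tau> / t)) \<le> (Q powr t) powr (- (\<tau> / t))"
      using assms \<open>0 < Q\<close> by (intro powr_mono2') auto
    also have "\<dots> = Q powr (- \<tau>)" using assms by (simp add: powr_powr)
    finally show ?thesis .
  qed
  finally show ?thesis using n Q by (intro goodI[of n _ _ a]) auto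
qed

text \<open>The multiples \<open>(i + j * q k) * \<theta>\<close> leave \<open>i * \<theta>\<close> in one direction only, so the intervals of the Cantor set are
  centred at \<open>j = hw t k\<close>, about half way into the cluster of \<open>i\<close>.\<close>

definition hw :: "real \<Rightarrow> nat \<Rightarrow> nat" where "hw t k = nat \<lceil>Qs t k / real (q k)\<rceil>"

lemma hw_bounds:
  assumes "0 < t" "t \<le> 1"
  shows "Qs t k \<le> real (hw t k) * real (q k)" "real (hw t k) * real (q k) \<le> 2 * Qs t k" "real (q k) \<le> Qs t k"
proof -
  have "1 \<le> ell t k * real (q (Suc k))" using ell_ge_small[OF assms, of k] by (simp add: pos_divide_le_eq)
  then have "real (q k) * 1 \<le> real (q k) * (ell t k * real (q (Suc k)))" by (intro mult_left_mono) auto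
  then show 1: "real (q k) \<le> Qs t k" unfolding Qs_eq[OF assms(1)] by (simp add: mult_ac)
  have pos: "0 \<le> Qs t k / real (q k)" using Qs_pos[of t k] by (simp add: less_imp_le)
  then have "Qs t k / real (q k) \<le> real (hw t k)" "real (hw t k) \<le> Qs t k / real (q k) + 1"
    unfolding hw_def by linarith+
  then have "Qs t k / real (q k) * real (q k) \<le> real (hw t k) * real (q k)"
    "real (hw t k) * real (q k) \<le> (Qs t k / real (q k) + 1) * real (q k)" by (intro mult_right_mono; simp)+
  then show "Qs t k \<le> real (hw t k) * real (q k)" "real (hw t k) * real (q k) \<le> 2 * Qs t k"
    using 1 by (simp_all add: distrib_right)
qed

lemma Qs_div: "0 < t \<Longrightarrow> Qs t k / real (q k) / real (q (Suc k)) = ell t k"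
  by (simp add: Qs_eq)

text \<open>For large \<open>Q\<close> the cluster extends far enough to both sides of its centre to
  have a point within \<open>\<bar>D k\<bar>\<close> of \<open>y\<close>, and
  \<open>\<tau> < 1\<close> makes that close enough. For smaller \<open>Q\<close> the first point of
  the cluster serves, since the radius is then longer than the half cluster.\<close>

lemma block_good:
  assumes t: "0 < \<tau>" "\<tau> < t" "t < 1" and n: "hw t k * q k < n" "n \<le> (hw t k + 1) * q k"
    and y: "\<bar>y - (real n * \<theta> - of_int a)\<bar> \<le> ell t k / 8"
    and large: "3 \<le> real (q (Suc k)) powr (1 - \<tau>)" "6 * 5 powr \<tau> \<le> real (q k) powr ((t - \<tau>) / (1 + t))"
    and Q: "real (q k) \<le> Q" "Q < real (q (Suc k))"
  shows "good \<tau> y Q"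
proof -
  define h where "h = hw t k"
  have t0: "0 < t" "t \<le> 1" using t by auto
  have hb: "Qs t k \<le> real h * real (q k)" "real h * real (q k) \<le> 2 * Qs t k" "real (q k) \<le> Qs t k"
    using hw_bounds[OF t0] unfolding h_def by auto
  have Dpos: "0 < \<bar>D k\<bar>" using D_lower[of k] by (rule less_le_trans[rotated]) simp
  have "0 < Q" using Q q_ge1[of k] by linarith
  show ?thesis
  proof (cases "real ((2 * h + 1) * q k) \<le> Q")
    case True
    \<comment> \<open>\<open>v\<close> measures the way from the centre to \<open>y\<close> in steps
      of \<open>D k\<close>. As \<open>\<bar>v\<bar> \<le> h\<close>, rounding down leads to an
      index between 1 and \<open>(2 * h + 1) * q k\<close>.\<close>
    define v where "v = (y - (real n * \<theta> - of_int a)) / D k"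
    have yv: "y = (real n * \<theta> - of_int a) + v * D k" unfolding v_def using Dpos by simp
    have "ell t k / 8 \<le> real h * \<bar>D k\<bar>"
    proof -
      have "ell t k = Qs t k / (real (q k) * real (q (Suc k)))" using Qs_div[OF t0(1), of k] by simp
      also have "\<dots> \<le> real h * real (q k) / (real (q k) * real (q (Suc k)))" using hb by (intro divide_right_mono) auto
      also have "\<dots> = real h * (2 * (1 / (2 * real (q (Suc k)))))" by simp
      also have "\<dots> \<le> real h * (2 * \<bar>D k\<bar>)" using D_lower[of k] by (intro mult_left_mono) auto
      finally show ?thesis using ell_pos[of t k] by linarith
    qed
    then have "\<bar>v\<bar> * \<bar>D k\<bar> \<le> real h * \<bar>D k\<bar>" using y yv by (simp add: abs_mult[symmetric])
    then have "\<bar>v\<bar> \<le> real h" using Dpos by simp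
    then have j: "- int h \<le> \<lfloor>v\<rfloor>" "\<lfloor>v\<rfloor> \<le> int h" by linarith+
    define n' where "n' = nat (int n + \<lfloor>v\<rfloor> * int (q k))"
    define A where "A = int h * int (q k)"
    define V where "V = \<lfloor>v\<rfloor> * int (q k)"
    have "- int h * int (q k) \<le> V" "V \<le> A"
      unfolding V_def A_def using j by (intro mult_right_mono; simp)+
    then have V: "- A \<le> V" "V \<le> A" by (simp_all add: A_def)
    have "int (h * q k) < int n" "int n \<le> int ((h + 1) * q k)"
      using n unfolding h_def by (simp_all only: of_nat_less_iff of_nat_le_iff)
    then have "A < int n" "int n \<le> A + int (q k)" by (simp_all add: A_def algebra_simps)
    with V have n'': "1 \<le> int n + V" "int n + V \<le> 2 * A + int (q k)" by linarith+
    moreover have "int ((2 * h + 1) * q k) = 2 * A + int (q k)" by (simp add: A_def algebra_simps)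
    ultimately have n': "1 \<le> int n + \<lfloor>v\<rfloor> * int (q k)" "int n + \<lfloor>v\<rfloor> * int (q k) \<le> int ((2 * h + 1) * q k)"
      unfolding V_def by simp_all
    then have n'2: "int n' = int n + \<lfloor>v\<rfloor> * int (q k)" unfolding n'_def by simp
    then have n'1: "1 \<le> n'" using n' by linarith
    have rn': "real n' = real n + of_int \<lfloor>v\<rfloor> * real (q k)"
      using arg_cong[OF n'2, of real_of_int] by simp
    have n'Q: "real n' \<le> Q"
    proof -
      have "n' \<le> (2 * h + 1) * q k" using n'(2) unfolding n'2[symmetric] by (simp only: of_nat_le_iff)
      then have "real n' \<le> real ((2 * h + 1) * q k)" by (simp only: of_nat_le_iff)
      then show ?thesis using True by linarith
    qed
    have "y - (real n' * \<theta> - of_int (a + \<lfloor>v\<rfloor> * p k)) = (v - of_int \<lfloor>v\<rfloor>) * D k"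
      unfolding rn' using yv unfolding D_def by (simp add: algebra_simps)
    then have "\<bar>y - (real n' * \<theta> - of_int (a + \<lfloor>v\<rfloor> * p k))\<bar> = \<bar>v - of_int \<lfloor>v\<rfloor>\<bar> * \<bar>D k\<bar>" by (simp add: abs_mult)
    also have "\<dots> \<le> 1 * (2 / real (q (Suc k)))"
    proof (intro mult_mono D_upper)
      show "\<bar>v - of_int \<lfloor>v\<rfloor>\<bar> \<le> 1" by linarith
    qed auto
    also have "\<dots> < 3 * real (q (Suc k)) powr (- 1)" by (simp add: powr_minus_divide divide_strict_right_mono)
    also have "\<dots> \<le> real (q (Suc k)) powr (1 - \<tau>) * real (q (Suc k)) powr (- 1)"
      using large(1) by (intro mult_right_mono) auto
    also have "\<dots> = real (q (Suc k)) powr (- \<tau>)" by (simp only: powr_add[symmetric]) simp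
    also have "\<dots> \<le> Q powr (- \<tau>)" using Q \<open>0 < Q\<close> t by (intro powr_mono2') auto
    finally show ?thesis using n'1 n'Q by (intro goodI[of n'])
  next
    case False
    \<comment> \<open>Going back \<open>h\<close> blocks costs at most \<open>4 * ell t k\<close>,
      while \<open>Q < (2 * h + 1) * q k \<le> 5 * Qs t k\<close> keeps the radius above
      \<open>6 * ell t k\<close>.\<close>
    define n' where "n' = n - h * q k"
    have n': "1 \<le> n'" "n' \<le> q k" "n = n' + h * q k" using n unfolding n'_def h_def by auto
    have eq: "real n' * \<theta> - of_int (a - int h * p k) = (real n * \<theta> - of_int a) - real h * D k"
      unfolding n' D_def by (simp add: algebra_simps)
    have hD: "real h * \<bar>D k\<bar> \<le> 4 * ell t k"
    proof -
      have "real h \<le> 2 * Qs t k / real (q k)" using hb(2) by (simp add: pos_le_divide_eq)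
      then have "real h * \<bar>D k\<bar> \<le> 2 * Qs t k / real (q k) * (2 / real (q (Suc k)))"
        using D_upper[of k] by (intro mult_mono) (auto simp: less_imp_le)
      also have "\<dots> = 4 * ell t k" using Qs_div[OF t0(1), of k, symmetric] by simp
      finally show ?thesis .
    qed
    have "\<bar>y - (real n' * \<theta> - of_int (a - int h * p k))\<bar> \<le> ell t k / 8 + real h * \<bar>D k\<bar>"
    proof -
      have "\<bar>real h * D k\<bar> = real h * \<bar>D k\<bar>" by (simp add: abs_mult)
      then show ?thesis unfolding eq using y by linarith
    qed
    also have "\<dots> < 6 * ell t k" using hD ell_pos[of t k] by linarith
    also have "\<dots> \<le> (5 * Qs t k) powr (- \<tau>)" using t large(2) by (intro Qs_slack) auto
    also have "\<dots> \<le> Q powr (- \<tau>)"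
    proof (rule powr_mono2')
      have "real ((2 * h + 1) * q k) = 2 * (real h * real (q k)) + real (q k)" by (simp add: algebra_simps)
      then show "Q \<le> 5 * Qs t k" using False hb by linarith
    qed (use t \<open>0 < Q\<close> in auto)
    finally show ?thesis using n' Q by (intro goodI[of n' _ _ "a - int h * p k"]) auto
  qed
qed

text \<open>Lets the counting skip stages that are not levels of the tree: each skipped factor is at
  most its trivial value.\<close>

lemma M_run_le:
  assumes "j \<le> k"
  shows "M t k \<le> M t j * real (q k) / real (q j)"
  using assms
proof (induction k rule: dec_induct)
  case (step k)
  have le: "real (q (Suc k)) * L t k \<le> real (q (Suc k)) * (1 / real (q k))" using L_le by (intro mult_left_mono) auto
  then have "M t k * (real (q (Suc k)) * L t k) \<le> (M t j * real (q k) / real (q j)) * (real (q (Suc k)) * (1 / real (q k)))"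
    by (intro mult_mono[OF step.IH le]) (auto simp: less_imp_le)
  then show ?case by (simp add: M_def)
qed simp

text \<open>Bounds the drift in \<open>orbit_point_eq\<close> for the central window: its indices
  are at most \<open>3 * Qs t k\<close>, and \<open>D_upper\<close> contributes a factor 2.\<close>

lemma window_spread:
  assumes "0 < t" "t \<le> 1" "n \<le> (hw t k + 1) * q k"
  shows "\<bar>real n / real (q k) * D k\<bar> \<le> 6 * ell t k"
proof -
  note hb = hw_bounds[OF assms(1,2), of k]
  have "real n \<le> real ((hw t k + 1) * q k)" using assms(3) by (simp only: of_nat_le_iff)
  also have "\<dots> = real (hw t k) * real (q k) + real (q k)" by (simp add: algebra_simps)
  also have "\<dots> \<le> 3 * Qs t k" using hb by linarith
  finally have "real n / real (q k) * \<bar>D k\<bar> \<le> 3 * Qs t k / real (q k) * (2 / real (q (Suc k)))"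
    using D_upper[of k] by (intro mult_mono divide_right_mono) (auto simp: less_imp_le)
  also have "\<dots> = 6 * ell t k" using Qs_div[OF assms(1), of k, symmetric] by simp
  finally show ?thesis by (simp add: abs_mult)
qed

end

lemma hausdorff_dim_eq_unit_interval_ge:
  assumes "{0..<1} \<subseteq> A" "A \<subseteq> {0..<1}" "s \<le> 1"
  shows "s \<le> hausdorff_dim A"
proof -
  have "A = {0..<1}" using assms by auto
  then show ?thesis using hausdorff_dim_unit_interval assms(3) by simp
qed

lemma abs_diff_triangle:
  fixes x y z :: real
  assumes "\<bar>y - z\<bar> \<le> a" "\<bar>x - y\<bar> \<le> b"
  shows "\<bar>x - z\<bar> \<le> a + b"
  using assms by linarith

context irrational
begin

text \<open>The levels of the tree are the stages in \<open>B\<close>, where the clusters leave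
  gaps; at all other stages every point is good by \<open>trivial_good\<close>. Children of a centre
  are cluster centres of the next stage in \<open>B\<close> that lie near it.\<close>

lemma dim_ge_small:
  assumes t: "0 < \<tau>" "\<tau> < t2" "t2 < 1" and s: "0 < s" "s \<le> 1"
    and ev: "\<forall>\<^sub>F k in sequentially. s * lam t2 k \<le> ln (M t2 k)"
  shows "s \<le> hausdorff_dim (U_set \<tau> \<theta>)"
proof -
  \<comment> \<open>The geometry uses \<open>t\<close> and the counting uses \<open>t2\<close>. The
    gap between them provides more children than needed, and the gap between \<open>\<tau>\<close>
    and \<open>t\<close> absorbs the constants in the goodness estimates.\<close>
  define t where "t = (\<tau> + t2) / 2"
  have tt: "\<tau> < t" "t < t2" "0 < t" "t \<le> 1" "t < 1" using t by (auto simp: t_def)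
  have U_unit: "U_set \<tau> \<theta> \<subseteq> {0..<1}" by (auto simp: U_set_def)
  have "\<forall>\<^sub>F k in sequentially. s * lam t2 k \<le> ln (M t2 k) \<and> 32 * ell t2 k \<le> ell t k \<and>
      100 * ell 1 k \<le> ell t k \<and> 4 \<le> real (q k) powr (1 - \<tau> / t) \<and> 3 \<le> real (q k) powr (1 - \<tau>) \<and>
      6 * 5 powr \<tau> \<le> real (q k) powr ((t - \<tau>) / (1 + t)) \<and> 40 \<le> real (q k) powr 1"
    using t tt by (intro eventually_conj ev q_powr_large ell_slack) auto
  then obtain K where
        K1: "\<And>k. K \<le> k \<Longrightarrow> s * lam t2 k \<le> ln (M t2 k)"
    and K2: "\<And>k. K \<le> k \<Longrightarrow> 32 * ell t2 k \<le> ell t k"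
    and K3: "\<And>k. K \<le> k \<Longrightarrow> 100 * ell 1 k \<le> ell t k"
    and K4: "\<And>k. K \<le> k \<Longrightarrow> 4 \<le> real (q k) powr (1 - \<tau> / t)"
    and K5: "\<And>k. K \<le> k \<Longrightarrow> 3 \<le> real (q k) powr (1 - \<tau>)"
    and K6: "\<And>k. K \<le> k \<Longrightarrow> 6 * 5 powr \<tau> \<le> real (q k) powr ((t - \<tau>) / (1 + t))"
    and K7: "\<And>k. K \<le> k \<Longrightarrow> 40 \<le> real (q k)"
    unfolding eventually_sequentially by (auto simp: Suc_le_eq)
  define B where "B = {k. K \<le> k \<and> real (q k) < real (q (Suc k)) powr t}"
  have trivial: "good \<tau> y Q" if "K \<le> k" "k \<notin> B" "real (q k) \<le> Q" "Q < real (q (Suc k))" for k y Q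
    using that tt t K4[of k] by (intro trivial_good[of \<tau> t k]) (auto simp: B_def)
  show ?thesis
  proof (cases "finite B")
    \<comment> \<open>From some stage on nothing is excluded, so
      \<open>U_set \<tau> \<theta>\<close> is the whole unit interval.\<close>
    case True
    then obtain K' where K': "\<And>k. k \<in> B \<Longrightarrow> k < K'" by (metis finite_nat_set_iff_bounded)
    have "{0..<1} \<subseteq> U_set \<tau> \<theta>"
    proof
      fix y :: real assume y: "y \<in> {0..<1}"
      have "good \<tau> y Q" if Q: "real (q (max K K')) \<le> Q" for Q
      proof -
        obtain k where k: "max K K' \<le> k" "real (q k) \<le> Q" "Q < real (q (Suc k))" using q_bracket[OF Q] .
        then have "k \<notin> B" using K' by force
        then show ?thesis using k by (intro trivial[of k]) auto
      qed
      then show "y \<in> U_set \<tau> \<theta>" using y unfolding U_set_eq E_def by (auto intro!: exI[of _ "q (max K K')"])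
    qed
    then show ?thesis using U_unit s by (intro hausdorff_dim_eq_unit_interval_ge)
  next
    case inf: False
    define e where "e = enumerate B"
    have eB: "e i \<in> B" for i unfolding e_def using inf by (rule enumerate_in_set)
    have eK: "K \<le> e i" for i using eB[of i] by (simp add: B_def)
    have e_less: "e i < e (Suc i)" for i unfolding e_def using inf by (rule enumerate_step)
    have ell_le: "ell t (e i) \<le> 1 / real (q (e i))" for i
      using eB[of i] ell_le_iff[OF tt(3)] by (simp add: B_def)
    define \<rho> where "\<rho> i = ell t (e i) / 8" for i
    define \<epsilon> where "\<epsilon> i = 1 / (2 * real (q (e i)))" for i
    define m where "m i = nat \<lceil>real (q (e (Suc i))) * ell t2 (e i)\<rceil>" for i
    define Y where "Y i = {real n * \<theta> - of_int a | n a. hw t (e i) * q (e i) < n \<and> n \<le> (hw t (e i) + 1) * q (e i)}" for i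
    \<comment> \<open>\<open>ell 1 k\<close> is never below \<open>1 / q (Suc k)\<close>, so the
      slack against exponent 1 yields the constant 100.\<close>
    have ell_big: "100 / real (q (Suc (e i))) \<le> ell t (e i)" for i
    proof -
      have "100 * (1 / real (q (Suc (e i)))) \<le> 100 * ell 1 (e i)" by (intro mult_left_mono ell_ge_small) auto
      then show ?thesis using K3[OF eK[of i]] by simp
    qed
    have q_e: "real (q (Suc (e i))) \<le> real (q (e (Suc i)))" for i
      using q_mono[of "Suc (e i)" "e (Suc i)"] e_less[of i] by simp
    have qell: "100 \<le> real (q (e (Suc i))) * ell t (e i)" for i
    proof -
      have "100 \<le> real (q (Suc (e i))) * ell t (e i)" using ell_big[of i] by (simp add: pos_divide_le_eq mult.commute)
      also have "\<dots> \<le> real (q (e (Suc i))) * ell t (e i)" by (intro mult_right_mono q_e) simp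
      finally show ?thesis .
    qed
    have ell_next: "100 * ell t (e (Suc i)) \<le> ell t (e i)" for i
    proof -
      have "ell t (e (Suc i)) \<le> 1 / real (q (Suc (e i)))"
        using ell_le[of "Suc i"] q_e[of i] by (rule order_trans[OF _ divide_left_mono]) auto
      then show ?thesis using ell_big[of i] by linarith
    qed
    have point: "\<exists>n a. hw t (e i) * q (e i) < n \<and> n \<le> (hw t (e i) + 1) * q (e i) \<and> int n * p (e i) - a * int (q (e i)) = r \<and>
        \<bar>(real n * \<theta> - of_int a) - real_of_int r / real (q (e i))\<bar> \<le> 6 * ell t (e i)" for i r
    proof -
      obtain n a where n: "hw t (e i) * q (e i) < n" "n \<le> (hw t (e i) + 1) * q (e i)" "int n * p (e i) - a * int (q (e i)) = r"
        by (rule residue_window)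
      have "\<bar>(real n * \<theta> - of_int a) - real_of_int r / real (q (e i))\<bar> \<le> 6 * ell t (e i)"
        unfolding orbit_point_eq[OF n(3)] using window_spread[OF tt(3,4) n(2)] by simp
      then show ?thesis using n by blast
    qed
    have m_ge: "real (q (e (Suc i))) * ell t2 (e i) \<le> real (m i)" for i unfolding m_def by linarith
    have m_pos: "0 < m i" for i
    proof -
      have "0 < real (q (e (Suc i))) * ell t2 (e i)" by simp
      then show ?thesis using m_ge[of i] by linarith
    qed
    have children: "\<exists>F. finite F \<and> card F = m i \<and> F \<subseteq> Y (Suc i) \<and> (\<forall>x'\<in>F. \<bar>x' - x\<bar> \<le> \<rho> i - \<rho> (Suc i))" for i x
    proof -
      let ?k = "e i" and ?k' = "e (Suc i)"
      \<comment> \<open>Fractions within \<open>ell / 16\<close> of \<open>x\<close> are used. There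
        are at least \<open>2 * d - 1 \<ge> m i\<close> of them, and the drift
        \<open>6 * ell\<close> of the next stage still fits into
        \<open>\<rho> i - \<rho> (Suc i)\<close>, since \<open>ell\<close> drops by a factor
        100.\<close>
      define d where "d = real (q ?k') * ell t ?k / 16"
      have d0: "0 \<le> d" by (simp add: d_def)
      define R where "R = {r::int. \<bar>real_of_int r - x * real (q ?k')\<bar> \<le> d}"
      have "m i \<le> card R"
      proof -
        have "real (m i) \<le> real (q ?k') * ell t2 ?k + 1" unfolding m_def
          using mult_pos_pos[of "real (q ?k')" "ell t2 ?k"] by (simp add: of_nat_nat)
        also have "real (q ?k') * ell t2 ?k \<le> real (q ?k') * (ell t ?k / 32)"
          using K2[OF eK[of i]] by (intro mult_left_mono) auto
        finally have "real (m i) \<le> real (q ?k') * ell t ?k / 32 + 1" by simp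
        then have "real (m i) \<le> 2 * d - 1" using qell[of i] unfolding d_def by linarith
        also have "\<dots> \<le> real (card R)" unfolding R_def by (rule int_ball_count(3)[OF d0])
        finally show ?thesis by simp
      qed
      then obtain R' where R': "R' \<subseteq> R" "card R' = m i" "finite R'" by (rule obtain_subset_with_card_n)
      obtain n a where na: "\<And>r. hw t ?k' * q ?k' < n r" "\<And>r. n r \<le> (hw t ?k' + 1) * q ?k'"
        "\<And>r. int (n r) * p ?k' - a r * int (q ?k') = r"
        "\<And>r. \<bar>(real (n r) * \<theta> - of_int (a r)) - real_of_int r / real (q ?k')\<bar> \<le> 6 * ell t ?k'"
        using point[of "Suc i"] by metis
      define f where "f r = real (n r) * \<theta> - of_int (a r)" for r
      have "inj f"
      proof (rule injI)
        fix r r' assume eq: "f r = f r'"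
        then have n: "n r = n r'" unfolding f_def by (rule orbit_inj)
        with eq have a: "a r = a r'" unfolding f_def by simp
        have "r = int (n r) * p ?k' - a r * int (q ?k')" by (rule na(3)[symmetric])
        also have "\<dots> = r'" unfolding n a by (rule na(3))
        finally show "r = r'" .
      qed
      have "\<bar>f r - x\<bar> \<le> \<rho> i - \<rho> (Suc i)" if "r \<in> R'" for r
      proof -
        have "\<bar>real_of_int r - x * real (q ?k')\<bar> \<le> d" using that R'(1) unfolding R_def by auto
        then have "\<bar>real_of_int r - x * real (q ?k')\<bar> / real (q ?k') \<le> d / real (q ?k')" by (rule divide_right_mono) simp
        moreover have "\<bar>real_of_int r - x * real (q ?k')\<bar> / real (q ?k') = \<bar>real_of_int r / real (q ?k') - x\<bar>"
        proof -
          have "real_of_int r / real (q ?k') - x = (real_of_int r - x * real (q ?k')) / real (q ?k')"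
            by (simp add: diff_divide_distrib)
          then show ?thesis by (simp add: abs_divide)
        qed
        ultimately have 1: "\<bar>real_of_int r / real (q ?k') - x\<bar> \<le> ell t ?k / 16" by (simp add: d_def)
        have "\<bar>f r - x\<bar> \<le> ell t ?k / 16 + 6 * ell t ?k'"
          using 1 na(4)[of r] unfolding f_def[symmetric] by (rule abs_diff_triangle)
        then show ?thesis using ell_next[of i] unfolding \<rho>_def by linarith
      qed
      moreover have "f r \<in> Y (Suc i)" for r unfolding Y_def f_def using na(1,2)[of r] by blast
      moreover have "card (f ` R') = m i" using \<open>inj f\<close> R'(2) by (simp add: card_image inj_on_subset)
      ultimately show ?thesis using R'(3) by (intro exI[of _ "f ` R'"]) auto
    qed
    then obtain ch where ch: "\<And>i x. finite (ch i x)" "\<And>i x. card (ch i x) = m i" "\<And>i x. ch i x \<subseteq> Y (Suc i)"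
      "\<And>i x x'. x' \<in> ch i x \<Longrightarrow> \<bar>x' - x\<bar> \<le> \<rho> i - \<rho> (Suc i)" by metis
    \<comment> \<open>A root within \<open>1 / 4\<close> of the midpoint, together with
      \<open>\<rho> 0 \<le> 1 / 8\<close>, keeps the limit set inside the unit interval.\<close>
    obtain x0 where x0: "x0 \<in> Y 0" "\<bar>x0 - 1 / 2\<bar> \<le> 1 / 4"
    proof -
      let ?Q = "real (q (e 0))"
      obtain n a where na: "hw t (e 0) * q (e 0) < n" "n \<le> (hw t (e 0) + 1) * q (e 0)"
        "\<bar>(real n * \<theta> - of_int a) - real_of_int \<lfloor>?Q / 2\<rfloor> / ?Q\<bar> \<le> 6 * ell t (e 0)" using point[of 0 "\<lfloor>?Q / 2\<rfloor>"] by blast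
      have "?Q / 2 - 1 \<le> real_of_int \<lfloor>?Q / 2\<rfloor>" "real_of_int \<lfloor>?Q / 2\<rfloor> \<le> ?Q / 2" by linarith+
      then have "(?Q / 2 - 1) / ?Q \<le> real_of_int \<lfloor>?Q / 2\<rfloor> / ?Q" "real_of_int \<lfloor>?Q / 2\<rfloor> / ?Q \<le> ?Q / 2 / ?Q"
        by (intro divide_right_mono; simp)+
      then have "\<bar>real_of_int \<lfloor>?Q / 2\<rfloor> / ?Q - 1 / 2\<bar> \<le> 1 / ?Q" by (simp add: diff_divide_distrib)
      from abs_diff_triangle[OF this na(3)]
      have "\<bar>real n * \<theta> - of_int a - 1 / 2\<bar> \<le> 1 / ?Q + 6 * ell t (e 0)" .
      also have "\<dots> \<le> 7 * (1 / ?Q)" using ell_le[of 0] by linarith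
      also have "\<dots> \<le> 7 * (1 / 40)" using K7[OF eK[of 0]] by (intro mult_left_mono divide_left_mono) auto
      finally have "\<bar>real n * \<theta> - of_int a - 1 / 2\<bar> \<le> 1 / 4" by simp
      moreover have "real n * \<theta> - of_int a \<in> Y 0" unfolding Y_def using na by blast
      ultimately show ?thesis using that by blast
    qed
    interpret cantor_tree Y ch \<rho> \<epsilon> m x0
    proof
      show "x0 \<in> Y 0" by (rule x0)
    next
      fix i x x' assume "x \<in> Y i" "x' \<in> Y i" "x \<noteq> x'"
      then obtain n a n' a' where n: "hw t (e i) * q (e i) < n" "n \<le> (hw t (e i) + 1) * q (e i)" "x = real n * \<theta> - of_int a"
        "hw t (e i) * q (e i) < n'" "n' \<le> (hw t (e i) + 1) * q (e i)" "x' = real n' * \<theta> - of_int a'" unfolding Y_def by auto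
      then have "\<bar>int n - int n'\<bar> < int (q (e i))" by (auto simp: algebra_simps)
      then show "\<epsilon> i \<le> \<bar>x - x'\<bar>" unfolding \<epsilon>_def using orbit_sep n \<open>x \<noteq> x'\<close> by blast
    next
      fix i show "0 < \<rho> i" by (simp add: \<rho>_def)
      show "4 * \<rho> i \<le> \<epsilon> i" unfolding \<epsilon>_def \<rho>_def using ell_le[of i] by simp
      show "0 < m i" by (rule m_pos)
    next
      have "filterlim e sequentially sequentially"
        using e_less by (intro filterlim_subseq strict_mono_Suc_iff[THEN iffD2]) simp
      then have "filterlim (\<lambda>i. real (q (e i))) at_top sequentially" by (rule filterlim_compose[OF q_at_top])
      then have "(\<lambda>i. inverse (2 * real (q (e i)))) \<longlonglongrightarrow> 0"
        by (intro tendsto_inverse_0_at_top filterlim_tendsto_pos_mult_at_top[OF tendsto_const]) simp_all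
      then show "\<epsilon> \<longlonglongrightarrow> 0" unfolding \<epsilon>_def by (simp add: inverse_eq_divide)
    qed (use ch in auto)
    have sub: "limit_set \<subseteq> U_set \<tau> \<theta>"
    proof
      fix y assume "y \<in> limit_set"
      then obtain x where x: "x 0 = x0" "\<And>i. x i \<in> Y i" "\<And>i. \<bar>y - x i\<bar> \<le> \<rho> i" unfolding limit_set_def by auto
      have "good \<tau> y Q" if Q: "real (q K) \<le> Q" for Q
      proof -
        obtain k where k: "K \<le> k" "real (q k) \<le> Q" "Q < real (q (Suc k))" using q_bracket[OF Q] .
        show ?thesis
        proof (cases "k \<in> B")
          case True
          then obtain i where i: "k = e i" unfolding e_def using enumerate_Ex[OF inf] by metis
          obtain n a where na: "hw t k * q k < n" "n \<le> (hw t k + 1) * q k" "x i = real n * \<theta> - of_int a"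
            using x(2)[of i] unfolding Y_def i by auto
          show ?thesis
          proof (rule block_good)
            show "\<bar>y - (real n * \<theta> - of_int a)\<bar> \<le> ell t k / 8" using x(3)[of i] na(3) by (simp add: \<rho>_def i)
            show "3 \<le> real (q (Suc k)) powr (1 - \<tau>)" using K5[of "Suc k"] k by simp
            show "6 * 5 powr \<tau> \<le> real (q k) powr ((t - \<tau>) / (1 + t))" using K6 k by simp
          qed (use t tt na k in auto)
        next
          case False
          then show ?thesis using k by (intro trivial[of k])
        qed
      qed
      moreover have "0 \<le> y" "y < 1"
      proof -
        have "1 / real (q (e 0)) \<le> 1" using q_ge1[of "e 0"] by simp
        then have "\<rho> 0 \<le> 1 / 8" using ell_le[of 0] unfolding \<rho>_def by linarith
        then show "0 \<le> y" "y < 1" using x(3)[of 0] x(1) x0(2) by linarith+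
      qed
      ultimately show "y \<in> U_set \<tau> \<theta>" unfolding U_set_eq E_def by (auto intro!: exI[of _ "q K"])
    qed
    have L2: "L t2 (e i) = ell t2 (e i)" for i
    proof -
      have "ell t2 (e i) \<le> ell t (e i)" using tt by (intro ell_antimono) auto
      then show ?thesis using ell_le[of i] t by (simp add: L_small)
    qed
    have prod_m: "M t2 (e i) / M t2 (e 0) \<le> real (\<Prod>j<i. m j)" for i
    proof (induction i)
      case (Suc i)
      have "M t2 (e (Suc i)) \<le> M t2 (Suc (e i)) * real (q (e (Suc i))) / real (q (Suc (e i)))"
        using e_less[of i] by (intro M_run_le) simp
      also have "\<dots> = M t2 (e i) * (real (q (e (Suc i))) * ell t2 (e i))" by (simp add: M_def L2)
      finally have "M t2 (e (Suc i)) / M t2 (e 0) \<le> M t2 (e i) * (real (q (e (Suc i))) * ell t2 (e i)) / M t2 (e 0)"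
        by (rule divide_right_mono) (simp add: less_imp_le)
      also have "\<dots> = M t2 (e i) / M t2 (e 0) * (real (q (e (Suc i))) * ell t2 (e i))" by simp
      also have "\<dots> \<le> real (\<Prod>j<i. m j) * real (m i)"
        by (intro mult_mono Suc.IH m_ge) (auto intro: prod_nonneg)
      finally show ?case by simp
    qed simp
    have frost: "1 / (M t2 (e 0) * 2 powr s) \<le> real (\<Prod>j<i. m j) * (real (m i) * \<epsilon> (Suc i)) powr s" for i
    proof -
      have "1 / (M t2 (e 0) * 2 powr s) * 1 \<le> 1 / (M t2 (e 0) * 2 powr s) * (M t2 (e i) * L t2 (e i) powr s)"
        using frostman_const[OF K1[OF eK[of i]]] by (intro mult_left_mono) (auto simp: less_imp_le)
      also have "\<dots> = M t2 (e i) / M t2 (e 0) * (L t2 (e i) / 2) powr s" by (simp add: powr_divide)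
      also have "\<dots> \<le> real (\<Prod>j<i. m j) * (real (m i) * \<epsilon> (Suc i)) powr s"
      proof (intro mult_mono prod_m powr_mono2)
        have "L t2 (e i) / 2 = real (q (e (Suc i))) * ell t2 (e i) * \<epsilon> (Suc i)" by (simp add: \<epsilon>_def L2)
        also have "\<dots> \<le> real (m i) * \<epsilon> (Suc i)" by (intro mult_right_mono m_ge) (simp add: \<epsilon>_def)
        finally show "L t2 (e i) / 2 \<le> real (m i) * \<epsilon> (Suc i)" .
      qed (use s in \<open>auto intro!: prod_nonneg\<close>)
      finally show ?thesis by simp
    qed
    obtain c' where c': "0 < c'" "\<And>C::nat \<Rightarrow> real set. limit_set \<subseteq> (\<Union>i. C i) \<Longrightarrow> (\<And>i. bounded (C i)) \<Longrightarrow>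
        ennreal c' \<le> (\<Sum>i. ennreal (diameter (C i) powr s))"
      by (rule limit_set_content[OF s _ frost]) (simp, blast)
    show ?thesis
    proof (rule hausdorff_dim_ge[OF U_unit c'(1)])
      fix C :: "nat \<Rightarrow> real set" assume "U_set \<tau> \<theta> \<subseteq> (\<Union>i. C i)" "\<And>i. bounded (C i)"
      then show "ennreal c' \<le> (\<Sum>i. ennreal (diameter (C i) powr s))" using sub by (intro c'(2)) blast+
    qed
  qed
qed

end

section \<open>Continuity\<close>

context irrational
begin

lemma dim_le:
  assumes t: "0 < t" "t < \<tau>" "\<tau> < 1 \<or> 1 < t" and s: "0 \<le> s"
    and freq: "\<exists>\<^sub>F k in sequentially. ln (M t k) \<le> s * lam t k"
  shows "hausdorff_dim (U_set \<tau> \<theta>) \<le> s"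
proof (rule hausdorff_dim_le[OF s])
  fix s' assume "s < s'"
  have "coverable t (E \<tau> K)" for K
    using t(3)
  proof
    assume "\<tau> < 1"
    then show ?thesis using t by (intro E_coverable_small)
  next
    assume "1 < t"
    then show ?thesis using t by (intro E_coverable_large)
  qed
  then show "hnull s' (U_set \<tau> \<theta>)"
    unfolding U_set_eq using freq s \<open>s < s'\<close> by (intro hnull_UN coverable_hnull)
qed

lemma ln_M_nonneg: "0 \<le> ln (M t k)"
  unfolding ln_M using lam_le by (intro sum_nonneg) simp

text \<open>\<open>g\<close> is the liminf of the quotients at \<open>v\<close>, capped at 1. It
  bounds the dimension below because \<open>v > \<tau>\<close>; above, the quotients at
  \<open>u < \<tau>\<close> exceed those at \<open>v\<close> by at most the stated error, by
  \<open>ln_M_compare\<close>.\<close>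

lemma dim_oscillation:
  assumes \<theta>: "0 < \<theta>" "\<theta> < 1"
    and uv: "0 < u" "u < v" and C: "v < 1 \<and> C = 1 / (1 - v) \<or> 1 < u \<and> C = u / (u - 1)"
  obtains g where "\<And>\<tau>. u < \<tau> \<Longrightarrow> \<tau> < v \<Longrightarrow> g \<le> hausdorff_dim (U_set \<tau> \<theta>)"
    "\<And>\<tau>. u < \<tau> \<Longrightarrow> \<tau> < v \<Longrightarrow> hausdorff_dim (U_set \<tau> \<theta>) \<le> g + (sig v / sig u - 1) * (1 + C)"
proof -
  let ?\<eta> = "(sig v / sig u - 1) * (1 + C)"
  have C0: "0 \<le> C" using C uv by auto
  have "1 \<le> sig v / sig u" using sig_less[OF uv] sig_bounds[of u] uv by simp
  then have \<eta>: "0 \<le> ?\<eta>" using C0 by (intro mult_nonneg_nonneg) auto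
  define G where "G = {s. 0 \<le> s \<and> s \<le> 1 \<and> (\<forall>\<^sub>F k in sequentially. s * lam v k \<le> ln (M v k))}"
  have G0: "0 \<in> G" by (simp add: G_def ln_M_nonneg)
  have bdd: "bdd_above G" by (rule bdd_aboveI[of _ 1]) (simp add: G_def)
  define g where "g = Sup G"
  have g0: "0 \<le> g" unfolding g_def using G0 bdd by (rule cSup_upper)
  have unit: "U_set \<tau> \<theta> \<subseteq> {0..<1}" for \<tau> by (auto simp: U_set_def)
  have lower: "g \<le> hausdorff_dim (U_set \<tau> \<theta>)" if \<tau>: "u < \<tau>" "\<tau> < v" for \<tau>
    unfolding g_def
  proof (rule cSup_least)
    fix s assume "s \<in> G"
    then have s: "0 \<le> s" "s \<le> 1" "\<forall>\<^sub>F k in sequentially. s * lam v k \<le> ln (M v k)" by (auto simp: G_def)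
    show "s \<le> hausdorff_dim (U_set \<tau> \<theta>)"
    proof (cases "s = 0")
      case True
      then show ?thesis using hausdorff_dim_unit_nonneg[OF unit] by simp
    next
      case False
      then have "0 < s" using s by simp
      from C show ?thesis
      proof
        assume "v < 1 \<and> C = 1 / (1 - v)"
        then show ?thesis using \<open>0 < s\<close> s \<tau> uv by (intro dim_ge_small) auto
      next
        assume "1 < u \<and> C = u / (u - 1)"
        then show ?thesis using \<open>0 < s\<close> s \<tau> uv \<theta> by (intro dim_ge_large) auto
      qed
    qed
  qed (use G0 in auto)
  have upper: "hausdorff_dim (U_set \<tau> \<theta>) \<le> g + ?\<eta>" if \<tau>: "u < \<tau>" "\<tau> < v" for \<tau>
  proof (rule field_le_epsilon)
    fix e :: real assume "0 < e"
    \<comment> \<open>The cap at 1 meets the hypothesis of \<open>ln_M_compare\<close>; when it is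
      active, \<open>ln_M_le\<close> supplies the inequality at every \<open>k\<close>.\<close>
    define s where "s = min (g + e) 1"
    have s: "0 \<le> s" "s \<le> 1" "s \<le> g + e" using g0 \<open>0 < e\<close> by (auto simp: s_def)
    have "\<exists>\<^sub>F k in sequentially. ln (M v k) \<le> s * lam v k"
    proof (cases "g + e < 1")
      case True
      have "s \<notin> G"
      proof
        assume "s \<in> G"
        then have "s \<le> g" unfolding g_def using bdd by (rule cSup_upper)
        then show False using True \<open>0 < e\<close> by (simp add: s_def)
      qed
      then have "\<exists>\<^sub>F k in sequentially. \<not> s * lam v k \<le> ln (M v k)"
        using s by (simp add: G_def not_eventually)
      then show ?thesis by (rule frequently_elim1) simp
    next
      case False
      then have "s = 1" by (simp add: s_def)
      then show ?thesis using ln_M_le by (intro eventually_frequently always_eventually) auto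
    qed
    then have "\<exists>\<^sub>F k in sequentially. ln (M u k) \<le> (s + ?\<eta>) * lam u k"
      by (rule frequently_elim1) (rule ln_M_compare[OF uv C s(1,2)])
    then have "hausdorff_dim (U_set \<tau> \<theta>) \<le> s + ?\<eta>"
      using \<tau> uv C s \<eta> by (intro dim_le) auto
    then show "hausdorff_dim (U_set \<tau> \<theta>) \<le> g + ?\<eta> + e" using s by linarith
  qed
  from lower upper show ?thesis by (rule that)
qed

end

theorem theorem4:
  fixes \<theta> :: real
  assumes "\<theta> \<notin> \<rat>" and "0 < \<theta>" and "\<theta> < 1"
  shows "continuous_on ({0<..<1} \<union> {1<..}) (\<lambda>\<tau>. hausdorff_dim (U_set \<tau> \<theta>))"
  unfolding continuous_on_iff
proof (intro ballI allI impI)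
  interpret irrational \<theta> using assms(1) by unfold_locales
  fix \<tau>0 e :: real assume \<tau>0: "\<tau>0 \<in> {0<..<1} \<union> {1<..}" and "0 < e"
  \<comment> \<open>\<open>C \<delta>\<close> and \<open>\<eta> \<delta>\<close> are the constant
    and the error of \<open>dim_oscillation\<close> on the interval of radius
    \<open>\<delta>\<close> about \<open>\<tau>0\<close>. As \<open>\<delta>\<close> tends to 0,
    \<open>C\<close> stays bounded and the quotient of the \<open>sig\<close> values tends to 1, so
    \<open>\<eta>\<close> tends to 0.\<close>
  define C where "C \<delta> = (if \<tau>0 < 1 then 1 / (1 - (\<tau>0 + \<delta>)) else (\<tau>0 - \<delta>) / (\<tau>0 - \<delta> - 1))" for \<delta>
  define \<eta> where "\<eta> \<delta> = (sig (\<tau>0 + \<delta>) / sig (\<tau>0 - \<delta>) - 1) * (1 + C \<delta>)" for \<delta>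
  have "(C \<longlongrightarrow> C 0) (at_right 0)"
  proof (cases "\<tau>0 < 1")
    case True
    have "((\<lambda>\<delta>. 1 / (1 - (\<tau>0 + \<delta>))) \<longlongrightarrow> 1 / (1 - (\<tau>0 + 0))) (at_right 0)"
      using True by (intro tendsto_intros) auto
    then show ?thesis using True by (simp add: C_def[abs_def])
  next
    case False
    have "((\<lambda>\<delta>. (\<tau>0 - \<delta>) / (\<tau>0 - \<delta> - 1)) \<longlongrightarrow> (\<tau>0 - 0) / (\<tau>0 - 0 - 1)) (at_right 0)"
      using False \<tau>0 by (intro tendsto_intros) auto
    then show ?thesis using False by (simp add: C_def[abs_def])
  qed
  then have "(\<eta> \<longlongrightarrow> (sig (\<tau>0 + 0) / sig (\<tau>0 - 0) - 1) * (1 + C 0)) (at_right 0)"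
    unfolding \<eta>_def[abs_def] sig_def using \<tau>0 by (intro tendsto_intros) auto
  moreover have "sig \<tau>0 \<noteq> 0" using \<tau>0 by (auto simp: sig_def)
  ultimately have "(\<eta> \<longlongrightarrow> 0) (at_right 0)" by simp
  then have "\<forall>\<^sub>F \<delta> in at_right 0. \<eta> \<delta> < e" using \<open>0 < e\<close> by (rule order_tendstoD)
  \<comment> \<open>Such \<open>\<delta>\<close> keep the interval about \<open>\<tau>0\<close>
    positive and on one side of 1.\<close>
  moreover have "\<forall>\<^sub>F \<delta> in at_right 0. \<delta> \<in> {0<..<min \<tau>0 \<bar>1 - \<tau>0\<bar>}"
    using \<tau>0 by (intro eventually_at_right_real) auto
  ultimately have "\<forall>\<^sub>F \<delta> in at_right (0::real). \<eta> \<delta> < e \<and> \<delta> \<in> {0<..<min \<tau>0 \<bar>1 - \<tau>0\<bar>}"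
    by (rule eventually_conj)
  then obtain \<delta> where \<delta>: "\<eta> \<delta> < e" "0 < \<delta>" "\<delta> < \<tau>0" "\<delta> < \<bar>1 - \<tau>0\<bar>"
    using eventually_happens'[OF trivial_limit_at_right_real[of "0::real"]] by fastforce
  have C: "\<tau>0 + \<delta> < 1 \<and> C \<delta> = 1 / (1 - (\<tau>0 + \<delta>)) \<or> 1 < \<tau>0 - \<delta> \<and> C \<delta> = (\<tau>0 - \<delta>) / (\<tau>0 - \<delta> - 1)"
    using \<delta> by (cases "\<tau>0 < 1") (auto simp: C_def)
  obtain g where g: "\<And>\<tau>. \<tau>0 - \<delta> < \<tau> \<Longrightarrow> \<tau> < \<tau>0 + \<delta> \<Longrightarrow> g \<le> hausdorff_dim (U_set \<tau> \<theta>)"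
    "\<And>\<tau>. \<tau>0 - \<delta> < \<tau> \<Longrightarrow> \<tau> < \<tau>0 + \<delta> \<Longrightarrow> hausdorff_dim (U_set \<tau> \<theta>) \<le> g + \<eta> \<delta>"
    unfolding \<eta>_def
  proof (rule dim_oscillation[OF assms(2,3) _ _ C])
    show "0 < \<tau>0 - \<delta>" "\<tau>0 - \<delta> < \<tau>0 + \<delta>" using \<delta> by auto
  qed blast
  show "\<exists>d>0. \<forall>\<tau>\<in>{0<..<1} \<union> {1<..}. dist \<tau> \<tau>0 < d \<longrightarrow>
      dist (hausdorff_dim (U_set \<tau> \<theta>)) (hausdorff_dim (U_set \<tau>0 \<theta>)) < e"
  proof (intro exI[of _ \<delta>] conjI ballI impI)
    fix \<tau> assume "dist \<tau> \<tau>0 < \<delta>"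
    then have "\<tau>0 - \<delta> < \<tau>" "\<tau> < \<tau>0 + \<delta>" by (auto simp: dist_real_def)
    from g[OF this] g[of \<tau>0] \<delta> show "dist (hausdorff_dim (U_set \<tau> \<theta>)) (hausdorff_dim (U_set \<tau>0 \<theta>)) < e"
      unfolding dist_real_def by linarith
  qed (rule \<delta>(2))
qed

end
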